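(* Let $\mathcal{E}$ and $\mathcal{F}$ be spatial Arveson systems. Then, for any normalised units $u$ and $v$ of $\mathcal{E}$ and $\mathcal{F}$ respectively, $$\mathcal{E}\otimes_{u,v}\mathcal{F}\;\cong\;(\mathcal{E}\otimes\mathcal{F}^I)\bigvee(\mathcal{E}^I\otimes\mathcal{F}),$$ where the right-hand side is a product subsystem of the tensor product Arveson system $\mathcal{E}\otimes\mathcal{F}$.
   Context: A product system $\mathcal{E}$ is a family $(\mathcal{E}_t)_{t>0}$ of Hilbert spaces with unitary structure maps $B^{\mathcal{E}}_{s,t}:\mathcal{E}_{s+t}\to\mathcal{E}_s\otimes\mathcal{E}_t$ ($s,t>0$) satisfying $(I_{\mathcal{E}_r}\otimes B^{\mathcal{E}}_{s,t})B^{\mathcal{E}}_{r,s+t}=(B^{\mathcal{E}}_{r,s}\otimes I_{\mathcal{E}_t})B^{\mathcal{E}}_{r+s,t}$. For $x\in\mathcal{E}_s$, $y\in\mathcal{E}_t$, write $x\cdot y:=(B^{\mathcal{E}}_{s,t})^*(x\otimes y)$. An Arveson system is a product system with every $\mathcal{E}_t$ separable, equipped with a measurable structure: a countable family of sections $(e^n)_{n\ge1}$ such that $(e^n_t)_n$ is total in $\mathcal{E}_t$ for each $t$, and $t\mapsto\langle e^m_t,e^n_t\rangle$ and $(s,t)\mapsto\langle e^l_{s+t},e^m_s\cdot e^n_t\rangle$ are measurable; a section $x$ is measurable if $t\mapsto\langle e^n_t,x_t\rangle$ is measurable for all $n$. The tensor product $\mathcal{E}\otimes\mathcal{F}$ has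 fibres $\mathcal{E}_t\otimes\mathcal{F}_t$ and structure maps $B^{\mathcal{E}}_{s,t}\otimes B^{\mathcal{F}}_{s,t}$ followed by the flip of the two middle tensor factors. A morphism of product systems $\phi:\mathcal{E}\to\mathcal{F}$ is a family of bounded operators $\phi_t:\mathcal{E}_t\to\mathcal{F}_t$ with $B^{\mathcal{F}}_{s,t}\phi_{s+t}=(\phi_s\otimes\phi_t)B^{\mathcal{E}}_{s,t}$ and $\|\phi_t\|\le e^{kt}$ for some $k\in\mathbb{R}$; it is an isomorphism ($\cong$) if each $\phi_t$ is unitary. A product subsystem of $\mathcal{E}$ is a family of closed subspaces $\mathcal{G}_t\subset\mathcal{E}_t$ with $B^{\mathcal{E}}_{s,t}(\mathcal{G}_{s+t})=\mathcal{G}_s\otimes\mathcal{G}_t$. $\mathcal{G}^1\bigvee\mathcal{G}^2$ denotes the smallest product subsystem containing the product subsystems $\mathcal{G}^1$ and $\mathcal{G}^2$. A unit is a nonzero measurable section $u$ with $u_{s+t}=u_s\cdot u_t$; it is normalised if $\|u_t\|=1$ for all $t$. $\mathcal{E}$ is spatial if it has a unit. The type I part $\mathcal{E}^I$ is the smallest product subsystem of $\mathcal{E}$ containing all units of $\mathcal{E}$. Amalgamated product: for a contractive morphism $C:\mathcal{E}^2\to\mathcal{E}^1$ between Arveson systems there is a triple $(\mathcal{G},J^1,J^2)$, unique up to isomorphism, consisting of a product system $\mathcal{G}$ and isometric morphisms $J^i:\mathcal{E}^i\to\mathcal{G}$ such that $(J^1_t)^*J^2_t=C_t$ ($t>0$)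 and $\mathcal{G}=J^1(\mathcal{E}^1)\bigvee J^2(\mathcal{E}^2)$; one writes $\mathcal{G}=\mathcal{E}^1\otimes_C\mathcal{E}^2$. For normalised units $u$ of $\mathcal{E}$ and $v$ of $\mathcal{F}$, $\mathcal{E}\otimes_{u,v}\mathcal{F}:=\mathcal{E}\otimes_C\mathcal{F}$ where $C_t=|u_t\rangle\langle v_t|:\mathcal{F}_t\to\mathcal{E}_t$, $y\mapsto\langle v_t,y\rangle u_t$ (inner products linear in the second argument). *)

theory Defs
  imports "HOL-Analysis.Analysis"
begin

section \<open>Complex Hilbert spaces\<close>

text \<open>Inner products are conjugate linear in the first and linear in the second argument.\<close>

class complex_inner = real_normed_vector +
  fixes scaleC :: "complex \<Rightarrow> 'a \<Rightarrow> 'a" (infixr "*\<^sub>C" 75)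
    and cinner :: "'a \<Rightarrow> 'a \<Rightarrow> complex"
  assumes scaleR_scaleC: "r *\<^sub>R x = complex_of_real r *\<^sub>C x"
    and scaleC_add_right: "c *\<^sub>C (x + y) = c *\<^sub>C x + c *\<^sub>C y"
    and scaleC_add_left: "(c + d) *\<^sub>C x = c *\<^sub>C x + d *\<^sub>C x"
    and scaleC_scaleC: "c *\<^sub>C (d *\<^sub>C x) = (c * d) *\<^sub>C x"
    and cinner_commute: "cinner x y = cnj (cinner y x)"
    and cinner_add_right: "cinner x (y + z) = cinner x y + cinner x z"
    and cinner_scaleC_right: "cinner x (c *\<^sub>C y) = c * cinner x y"
    and norm_eq_sqrt_cinner: "norm x = sqrt (Re (cinner x x))"

class chilbert = complex_inner + complete_space

lemma cinner_add_left: "cinner (x + y) z = cinner x z + cinner y z"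
  by (metis cinner_add_right cinner_commute complex_cnj_add)

lemma cinner_scaleC_left: "cinner (c *\<^sub>C x) y = cnj c * cinner x y"
  by (metis cinner_commute cinner_scaleC_right complex_cnj_mult)

lemma cinner_zero_right [simp]: "cinner x 0 = 0"
  using cinner_add_right[of x 0 0] by simp

lemma cinner_zero_left [simp]: "cinner 0 x = 0"
  using cinner_add_left[of 0 0 x] by simp

lemma cinner_minus_right: "cinner x (- y) = - cinner x y"
  using cinner_add_right[of x y "- y"] by (simp add: eq_neg_iff_add_eq_0 add.commute)

lemma cinner_minus_left: "cinner (- x) y = - cinner x y"
  using cinner_add_left[of x "- x" y] by (simp add: eq_neg_iff_add_eq_0 add.commute)

lemma cinner_diff_right: "cinner x (y - z) = cinner x y - cinner x z"
  using cinner_add_right[of x y "- z"] by (simp add: cinner_minus_right)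

lemma cinner_diff_left: "cinner (x - y) z = cinner x z - cinner y z"
  using cinner_add_left[of x "- y" z] by (simp add: cinner_minus_left)

lemma cinner_self: "cinner x x = complex_of_real ((norm x)\<^sup>2)"
proof -
  have "Im (cinner x x) = 0"
    using arg_cong[OF cinner_commute[of x x], of Im] by simp
  moreover have "0 \<le> Re (cinner x x)"
    using norm_ge_zero[of x] by (simp add: norm_eq_sqrt_cinner)
  ultimately show ?thesis
    by (simp add: norm_eq_sqrt_cinner complex_eq_iff)
qed

lemma scaleC_one [simp]: "1 *\<^sub>C x = (x :: 'a::complex_inner)"
  using scaleR_scaleC[of 1 x] by simp

lemma scaleC_zero_left [simp]: "0 *\<^sub>C x = (0 :: 'a::complex_inner)"
  using scaleR_scaleC[of 0 x] by simp

lemma scaleC_zero_right [simp]: "c *\<^sub>C 0 = (0 :: 'a::complex_inner)"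
  using scaleC_add_right[of c 0 0] by simp

lemma scaleC_minus1: "(-1) *\<^sub>C x = - (x :: 'a::complex_inner)"
  using scaleR_scaleC[of "-1" x] by simp

lemma norm_scaleC: "norm (c *\<^sub>C x) = cmod c * norm (x :: 'a::complex_inner)"
proof -
  have "complex_of_real ((norm (c *\<^sub>C x))\<^sup>2) = complex_of_real ((cmod c)\<^sup>2 * (norm x)\<^sup>2)"
    unfolding of_real_mult complex_norm_square cinner_self[symmetric]
    by (simp add: cinner_scaleC_left cinner_scaleC_right)
  then have "(norm (c *\<^sub>C x))\<^sup>2 = (cmod c * norm x)\<^sup>2"
    unfolding of_real_eq_iff by (simp add: power_mult_distrib)
  then show ?thesis
    by simp
qed

lemma cinner_sum_right: "cinner x (sum f A) = (\<Sum>i\<in>A. cinner x (f i))"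
  by (induction A rule: infinite_finite_induct) (auto simp: cinner_add_right)

lemma cinner_sum_left: "cinner (sum f A) x = (\<Sum>i\<in>A. cinner (f i) x)"
  by (induction A rule: infinite_finite_induct) (auto simp: cinner_add_left)

lemma norm_diff_square:
  fixes x y :: "'a::complex_inner"
  shows "(norm (x - y))\<^sup>2 = (norm x)\<^sup>2 + (norm y)\<^sup>2 - 2 * Re (cinner x y)"
proof -
  have "complex_of_real ((norm (x - y))\<^sup>2)
      = cinner x x + cinner y y - (cinner x y + cnj (cinner x y))"
    unfolding cinner_self[symmetric]
    by (simp add: cinner_diff_left cinner_diff_right cinner_commute[of y x])
  then have "Re (complex_of_real ((norm (x - y))\<^sup>2))
      = Re (cinner x x + cinner y y - (cinner x y + cnj (cinner x y)))"
    by simp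
  then show ?thesis by (simp add: cinner_self)
qed

lemma complex_Cauchy_Schwarz:
  fixes x y :: "'a::complex_inner"
  shows "cmod (cinner x y) \<le> norm x * norm y"
proof (cases "y = 0")
  case False
  then have y: "norm y > 0" by simp
  define c where "c = cinner y x / complex_of_real ((norm y)\<^sup>2)"
  have cy: "cinner x (c *\<^sub>C y) = complex_of_real ((cmod (cinner x y))\<^sup>2 / (norm y)\<^sup>2)"
    unfolding c_def cinner_scaleC_right cinner_commute[of y x] of_real_divide complex_norm_square
    by simp
  have nc: "(norm (c *\<^sub>C y))\<^sup>2 = (cmod (cinner x y))\<^sup>2 / (norm y)\<^sup>2"
  proof -
    have "norm c = cmod (cinner x y) / (norm y)\<^sup>2"
      unfolding c_def norm_divide norm_of_real cinner_commute[of y x] by simp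
    then show ?thesis
      using y by (simp add: norm_scaleC power2_eq_square field_simps)
  qed
  have "0 \<le> (norm (x - c *\<^sub>C y))\<^sup>2" by simp
  also have "\<dots> = (norm x)\<^sup>2 - (cmod (cinner x y))\<^sup>2 / (norm y)\<^sup>2"
    unfolding norm_diff_square nc cy by simp
  finally have "(cmod (cinner x y))\<^sup>2 \<le> (norm x * norm y)\<^sup>2"
    using y by (simp add: field_simps)
  then show ?thesis
    by (rule power2_le_imp_le) simp
qed simp

lemma bounded_linear_cinner_right: "bounded_linear (cinner (x::'a::complex_inner))"
  by (rule bounded_linear_intro[where K = "norm x"])
     (simp_all add: cinner_add_right scaleR_scaleC[where 'a = 'a] cinner_scaleC_right
       scaleR_conv_of_real complex_Cauchy_Schwarz mult.commute[of "norm _" "norm x"])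

section \<open>Orthonormal bases\<close>

definition orthonormal :: "'a::complex_inner set \<Rightarrow> bool" where
  "orthonormal S \<longleftrightarrow> (\<forall>x\<in>S. \<forall>y\<in>S. cinner x y = (if x = y then 1 else 0))"

definition hbasis :: "'a::chilbert set" where
  "hbasis = (SOME S. orthonormal S \<and> (\<forall>T. orthonormal T \<longrightarrow> S \<subseteq> T \<longrightarrow> T = S))"

lemma hbasis_maximal:
  "orthonormal (hbasis :: 'a::chilbert set) \<and> (\<forall>T. orthonormal T \<longrightarrow> (hbasis :: 'a set) \<subseteq> T \<longrightarrow> T = hbasis)"
proof -
  have "\<exists>M\<in>Collect orthonormal. \<forall>X\<in>Collect orthonormal. M \<subseteq> X \<longrightarrow> X = (M :: 'a set)"
  proof (rule subset_Zorn')
    fix C assume C: "subset.chain (Collect orthonormal) (C :: 'a set set)"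
    have "orthonormal (\<Union>C)"
      unfolding orthonormal_def
    proof (intro ballI)
      fix x y assume "x \<in> \<Union>C" "y \<in> \<Union>C"
      then obtain A B where AB: "A \<in> C" "B \<in> C" "x \<in> A" "y \<in> B" by blast
      then have "A \<subseteq> B \<or> B \<subseteq> A" "orthonormal A" "orthonormal B"
        using C by (auto simp: subset.chain_def)
      with AB show "cinner x y = (if x = y then 1 else 0)"
        unfolding orthonormal_def by blast
    qed
    then show "\<Union>C \<in> Collect orthonormal" by simp
  qed
  then have "\<exists>M. orthonormal M \<and> (\<forall>T. orthonormal T \<longrightarrow> M \<subseteq> T \<longrightarrow> T = (M :: 'a set))"
    unfolding Bex_def Ball_def mem_Collect_eq by simp
  then show ?thesis
    unfolding hbasis_def by (rule someI_ex)
qed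

lemma hbasis_cinner:
  "a \<in> hbasis \<Longrightarrow> b \<in> hbasis \<Longrightarrow> cinner a b = (if a = b then 1 else 0)"
  by (rule hbasis_maximal[THEN conjunct1, unfolded orthonormal_def, rule_format])

lemma hbasis_orthogonal_imp_0:
  fixes x :: "'a::chilbert"
  assumes "\<And>b. b \<in> hbasis \<Longrightarrow> cinner b x = 0"
  shows "x = 0"
proof (rule ccontr)
  assume "x \<noteq> 0"
  define y where "y = complex_of_real (1 / norm x) *\<^sub>C x"
  have "norm y = 1"
    using \<open>x \<noteq> 0\<close> by (simp add: y_def norm_scaleC norm_divide)
  then have yy: "cinner y y = 1" by (simp add: cinner_self)
  have by0: "cinner b y = 0" "cinner y b = 0" if "b \<in> hbasis" for b
    using assms[OF that] cinner_commute[of y b] by (auto simp: y_def cinner_scaleC_right)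
  have "y \<notin> hbasis" using yy by0(1)[of y] by auto
  then have ne: "b \<noteq> y" "y \<noteq> b" if "b \<in> hbasis" for b using that by auto
  have "orthonormal (insert y hbasis)"
    unfolding orthonormal_def ball_simps insert_iff
    by (intro conjI ballI) (simp_all add: yy by0 ne hbasis_cinner)
  from hbasis_maximal[THEN conjunct2, rule_format, OF this] have "insert y hbasis = hbasis"
    by (rule meta_mp) auto
  then have "y \<in> hbasis" by auto
  then show False using yy by0(1)[of y] by simp
qed

lemma bessel_residual:
  fixes x :: "'a::chilbert"
  assumes "finite F" "F \<subseteq> hbasis"
  shows "(norm (x - (\<Sum>b\<in>F. cinner b x *\<^sub>C b)))\<^sup>2 = (norm x)\<^sup>2 - (\<Sum>b\<in>F. (cmod (cinner b x))\<^sup>2)"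
    and "(norm (\<Sum>b\<in>F. cinner b x *\<^sub>C b))\<^sup>2 = (\<Sum>b\<in>F. (cmod (cinner b x))\<^sup>2)"
proof -
  let ?s = "\<Sum>b\<in>F. cinner b x *\<^sub>C b"
  have bs: "cinner b ?s = cinner b x" if "b \<in> F" for b
  proof -
    have "cinner b ?s = (\<Sum>a\<in>F. if a = b then cinner a x else 0)"
      unfolding cinner_sum_right
      using assms that by (intro sum.cong) (auto simp: cinner_scaleC_right hbasis_cinner subset_iff)
    also have "\<dots> = cinner b x" using assms that by simp
    finally show ?thesis .
  qed
  have xs: "cinner x ?s = complex_of_real (\<Sum>b\<in>F. (cmod (cinner b x))\<^sup>2)"
    by (simp add: cinner_sum_right cinner_scaleC_right cinner_commute[of x] complex_norm_square
        del: of_real_power)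
  have ss: "cinner ?s ?s = complex_of_real (\<Sum>b\<in>F. (cmod (cinner b x))\<^sup>2)"
    by (simp add: cinner_sum_left cinner_scaleC_left bs complex_norm_square mult.commute
        del: of_real_power)
  then show n: "(norm ?s)\<^sup>2 = (\<Sum>b\<in>F. (cmod (cinner b x))\<^sup>2)"
    unfolding cinner_self of_real_eq_iff .
  show "(norm (x - ?s))\<^sup>2 = (norm x)\<^sup>2 - (\<Sum>b\<in>F. (cmod (cinner b x))\<^sup>2)"
    unfolding norm_diff_square n xs by simp
qed

lemma parseval_norm:
  fixes x :: "'a::chilbert"
  shows "((\<lambda>b. (cmod (cinner b x))\<^sup>2) has_sum (norm x)\<^sup>2) hbasis"
proof -
  let ?f = "\<lambda>b. (cmod (cinner b x))\<^sup>2"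
  have le: "sum ?f F \<le> (norm x)\<^sup>2" if "finite F" "F \<subseteq> hbasis" for F
    using bessel_residual(1)[OF that, of x] zero_le_power2[of "norm (x - (\<Sum>b\<in>F. cinner b x *\<^sub>C b))"]
    by linarith
  have summ: "?f summable_on hbasis"
    by (rule nonneg_bdd_above_summable_on) (auto intro!: bdd_aboveI2[where M = "(norm x)\<^sup>2"] le)
  define \<alpha> where "\<alpha> = infsum ?f hbasis"
  have hs: "(?f has_sum \<alpha>) hbasis" using summ by (simp add: \<alpha>_def)
  have "\<exists>F. finite F \<and> F \<subseteq> hbasis \<and> \<alpha> - sum ?f F < 1 / real (Suc n)" for n
  proof -
    define d where "d = 1 / real (Suc n)"
    have "d > 0" by (simp add: d_def)
    then obtain F where F: "finite F" "F \<subseteq> hbasis" "dist (sum ?f F) \<alpha> \<le> d / 2"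
      using has_sum_finite_approximation[OF hs, of "d / 2"] by auto
    have "\<alpha> - sum ?f F < d" using F(3) \<open>d > 0\<close> unfolding dist_real_def by linarith
    then have "finite F \<and> F \<subseteq> hbasis \<and> \<alpha> - sum ?f F < 1 / real (Suc n)"
      using F(1,2) unfolding d_def by (intro conjI)
    then show ?thesis by (rule exI)
  qed
  then obtain F0 where F0: "\<And>n. finite (F0 n)" "\<And>n. F0 n \<subseteq> hbasis"
      "\<And>n. \<alpha> - sum ?f (F0 n) < 1 / real (Suc n)" by metis
  define F where "F n = (\<Union>k\<le>n. F0 k)" for n
  have F: "finite (F n)" "F n \<subseteq> hbasis" for n
    using F0 by (auto simp: F_def)
  have Fn: "\<alpha> - sum ?f (F n) < 1 / real (Suc n)" for n
  proof -
    have "sum ?f (F0 n) \<le> sum ?f (F n)"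
      by (rule sum_mono2[OF F(1)]) (auto simp: F_def)
    with F0(3)[of n] show ?thesis by simp
  qed
  have le\<alpha>: "sum ?f A \<le> \<alpha>" if "finite A" "A \<subseteq> hbasis" for A
    by (rule finite_sum_le_has_sum[OF hs that]) auto
  define s where "s n = (\<Sum>b\<in>F n. cinner b x *\<^sub>C b)" for n
  have sdiff: "(norm (s m - s n))\<^sup>2 < 1 / real (Suc n)" if "n \<le> m" for m n
  proof -
    have sub: "F n \<subseteq> F m" using that by (auto simp: F_def intro: order_trans)
    have "s m - s n = (\<Sum>b\<in>F m - F n. cinner b x *\<^sub>C b)"
      unfolding s_def using F(1) sub by (simp add: sum_diff)
    then have "(norm (s m - s n))\<^sup>2 = sum ?f (F m - F n)"
      using bessel_residual(2)[of "F m - F n" x] F by auto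
    also have "\<dots> = sum ?f (F m) - sum ?f (F n)"
      using F(1) sub by (simp add: sum_diff)
    also have "\<dots> < 1 / real (Suc n)"
      using le\<alpha>[OF F, of m] Fn[of n] by linarith
    finally show ?thesis .
  qed
  have "Cauchy s"
  proof (rule CauchyI')
    fix e :: real assume "0 < e"
    then obtain N where N: "1 / real (Suc N) < e\<^sup>2"
      using nat_approx_posE[of "e\<^sup>2"] by auto
    have "dist (s m) (s n) < e" if "N \<le> m" "m < n" for m n
    proof -
      have "(norm (s n - s m))\<^sup>2 < 1 / real (Suc m)" using sdiff[of m n] that by simp
      also have "\<dots> \<le> 1 / real (Suc N)" using that by (simp add: field_simps)
      finally have "(norm (s n - s m))\<^sup>2 < e\<^sup>2" using N by linarith
      then show ?thesis
        using \<open>0 < e\<close> by (metis dist_commute dist_norm less_imp_le power_less_imp_less_base)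
    qed
    then show "\<exists>M. \<forall>m\<ge>M. \<forall>n>m. dist (s m) (s n) < e" by blast
  qed
  then obtain z where z: "s \<longlonglongrightarrow> z"
    using Cauchy_convergent convergent_def by blast
  have "x - z = 0"
  proof (rule hbasis_orthogonal_imp_0)
    fix b :: 'a assume b: "b \<in> hbasis"
    have lim: "(\<lambda>n. cinner b (s n)) \<longlonglongrightarrow> cinner b z"
      by (rule bounded_linear.tendsto[OF bounded_linear_cinner_right z])
    have bs: "cinner b (s n) = (if b \<in> F n then cinner b x else 0)" for n
    proof -
      have "cinner b (s n) = (\<Sum>a\<in>F n. if a = b then cinner a x else 0)"
        unfolding s_def cinner_sum_right
        using F b by (intro sum.cong) (auto simp: cinner_scaleC_right hbasis_cinner subset_iff)
      then show ?thesis using F by simp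
    qed
    have "cinner b z = cinner b x"
    proof (cases "\<exists>k. b \<in> F k")
      case True
      then obtain k where k: "b \<in> F k" by blast
      have "b \<in> F n" if "n \<ge> k" for n
        using k that by (auto simp: F_def intro: order_trans)
      then have "\<forall>\<^sub>F n in sequentially. cinner b (s n) = cinner b x"
        unfolding eventually_sequentially bs by auto
      then show ?thesis
        by (rule LIMSEQ_unique[OF lim tendsto_eventually])
    next
      case False
      then have "cinner b z = 0"
        using lim bs by (simp add: LIMSEQ_const_iff)
      moreover have "?f b \<le> 1 / real (Suc n)" for n
      proof -
        have "sum ?f (insert b (F n)) \<le> \<alpha>"
          by (rule le\<alpha>) (use F b in auto)
        then show ?thesis using False F Fn[of n] by simp
      qed
      then have "\<not> 0 < ?f b"
        by (meson nat_approx_posE not_less)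
      then have "?f b = 0" using zero_le_power2[of "cmod (cinner b x)"] by linarith
      ultimately show ?thesis by simp
    qed
    then show "cinner b (x - z) = 0" by (simp add: cinner_diff_right)
  qed
  then have "x = z" by simp
  have "(\<lambda>n. (norm (s n))\<^sup>2) \<longlonglongrightarrow> (norm x)\<^sup>2"
    using z \<open>x = z\<close> by (intro tendsto_intros) auto
  moreover have "(norm (s n))\<^sup>2 \<le> \<alpha>" for n
    unfolding s_def using bessel_residual(2)[OF F] le\<alpha>[OF F] by simp
  ultimately have "(norm x)\<^sup>2 \<le> \<alpha>"
    by (meson LIMSEQ_le_const2)
  moreover have "\<alpha> \<le> (norm x)\<^sup>2"
    by (rule has_sum_le_finite_sums[OF hs]) (use le in auto)
  ultimately have "\<alpha> = (norm x)\<^sup>2" by (rule antisym[rotated])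
  with hs show ?thesis by simp
qed

lemma polarization:
  fixes x y :: "'a::complex_inner"
  shows "cinner x y = (complex_of_real ((norm (x + y))\<^sup>2) - complex_of_real ((norm (x - y))\<^sup>2)
    - \<i> * complex_of_real ((norm (x + \<i> *\<^sub>C y))\<^sup>2) + \<i> * complex_of_real ((norm (x - \<i> *\<^sub>C y))\<^sup>2)) / 4"
  unfolding cinner_self[symmetric]
  by (simp add: cinner_add_left cinner_add_right cinner_diff_left cinner_diff_right
      cinner_scaleC_left cinner_scaleC_right algebra_simps)

lemma polarization_complex:
  fixes w z :: complex
  shows "cnj w * z = (complex_of_real ((cmod (w + z))\<^sup>2) - complex_of_real ((cmod (w - z))\<^sup>2)
    - \<i> * complex_of_real ((cmod (w + \<i> * z))\<^sup>2) + \<i> * complex_of_real ((cmod (w - \<i> * z))\<^sup>2)) / 4"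
  unfolding complex_norm_square by (simp add: algebra_simps)

lemma parseval:
  fixes x y :: "'a::chilbert"
  shows "((\<lambda>b. cnj (cinner b x) * cinner b y) has_sum cinner x y) hbasis"
proof -
  have *: "((\<lambda>b. complex_of_real ((cmod (cinner b z))\<^sup>2)) has_sum complex_of_real ((norm z)\<^sup>2)) hbasis"
    for z :: 'a
    by (rule has_sum_of_real[OF parseval_norm])
  have four: "(p - q - \<i> * r + \<i> * s) / 4 = 1/4 * (p + (-1) * q + (-\<i>) * r + \<i> * s)" for p q r s
    by simp
  have eq: "cnj (cinner b x) * cinner b y = 1/4 * (complex_of_real ((cmod (cinner b (x + y)))\<^sup>2)
      + (-1) * complex_of_real ((cmod (cinner b (x - y)))\<^sup>2)
      + (-\<i>) * complex_of_real ((cmod (cinner b (x + \<i> *\<^sub>C y)))\<^sup>2)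
      + \<i> * complex_of_real ((cmod (cinner b (x - \<i> *\<^sub>C y)))\<^sup>2))" for b
    unfolding cinner_add_right cinner_diff_right cinner_scaleC_right
    by (rule trans[OF polarization_complex four])
  have eq': "cinner x y = 1/4 * (complex_of_real ((norm (x + y))\<^sup>2)
      + (-1) * complex_of_real ((norm (x - y))\<^sup>2)
      + (-\<i>) * complex_of_real ((norm (x + \<i> *\<^sub>C y))\<^sup>2)
      + \<i> * complex_of_real ((norm (x - \<i> *\<^sub>C y))\<^sup>2))"
    by (rule trans[OF polarization four])
  show ?thesis
    unfolding eq'
  proof (rule has_sum_cong[THEN iffD1])
    show "((\<lambda>b. 1/4 * (complex_of_real ((cmod (cinner b (x + y)))\<^sup>2)
      + (-1) * complex_of_real ((cmod (cinner b (x - y)))\<^sup>2)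
      + (-\<i>) * complex_of_real ((cmod (cinner b (x + \<i> *\<^sub>C y)))\<^sup>2)
      + \<i> * complex_of_real ((cmod (cinner b (x - \<i> *\<^sub>C y)))\<^sup>2))) has_sum
      1/4 * (complex_of_real ((norm (x + y))\<^sup>2)
      + (-1) * complex_of_real ((norm (x - y))\<^sup>2)
      + (-\<i>) * complex_of_real ((norm (x + \<i> *\<^sub>C y))\<^sup>2)
      + \<i> * complex_of_real ((norm (x - \<i> *\<^sub>C y))\<^sup>2))) hbasis"
      by (rule has_sum_cmult_right, rule has_sum_add, rule has_sum_add, rule has_sum_add, rule *,
          rule has_sum_cmult_right, rule *, rule has_sum_cmult_right, rule *, rule has_sum_cmult_right, rule *)
  qed (rule eq[symmetric])
qed

section \<open>The Hilbert space tensor product\<close>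

definition square_summable :: "('i \<Rightarrow> complex) \<Rightarrow> bool" where
  "square_summable f \<longleftrightarrow> (\<lambda>i. (cmod (f i))\<^sup>2) summable_on UNIV"

definition l2norm :: "('i \<Rightarrow> complex) \<Rightarrow> real" where
  "l2norm f = sqrt (\<Sum>\<^sub>\<infinity>i. (cmod (f i))\<^sup>2)"

lemma l2norm_nonneg [simp]: "0 \<le> l2norm f"
  by (simp add: l2norm_def infsum_nonneg)

lemma L2_set_le_l2norm:
  "square_summable f \<Longrightarrow> finite F \<Longrightarrow> L2_set (\<lambda>i. cmod (f i)) F \<le> l2norm f"
  unfolding L2_set_def l2norm_def square_summable_def
  by (auto intro!: finite_sum_le_infsum)

lemma square_summableI:
  assumes "\<And>F. finite F \<Longrightarrow> L2_set (\<lambda>i. cmod (f i)) F \<le> C"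
  shows "square_summable f" and "l2norm f \<le> C"
proof -
  have "0 \<le> C" using assms[of "{}"] by simp
  then have le: "(\<Sum>i\<in>F. (cmod (f i))\<^sup>2) \<le> C\<^sup>2" if "finite F" for F
    using assms[OF that] by (simp add: L2_set_def sqrt_le_D)
  show ss: "square_summable f"
    unfolding square_summable_def
    by (rule nonneg_bdd_above_summable_on) (auto intro!: bdd_aboveI2[where M = "C\<^sup>2"] le)
  have "(\<Sum>\<^sub>\<infinity>i. (cmod (f i))\<^sup>2) \<le> C\<^sup>2"
    by (rule infsum_le_finite_sums[OF ss[unfolded square_summable_def]]) (use le in auto)
  then show "l2norm f \<le> C"
    unfolding l2norm_def using \<open>0 \<le> C\<close> by (rule real_le_lsqrt[rotated])
qed

lemma square_summable_add:
  assumes "square_summable f" "square_summable g"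
  shows "square_summable (\<lambda>i. f i + g i)" and "l2norm (\<lambda>i. f i + g i) \<le> l2norm f + l2norm g"
proof -
  have "L2_set (\<lambda>i. cmod (f i + g i)) F \<le> l2norm f + l2norm g" if "finite F" for F
  proof -
    have "L2_set (\<lambda>i. cmod (f i + g i)) F \<le> L2_set (\<lambda>i. cmod (f i) + cmod (g i)) F"
      by (rule L2_set_mono) (auto intro: norm_triangle_ineq)
    also have "\<dots> \<le> L2_set (\<lambda>i. cmod (f i)) F + L2_set (\<lambda>i. cmod (g i)) F"
      by (rule L2_set_triangle_ineq)
    finally show ?thesis
      using L2_set_le_l2norm[OF assms(1) that] L2_set_le_l2norm[OF assms(2) that] by linarith
  qed
  then show "square_summable (\<lambda>i. f i + g i)" "l2norm (\<lambda>i. f i + g i) \<le> l2norm f + l2norm g"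
    by (rule square_summableI; simp)+
qed

lemma square_summable_scale:
  assumes "square_summable f"
  shows "square_summable (\<lambda>i. c * f i)"
  using assms unfolding square_summable_def
  by (simp add: norm_mult power_mult_distrib summable_on_cmult_right)

lemma l2norm_scale: "l2norm (\<lambda>i. c * f i) = cmod c * l2norm f"
  unfolding l2norm_def
  by (simp add: norm_mult power_mult_distrib infsum_cmult_right' real_sqrt_mult)

lemma square_summable_minus: "square_summable f \<Longrightarrow> square_summable (\<lambda>i. - f i)"
  by (simp add: square_summable_def)

lemma square_summable_mult:
  assumes "square_summable f" "square_summable g"
  shows "(\<lambda>i. cnj (f i) * g i) summable_on UNIV"
proof (rule abs_summable_summable, rule abs_summable_product)
  show "(\<lambda>i. norm (cnj (f i) * cnj (f i))) summable_on UNIV"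
    using assms(1) by (simp add: square_summable_def norm_mult power2_eq_square)
  show "(\<lambda>i. norm (g i * g i)) summable_on UNIV"
    using assms(2) by (simp add: square_summable_def norm_mult power2_eq_square)
qed

lemma l2norm_eq_0:
  assumes "square_summable f" "l2norm f = 0"
  shows "f i = 0"
  using L2_set_le_l2norm[OF assms(1), of "{i}"] assms(2) by (simp add: L2_set_def)

text \<open>The tensor product of two Hilbert spaces, realised as the square summable functions on the
  product of chosen orthonormal bases. It does not depend on the bases up to the unique unitary
  fixing the elementary tensors: these satisfy \<open>cinner_tensor\<close> below and are total, which
  determines the tensor product.\<close>

typedef (overloaded) ('a::chilbert, 'b::chilbert) htensor =
  "{f :: 'a \<times> 'b \<Rightarrow> complex. square_summable f \<and> (\<forall>p. p \<notin> hbasis \<times> hbasis \<longrightarrow> f p = 0)}"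
  morphisms hcoeff Abs_htensor
  by (rule exI[of _ "\<lambda>_. 0"]) (simp add: square_summable_def)

lemma square_summable_hcoeff [simp]: "square_summable (hcoeff z)"
  using hcoeff[of z] by simp

lemma hcoeff_outside: "p \<notin> hbasis \<times> hbasis \<Longrightarrow> hcoeff z p = 0"
  using hcoeff[of z] by blast

instantiation htensor :: (chilbert, chilbert) complex_inner
begin

definition "0 = Abs_htensor (\<lambda>_. 0)"
definition "x + y = Abs_htensor (\<lambda>p. hcoeff x p + hcoeff y p)"
definition "- x = Abs_htensor (\<lambda>p. - hcoeff x p)"
definition "x - y = Abs_htensor (\<lambda>p. hcoeff x p - hcoeff y p)" for x y :: "('a, 'b) htensor"
definition "c *\<^sub>C x = Abs_htensor (\<lambda>p. c * hcoeff x p)"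
definition "r *\<^sub>R x = complex_of_real r *\<^sub>C x" for x :: "('a, 'b) htensor"
definition "cinner x y = (\<Sum>\<^sub>\<infinity>p. cnj (hcoeff x p) * hcoeff y p)"
definition "norm x = l2norm (hcoeff x)"
definition "dist x y = norm (x - y)" for x y :: "('a, 'b) htensor"
definition "sgn x = inverse (norm x) *\<^sub>R x" for x :: "('a, 'b) htensor"
definition [code del]:
  "(uniformity :: (('a, 'b) htensor \<times> ('a, 'b) htensor) filter) = (INF e\<in>{0<..}. principal {(x, y). dist x y < e})"
definition [code del]:
  "open (U :: ('a, 'b) htensor set) \<longleftrightarrow> (\<forall>x\<in>U. \<forall>\<^sub>F (x', y) in uniformity. x' = x \<longrightarrow> y \<in> U)"

lemma hcoeff_zero: "hcoeff (0 :: ('a, 'b) htensor) p = 0"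
  unfolding zero_htensor_def by (subst Abs_htensor_inverse) (auto simp: square_summable_def)

lemma hcoeff_add: "hcoeff (x + y :: ('a, 'b) htensor) p = hcoeff x p + hcoeff y p"
  unfolding plus_htensor_def
  by (subst Abs_htensor_inverse) (auto simp: square_summable_add hcoeff_outside)

lemma hcoeff_minus: "hcoeff (- x :: ('a, 'b) htensor) p = - hcoeff x p"
  unfolding uminus_htensor_def
  by (subst Abs_htensor_inverse) (auto simp: square_summable_minus hcoeff_outside)

lemma hcoeff_diff: "hcoeff (x - y :: ('a, 'b) htensor) p = hcoeff x p - hcoeff y p"
  unfolding minus_htensor_def
  using square_summable_add(1)[OF square_summable_hcoeff[of x] square_summable_minus[OF square_summable_hcoeff[of y]]]
  by (subst Abs_htensor_inverse) (auto simp: hcoeff_outside)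

lemma hcoeff_scaleC: "hcoeff (c *\<^sub>C x :: ('a, 'b) htensor) p = c * hcoeff x p"
  unfolding scaleC_htensor_def
  by (subst Abs_htensor_inverse) (auto simp: square_summable_scale hcoeff_outside)

lemmas hcoeff_simps = hcoeff_zero hcoeff_add hcoeff_minus hcoeff_diff hcoeff_scaleC

lemma htensor_eqI: "(\<And>p. hcoeff x p = hcoeff y p) \<Longrightarrow> x = y"
  by (simp add: hcoeff_inject[symmetric] ext)

lemma htensor_summable: "(\<lambda>p. cnj (hcoeff x p) * hcoeff y p) summable_on UNIV"
  by (simp add: square_summable_mult)

instance
proof
  fix x y z :: "('a, 'b) htensor" and r s :: real and c d :: complex
  show "x + y + z = x + (y + z)" "x + y = y + x" "0 + x = x" "- x + x = 0" "x - y = x + - y"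
    by (auto intro!: htensor_eqI simp: hcoeff_simps)
  show "r *\<^sub>R (x + y) = r *\<^sub>R x + r *\<^sub>R y" "(r + s) *\<^sub>R x = r *\<^sub>R x + s *\<^sub>R x"
    "r *\<^sub>R s *\<^sub>R x = (r * s) *\<^sub>R x" "1 *\<^sub>R x = x"
    by (auto intro!: htensor_eqI simp: scaleR_htensor_def hcoeff_simps algebra_simps)
  show "dist x y = norm (x - y)" by (rule dist_htensor_def)
  show "sgn x = inverse (norm x) *\<^sub>R x" by (rule sgn_htensor_def)
  show "(uniformity :: (('a, 'b) htensor \<times> ('a, 'b) htensor) filter)
      = (INF e\<in>{0<..}. principal {(x, y). dist x y < e})"
    by (rule uniformity_htensor_def)
  show "open U \<longleftrightarrow> (\<forall>x\<in>U. \<forall>\<^sub>F (x', y) in uniformity. x' = x \<longrightarrow> y \<in> U)" for U :: "('a, 'b) htensor set"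
    by (rule open_htensor_def)
  have "norm (0 :: ('a, 'b) htensor) = 0"
    by (simp add: norm_htensor_def l2norm_def hcoeff_simps)
  moreover have "norm x = 0 \<Longrightarrow> x = 0"
    using l2norm_eq_0[of "hcoeff x"] by (intro htensor_eqI) (auto simp: norm_htensor_def hcoeff_simps)
  ultimately show "(norm x = 0) = (x = 0)" by blast
  have "hcoeff (x + y) = (\<lambda>p. hcoeff x p + hcoeff y p)" by (rule ext) (rule hcoeff_add)
  then show "norm (x + y) \<le> norm x + norm y"
    unfolding norm_htensor_def using square_summable_add(2) square_summable_hcoeff by metis
  have "hcoeff (r *\<^sub>R x) = (\<lambda>p. complex_of_real r * hcoeff x p)"
    by (rule ext) (simp add: scaleR_htensor_def hcoeff_simps)
  then show "norm (r *\<^sub>R x) = \<bar>r\<bar> * norm x"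
    unfolding norm_htensor_def by (simp add: l2norm_scale)
  show "r *\<^sub>R x = complex_of_real r *\<^sub>C x" by (rule scaleR_htensor_def)
  show "c *\<^sub>C (x + y) = c *\<^sub>C x + c *\<^sub>C y" "(c + d) *\<^sub>C x = c *\<^sub>C x + d *\<^sub>C x"
    "c *\<^sub>C d *\<^sub>C x = (c * d) *\<^sub>C x"
    by (auto intro!: htensor_eqI simp: hcoeff_simps algebra_simps)
  show "cinner x y = cnj (cinner y x)"
    unfolding cinner_htensor_def infsum_cnj[symmetric] by (simp add: mult.commute)
  show "cinner x (y + z) = cinner x y + cinner x z"
    unfolding cinner_htensor_def
    by (simp add: hcoeff_simps distrib_left infsum_add htensor_summable)
  have lc: "cnj (hcoeff x p) * (c * hcoeff y p) = c * (cnj (hcoeff x p) * hcoeff y p)" for p by simp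
  show "cinner x (c *\<^sub>C y) = c * cinner x y"
    unfolding cinner_htensor_def hcoeff_scaleC lc by (rule infsum_cmult_right')
  have "complex_of_real (\<Sum>\<^sub>\<infinity>p. (cmod (hcoeff x p))\<^sup>2) = cinner x x"
    unfolding cinner_htensor_def
    using has_sum_of_real[OF has_sum_infsum[OF square_summable_hcoeff[of x, unfolded square_summable_def]],
        where 'a = complex]
    by (intro infsumI[symmetric]) (simp only: complex_norm_square mult.commute)
  then show "norm x = sqrt (Re (cinner x x))"
    unfolding norm_htensor_def l2norm_def by (metis Re_complex_of_real)
qed

end

instance htensor :: (chilbert, chilbert) chilbert
proof
  fix X :: "nat \<Rightarrow> ('a, 'b) htensor" assume X: "Cauchy X"
  have le: "cmod (hcoeff x p) \<le> norm x" for x :: "('a, 'b) htensor" and p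
    using L2_set_le_l2norm[OF square_summable_hcoeff[of x], of "{p}"]
    by (simp add: L2_set_def norm_htensor_def)
  have "Cauchy (\<lambda>n. hcoeff (X n) p)" for p
  proof (rule metric_CauchyI)
    fix e :: real assume "0 < e"
    then obtain N where N: "\<And>m n. m \<ge> N \<Longrightarrow> n \<ge> N \<Longrightarrow> dist (X m) (X n) < e"
      using metric_CauchyD[OF X] by blast
    have "dist (hcoeff (X m) p) (hcoeff (X n) p) < e" if "m \<ge> N" "n \<ge> N" for m n
      using le[of "X m - X n" p] N[OF that] by (simp add: dist_norm hcoeff_simps)
    then show "\<exists>M. \<forall>m\<ge>M. \<forall>n\<ge>M. dist (hcoeff (X m) p) (hcoeff (X n) p) < e" by blast
  qed
  then have "\<forall>p. \<exists>l. (\<lambda>n. hcoeff (X n) p) \<longlonglongrightarrow> l"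
    using Cauchy_convergent unfolding convergent_def by blast
  from choice[OF this] obtain f where f: "\<And>p. (\<lambda>n. hcoeff (X n) p) \<longlonglongrightarrow> f p"
    by (elim exE) (rule that, rule spec)
  have f0: "f p = 0" if "p \<notin> hbasis \<times> hbasis" for p
    using f[of p] that by (simp add: hcoeff_outside LIMSEQ_const_iff)
  have close: "L2_set (\<lambda>p. cmod (hcoeff (X n) p - f p)) F \<le> e"
    if N: "\<And>m n. m \<ge> N \<Longrightarrow> n \<ge> N \<Longrightarrow> dist (X m) (X n) < e" and n: "n \<ge> N" and F: "finite F" for N n e F
  proof (rule LIMSEQ_le_const2)
    show "(\<lambda>m. L2_set (\<lambda>p. cmod (hcoeff (X n) p - hcoeff (X m) p)) F)
        \<longlonglongrightarrow> L2_set (\<lambda>p. cmod (hcoeff (X n) p - f p)) F"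
      unfolding L2_set_def by (intro tendsto_intros f)
    have "L2_set (\<lambda>p. cmod (hcoeff (X n) p - hcoeff (X m) p)) F \<le> e" if "m \<ge> N" for m
      using L2_set_le_l2norm[OF square_summable_hcoeff[of "X n - X m"] F] N[OF n that]
      by (simp add: hcoeff_simps dist_norm norm_htensor_def)
    then show "\<exists>N. \<forall>m\<ge>N. L2_set (\<lambda>p. cmod (hcoeff (X n) p - hcoeff (X m) p)) F \<le> e" by blast
  qed
  obtain N1 where N1: "\<And>m n. m \<ge> N1 \<Longrightarrow> n \<ge> N1 \<Longrightarrow> dist (X m) (X n) < 1"
    using metric_CauchyD[OF X, of 1] by auto
  have "square_summable (\<lambda>p. hcoeff (X N1) p - f p)"
    by (rule square_summableI(1)[of _ 1]) (rule close[OF N1], auto)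
  from square_summable_add(1)[OF square_summable_hcoeff[of "X N1"] square_summable_minus[OF this]]
  have "square_summable f" by simp
  then have "f \<in> {f. square_summable f \<and> (\<forall>p. p \<notin> hbasis \<times> hbasis \<longrightarrow> f p = 0)}"
    using f0 by blast
  then have hf: "hcoeff (Abs_htensor f) = f" by (rule Abs_htensor_inverse)
  have "X \<longlonglongrightarrow> Abs_htensor f"
  proof (rule metric_LIMSEQ_I)
    fix r :: real assume "0 < r"
    then obtain N where N: "\<And>m n. m \<ge> N \<Longrightarrow> n \<ge> N \<Longrightarrow> dist (X m) (X n) < r / 2"
      using metric_CauchyD[OF X, of "r / 2"] by auto
    have "dist (X n) (Abs_htensor f) < r" if "n \<ge> N" for n
    proof -
      have "l2norm (hcoeff (X n - Abs_htensor f)) \<le> r / 2"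
        by (rule square_summableI(2)) (use close[OF N that] in \<open>auto simp: hcoeff_simps hf\<close>)
      then show ?thesis using \<open>0 < r\<close> by (simp add: dist_norm norm_htensor_def)
    qed
    then show "\<exists>no. \<forall>n\<ge>no. dist (X n) (Abs_htensor f) < r" by blast
  qed
  then show "convergent X" by (auto simp: convergent_def)
qed

definition tensor :: "'a::chilbert \<Rightarrow> 'b::chilbert \<Rightarrow> ('a, 'b) htensor" (infixr "\<otimes>" 70) where
  "x \<otimes> y = Abs_htensor (\<lambda>(a, b). if a \<in> hbasis \<and> b \<in> hbasis then cinner a x * cinner b y else 0)"

lemma hcoeff_tensor:
  "hcoeff (x \<otimes> y) (a, b) = (if a \<in> hbasis \<and> b \<in> hbasis then cinner a x * cinner b y else 0)"
proof -
  let ?f = "\<lambda>(a, b). if a \<in> hbasis \<and> b \<in> hbasis then cinner a x * cinner b y else 0"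
  let ?g = "\<lambda>p. (cmod (cinner (fst p) x))\<^sup>2 * (cmod (cinner (snd p) y))\<^sup>2"
  have "?g summable_on hbasis \<times> hbasis"
  proof (rule summable_on_SigmaI)
    show "((\<lambda>b. ?g (a, b)) has_sum ((cmod (cinner a x))\<^sup>2 * (norm y)\<^sup>2)) hbasis" for a
      using has_sum_cmult_right[OF parseval_norm[of y]] by simp
    show "(\<lambda>a. (cmod (cinner a x))\<^sup>2 * (norm y)\<^sup>2) summable_on hbasis"
      using has_sum_cmult_left[OF parseval_norm[of x]] summable_on_def by blast
  qed auto
  then have "square_summable ?f"
    unfolding square_summable_def
    by (subst summable_on_cong_neutral[where T = "hbasis \<times> hbasis" and g = ?g])
       (auto simp: norm_mult power_mult_distrib split: if_splits)
  then show ?thesis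
    unfolding tensor_def by (subst Abs_htensor_inverse) auto
qed

lemma cinner_tensor: "cinner (x \<otimes> y) (x' \<otimes> y') = cinner x x' * cinner y y'"
proof -
  let ?f = "\<lambda>p. cnj (hcoeff (x \<otimes> y) p) * hcoeff (x' \<otimes> y') p"
  have "(?f has_sum (cinner x x' * cinner y y')) (hbasis \<times> hbasis)"
  proof (rule has_sum_SigmaI)
    show "((\<lambda>b. ?f (a, b)) has_sum (cnj (cinner a x) * cinner a x') * cinner y y') hbasis"
      if "a \<in> hbasis" for a
      using has_sum_cmult_right[OF parseval[of y y'], of "cnj (cinner a x) * cinner a x'"]
      by (rule has_sum_cong[THEN iffD1, rotated]) (auto simp: hcoeff_tensor that)
    show "((\<lambda>a. cnj (cinner a x) * cinner a x' * cinner y y') has_sum (cinner x x' * cinner y y')) hbasis"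
      by (rule has_sum_cmult_left[OF parseval])
    show "?f summable_on hbasis \<times> hbasis"
      using htensor_summable by (rule summable_on_subset_banach) auto
  qed
  then have "(?f has_sum (cinner x x' * cinner y y')) UNIV"
    by (rule has_sum_cong_neutral[THEN iffD1, rotated -1]) (auto simp: hcoeff_outside)
  then show ?thesis
    unfolding cinner_htensor_def by (rule infsumI)
qed

lemma tensor_add_left: "(x + x') \<otimes> y = x \<otimes> y + x' \<otimes> y"
  by (rule htensor_eqI, case_tac p) (simp add: hcoeff_simps hcoeff_tensor cinner_add_right distrib_right)

lemma tensor_add_right: "x \<otimes> (y + y') = x \<otimes> y + x \<otimes> y'"
  by (rule htensor_eqI, case_tac p) (simp add: hcoeff_simps hcoeff_tensor cinner_add_right distrib_left)

lemma tensor_scaleC_left: "(c *\<^sub>C x) \<otimes> y = c *\<^sub>C (x \<otimes> y)"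
  by (rule htensor_eqI, case_tac p) (simp add: hcoeff_simps hcoeff_tensor cinner_scaleC_right)

lemma tensor_scaleC_right: "x \<otimes> (c *\<^sub>C y) = c *\<^sub>C (x \<otimes> y)"
  by (rule htensor_eqI, case_tac p) (simp add: hcoeff_simps hcoeff_tensor cinner_scaleC_right)

section \<open>Closed subspaces and the operators between them\<close>

definition closed_csubspace :: "'a::complex_inner set \<Rightarrow> bool" where
  "closed_csubspace S \<longleftrightarrow> closed S \<and> 0 \<in> S \<and> (\<forall>x\<in>S. \<forall>y\<in>S. x + y \<in> S) \<and> (\<forall>c. \<forall>x\<in>S. c *\<^sub>C x \<in> S)"

definition closed_cspan :: "'a::complex_inner set \<Rightarrow> 'a set" where
  "closed_cspan X = \<Inter>{S. closed_csubspace S \<and> X \<subseteq> S}"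

lemma closed_csubspace_closed_cspan: "closed_csubspace (closed_cspan X)"
  unfolding closed_cspan_def closed_csubspace_def by (auto intro!: closed_Inter)

lemma closed_csubspace_sum:
  "closed_csubspace S \<Longrightarrow> (\<And>i. i \<in> A \<Longrightarrow> f i \<in> S) \<Longrightarrow> sum f A \<in> S"
  by (induction A rule: infinite_finite_induct) (auto simp: closed_csubspace_def)

lemma tensor_total: "closed_cspan (range (\<lambda>(x, y). x \<otimes> y)) = (UNIV :: ('a::chilbert, 'b::chilbert) htensor set)"
proof -
  have "z \<in> S" if S: "closed_csubspace S" "range (\<lambda>(x, y). x \<otimes> y) \<subseteq> S"
    for z :: "('a, 'b) htensor" and S
  proof -
    have "\<exists>w\<in>S. dist w z < e" if "e > 0" for e
    proof -
      have hs: "((\<lambda>p. (cmod (hcoeff z p))\<^sup>2) has_sum (norm z)\<^sup>2) UNIV"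
        using has_sum_infsum[OF square_summable_hcoeff[of z, unfolded square_summable_def]]
        by (simp add: norm_htensor_def l2norm_def infsum_nonneg)
      have "e\<^sup>2 / 2 > 0" using that by simp
      from has_sum_finite_approximation[OF hs this]
      obtain F where F: "finite F" "dist (\<Sum>p\<in>F. (cmod (hcoeff z p))\<^sup>2) ((norm z)\<^sup>2) \<le> e\<^sup>2 / 2"
        by blast
      define w where "w = (\<Sum>p\<in>F. hcoeff z p *\<^sub>C (fst p \<otimes> snd p))"
      have "w \<in> S"
        unfolding w_def
      proof (rule closed_csubspace_sum[OF S(1)])
        fix p
        have "fst p \<otimes> snd p \<in> S" using S(2) by (cases p) auto
        then show "hcoeff z p *\<^sub>C (fst p \<otimes> snd p) \<in> S"
          using S(1) by (simp add: closed_csubspace_def)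
      qed
      have sc: "hcoeff (sum g A) q = (\<Sum>p\<in>A. hcoeff (g p) q)"
        for g :: "'a \<times> 'b \<Rightarrow> ('a, 'b) htensor" and A q
        by (induction A rule: infinite_finite_induct) (auto simp: hcoeff_simps)
      have e: "hcoeff z p * hcoeff (fst p \<otimes> snd p) q = (if p = q then hcoeff z q else 0)" for p q
        by (cases p; cases q; cases "p \<in> hbasis \<times> hbasis")
           (auto simp: hcoeff_tensor hbasis_cinner hcoeff_outside)
      have hw: "hcoeff w q = (if q \<in> F then hcoeff z q else 0)" for q
        unfolding w_def sc hcoeff_scaleC e using F(1) by simp
      have zw: "cinner z w = complex_of_real (\<Sum>p\<in>F. (cmod (hcoeff z p))\<^sup>2)"
      proof -
        have "cinner z w = (\<Sum>\<^sub>\<infinity>p\<in>F. cnj (hcoeff z p) * hcoeff z p)"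
          unfolding cinner_htensor_def by (rule infsum_cong_neutral) (auto simp: hw)
        then show ?thesis
          using F(1) by (simp add: complex_norm_square mult.commute del: of_real_power)
      qed
      have "cinner w w = (\<Sum>\<^sub>\<infinity>p\<in>F. cnj (hcoeff z p) * hcoeff z p)"
        unfolding cinner_htensor_def by (rule infsum_cong_neutral) (auto simp: hw)
      then have "cinner w w = complex_of_real (\<Sum>p\<in>F. (cmod (hcoeff z p))\<^sup>2)"
        using F(1) by (simp add: complex_norm_square mult.commute del: of_real_power)
      then have ww: "(norm w)\<^sup>2 = (\<Sum>p\<in>F. (cmod (hcoeff z p))\<^sup>2)"
        unfolding cinner_self of_real_eq_iff .
      have "(norm (z - w))\<^sup>2 = (norm z)\<^sup>2 - (\<Sum>p\<in>F. (cmod (hcoeff z p))\<^sup>2)"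
        unfolding norm_diff_square zw ww by simp
      also have "\<dots> \<le> e\<^sup>2 / 2"
        using F(2) unfolding dist_real_def by linarith
      also have "\<dots> < e\<^sup>2" using that by simp
      finally have "norm (z - w) < e"
        using that by (simp add: power_less_imp_less_base)
      then show ?thesis using \<open>w \<in> S\<close> by (auto simp: dist_norm norm_minus_commute)
    qed
    then have "z \<in> closure S" by (auto simp: closure_approachable)
    then show ?thesis using S(1) by (simp add: closed_csubspace_def)
  qed
  then show ?thesis unfolding closed_cspan_def by auto
qed


definition tensor_space :: "'a::chilbert set \<Rightarrow> 'b::chilbert set \<Rightarrow> ('a, 'b) htensor set" where
  "tensor_space H K = closed_cspan {x \<otimes> y | x y. x \<in> H \<and> y \<in> K}"

text \<open>Operators between closed subspaces are total functions of which only the restriction to the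
  domain \<open>H\<close> matters.\<close>

definition clinear_on :: "'a::complex_inner set \<Rightarrow> ('a \<Rightarrow> 'b::complex_inner) \<Rightarrow> bool" where
  "clinear_on H f \<longleftrightarrow> (\<forall>x\<in>H. \<forall>y\<in>H. f (x + y) = f x + f y) \<and> (\<forall>c. \<forall>x\<in>H. f (c *\<^sub>C x) = c *\<^sub>C f x)"

definition bounded_op :: "'a::complex_inner set \<Rightarrow> 'b::complex_inner set \<Rightarrow> ('a \<Rightarrow> 'b) \<Rightarrow> bool" where
  "bounded_op H K f \<longleftrightarrow> f ` H \<subseteq> K \<and> clinear_on H f \<and> (\<exists>M. \<forall>x\<in>H. norm (f x) \<le> M * norm x)"

definition unitary_op :: "'a::complex_inner set \<Rightarrow> 'b::complex_inner set \<Rightarrow> ('a \<Rightarrow> 'b) \<Rightarrow> bool" where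
  "unitary_op H K f \<longleftrightarrow> f ` H = K \<and> clinear_on H f \<and> (\<forall>x\<in>H. \<forall>y\<in>H. cinner (f x) (f y) = cinner x y)"

definition adjoint_op :: "'a::complex_inner set \<Rightarrow> ('a \<Rightarrow> 'b::complex_inner) \<Rightarrow> 'b \<Rightarrow> 'a" where
  "adjoint_op H f y = (THE x. x \<in> H \<and> (\<forall>z\<in>H. cinner x z = cinner y (f z)))"

text \<open>The next three operators are bounded and specified on a total set, hence determined on
  \<open>tensor_space H K\<close>, respectively on the whole space, by the displayed equations.\<close>

definition tensor_op ::
    "'a::chilbert set \<Rightarrow> 'b::chilbert set \<Rightarrow> ('a \<Rightarrow> 'c::chilbert) \<Rightarrow> ('b \<Rightarrow> 'd::chilbert)
      \<Rightarrow> ('a, 'b) htensor \<Rightarrow> ('c, 'd) htensor" where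
  "tensor_op H K f g = (SOME T. bounded_op (tensor_space H K) UNIV T
     \<and> (\<forall>x\<in>H. \<forall>y\<in>K. T (x \<otimes> y) = f x \<otimes> g y))"

definition tensor_assoc ::
    "(('a::chilbert, 'b::chilbert) htensor, 'c::chilbert) htensor \<Rightarrow> ('a, ('b, 'c) htensor) htensor" where
  "tensor_assoc = (SOME T. bounded_op UNIV UNIV T \<and> (\<forall>x y z. T ((x \<otimes> y) \<otimes> z) = x \<otimes> (y \<otimes> z)))"

definition middle_flip ::
    "(('a::chilbert, 'b::chilbert) htensor, ('c::chilbert, 'd::chilbert) htensor) htensor
      \<Rightarrow> (('a, 'c) htensor, ('b, 'd) htensor) htensor" where
  "middle_flip = (SOME T. bounded_op UNIV UNIV T
     \<and> (\<forall>w x y z. T ((w \<otimes> x) \<otimes> (y \<otimes> z)) = (w \<otimes> y) \<otimes> (x \<otimes> z)))"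

section \<open>Product systems\<close>

text \<open>The fibres of a product system are closed subspaces of one ambient Hilbert space (for an
  arbitrary family of Hilbert spaces, their Hilbert space direct sum). Only the data at
  positive times, and the restriction of \<open>comult P s t\<close> to \<open>fibre P (s + t)\<close>, are meaningful.\<close>

record (overloaded) ('a::chilbert) psystem =
  fibre :: "real \<Rightarrow> 'a set"
  comult :: "real \<Rightarrow> real \<Rightarrow> 'a \<Rightarrow> ('a, 'a) htensor"

definition product_system :: "'a::chilbert psystem \<Rightarrow> bool" where
  "product_system P \<longleftrightarrow>
     (\<forall>t>0. closed_csubspace (fibre P t)) \<and>
     (\<forall>s>0. \<forall>t>0. unitary_op (fibre P (s + t)) (tensor_space (fibre P s) (fibre P t)) (comult P s t)) \<and>
     (\<forall>r>0. \<forall>s>0. \<forall>t>0. \<forall>x\<in>fibre P (r + s + t).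
        tensor_op (fibre P r) (fibre P (s + t)) id (comult P s t) (comult P r (s + t) x) =
        tensor_assoc (tensor_op (fibre P (r + s)) (fibre P t) (comult P r s) id (comult P (r + s) t x)))"

definition pmult :: "'a::chilbert psystem \<Rightarrow> real \<Rightarrow> real \<Rightarrow> 'a \<Rightarrow> 'a \<Rightarrow> 'a" where
  "pmult P s t x y = adjoint_op (fibre P (s + t)) (comult P s t) (x \<otimes> y)"

definition tensor_system :: "'a::chilbert psystem \<Rightarrow> 'b::chilbert psystem \<Rightarrow> ('a, 'b) htensor psystem" where
  "tensor_system P Q =
     \<lparr>fibre = (\<lambda>t. tensor_space (fibre P t) (fibre Q t)),
      comult = (\<lambda>s t z. middle_flip
        (tensor_op (fibre P (s + t)) (fibre Q (s + t)) (comult P s t) (comult Q s t) z))\<rparr>"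

text \<open>Arveson systems: \<open>e\<close> is the countable family of sections giving the measurable structure,
  indexed from 0. Measurability is Borel measurability on positive times.\<close>

definition arveson_system :: "'a::chilbert psystem \<Rightarrow> (nat \<Rightarrow> real \<Rightarrow> 'a) \<Rightarrow> bool" where
  "arveson_system P e \<longleftrightarrow>
     product_system P \<and>
     (\<forall>t>0. \<exists>D. countable D \<and> D \<subseteq> fibre P t \<and> fibre P t \<subseteq> closure D) \<and>
     (\<forall>n. \<forall>t>0. e n t \<in> fibre P t) \<and>
     (\<forall>t>0. closed_cspan (range (\<lambda>n. e n t)) = fibre P t) \<and>
     (\<forall>m n. (\<lambda>t. cinner (e m t) (e n t)) \<in> borel_measurable (restrict_space borel {0<..})) \<and>
     (\<forall>l m n. (\<lambda>(s, t). cinner (e l (s + t)) (pmult P s t (e m s) (e n t)))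
        \<in> borel_measurable (restrict_space borel ({0<..} \<times> {0<..})))"

definition measurable_section ::
    "'a::chilbert psystem \<Rightarrow> (nat \<Rightarrow> real \<Rightarrow> 'a) \<Rightarrow> (real \<Rightarrow> 'a) \<Rightarrow> bool" where
  "measurable_section P e x \<longleftrightarrow>
     (\<forall>t>0. x t \<in> fibre P t) \<and>
     (\<forall>n. (\<lambda>t. cinner (e n t) (x t)) \<in> borel_measurable (restrict_space borel {0<..}))"

definition is_unit :: "'a::chilbert psystem \<Rightarrow> (nat \<Rightarrow> real \<Rightarrow> 'a) \<Rightarrow> (real \<Rightarrow> 'a) \<Rightarrow> bool" where
  "is_unit P e u \<longleftrightarrow>
     measurable_section P e u \<and> (\<exists>t>0. u t \<noteq> 0) \<and>
     (\<forall>s>0. \<forall>t>0. u (s + t) = pmult P s t (u s) (u t))"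

definition normalised_unit :: "'a::chilbert psystem \<Rightarrow> (nat \<Rightarrow> real \<Rightarrow> 'a) \<Rightarrow> (real \<Rightarrow> 'a) \<Rightarrow> bool" where
  "normalised_unit P e u \<longleftrightarrow> is_unit P e u \<and> (\<forall>t>0. norm (u t) = 1)"

definition spatial :: "'a::chilbert psystem \<Rightarrow> (nat \<Rightarrow> real \<Rightarrow> 'a) \<Rightarrow> bool" where
  "spatial P e \<longleftrightarrow> (\<exists>u. is_unit P e u)"

section \<open>Subsystems and morphisms\<close>

definition product_subsystem :: "'a::chilbert psystem \<Rightarrow> (real \<Rightarrow> 'a set) \<Rightarrow> bool" where
  "product_subsystem P G \<longleftrightarrow>
     (\<forall>t>0. closed_csubspace (G t) \<and> G t \<subseteq> fibre P t) \<and>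
     (\<forall>s>0. \<forall>t>0. comult P s t ` G (s + t) = tensor_space (G s) (G t))"

definition restrict_system :: "'a::chilbert psystem \<Rightarrow> (real \<Rightarrow> 'a set) \<Rightarrow> 'a psystem" where
  "restrict_system P G = P\<lparr>fibre := G\<rparr>"

text \<open>The smallest product subsystem containing \<open>X\<close>; the fibrewise intersection of product
  subsystems is again a product subsystem.\<close>

definition generated_subsystem :: "'a::chilbert psystem \<Rightarrow> (real \<Rightarrow> 'a set) \<Rightarrow> real \<Rightarrow> 'a set" where
  "generated_subsystem P X t = \<Inter>{G t | G. product_subsystem P G \<and> (\<forall>s>0. X s \<subseteq> G s)}"

definition join_subsystem ::
    "'a::chilbert psystem \<Rightarrow> (real \<Rightarrow> 'a set) \<Rightarrow> (real \<Rightarrow> 'a set) \<Rightarrow> real \<Rightarrow> 'a set" where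
  "join_subsystem P G H = generated_subsystem P (\<lambda>t. G t \<union> H t)"

definition type_I_part :: "'a::chilbert psystem \<Rightarrow> (nat \<Rightarrow> real \<Rightarrow> 'a) \<Rightarrow> real \<Rightarrow> 'a set" where
  "type_I_part P e = generated_subsystem P (\<lambda>t. {u t | u. is_unit P e u})"

definition morphism ::
    "'a::chilbert psystem \<Rightarrow> 'b::chilbert psystem \<Rightarrow> (real \<Rightarrow> 'a \<Rightarrow> 'b) \<Rightarrow> bool" where
  "morphism P Q \<phi> \<longleftrightarrow>
     (\<forall>t>0. bounded_op (fibre P t) (fibre Q t) (\<phi> t)) \<and>
     (\<forall>s>0. \<forall>t>0. \<forall>x\<in>fibre P (s + t).
        comult Q s t (\<phi> (s + t) x) = tensor_op (fibre P s) (fibre P t) (\<phi> s) (\<phi> t) (comult P s t x)) \<and>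
     (\<exists>k. \<forall>t>0. \<forall>x\<in>fibre P t. norm (\<phi> t x) \<le> exp (k * t) * norm x)"

definition contractive_morphism ::
    "'a::chilbert psystem \<Rightarrow> 'b::chilbert psystem \<Rightarrow> (real \<Rightarrow> 'a \<Rightarrow> 'b) \<Rightarrow> bool" where
  "contractive_morphism P Q \<phi> \<longleftrightarrow>
     morphism P Q \<phi> \<and> (\<forall>t>0. \<forall>x\<in>fibre P t. norm (\<phi> t x) \<le> norm x)"

definition isometric_morphism ::
    "'a::chilbert psystem \<Rightarrow> 'b::chilbert psystem \<Rightarrow> (real \<Rightarrow> 'a \<Rightarrow> 'b) \<Rightarrow> bool" where
  "isometric_morphism P Q \<phi> \<longleftrightarrow>
     morphism P Q \<phi> \<and> (\<forall>t>0. \<forall>x\<in>fibre P t. norm (\<phi> t x) = norm x)"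

definition isomorphic :: "'a::chilbert psystem \<Rightarrow> 'b::chilbert psystem \<Rightarrow> bool" (infix "\<cong>\<^sub>p" 50) where
  "P \<cong>\<^sub>p Q \<longleftrightarrow> (\<exists>\<phi>. morphism P Q \<phi> \<and> (\<forall>t>0. unitary_op (fibre P t) (fibre Q t) (\<phi> t)))"

section \<open>Amalgamated products\<close>

text \<open>\<open>is_amalgam P Q C G J K\<close> says that \<open>(G, J, K)\<close> is the amalgamated product of \<open>P\<close> and \<open>Q\<close>
  along the contractive morphism \<open>C\<close> from \<open>Q\<close> to \<open>P\<close>.\<close>

definition is_amalgam ::
    "'a::chilbert psystem \<Rightarrow> 'b::chilbert psystem \<Rightarrow> (real \<Rightarrow> 'b \<Rightarrow> 'a) \<Rightarrow>
     'c::chilbert psystem \<Rightarrow> (real \<Rightarrow> 'a \<Rightarrow> 'c) \<Rightarrow> (real \<Rightarrow> 'b \<Rightarrow> 'c) \<Rightarrow> bool" where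
  "is_amalgam P Q C G J K \<longleftrightarrow>
     contractive_morphism Q P C \<and> product_system G \<and>
     isometric_morphism P G J \<and> isometric_morphism Q G K \<and>
     (\<forall>t>0. \<forall>y\<in>fibre Q t. adjoint_op (fibre P t) (J t) (K t y) = C t y) \<and>
     (\<forall>t>0. fibre G t = join_subsystem G (\<lambda>s. J s ` fibre P s) (\<lambda>s. K s ` fibre Q s) t)"

definition rank_one :: "(real \<Rightarrow> 'a::complex_inner) \<Rightarrow> (real \<Rightarrow> 'b::complex_inner) \<Rightarrow> real \<Rightarrow> 'b \<Rightarrow> 'a" where
  "rank_one u v t y = cinner (v t) y *\<^sub>C u t"

abbreviation is_unit_amalgam ::
    "'a::chilbert psystem \<Rightarrow> 'b::chilbert psystem \<Rightarrow> (real \<Rightarrow> 'a) \<Rightarrow> (real \<Rightarrow> 'b) \<Rightarrow>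
     'c::chilbert psystem \<Rightarrow> (real \<Rightarrow> 'a \<Rightarrow> 'c) \<Rightarrow> (real \<Rightarrow> 'b \<Rightarrow> 'c) \<Rightarrow> bool" where
  "is_unit_amalgam P Q u v \<equiv> is_amalgam P Q (rank_one u v)"

end

theory Submission
  imports Defs
begin

text \<open>
  Let \<open>S\<close> be the product subsystem of \<open>E \<otimes> F\<close> generated by the fibres \<open>E t \<otimes> v t\<close> and \<open>u t \<otimes> F t\<close>.
  In any amalgamated product over \<open>u\<close> and \<open>v\<close>, words in the images of \<open>E\<close> and \<open>F\<close> have the same inner
  products as the corresponding words in these generators, so the amalgamated product is isomorphic
  to \<open>S\<close>.

  It remains to see that \<open>S\<close> contains \<open>E \<otimes> F\<^sup>I\<close> and, by symmetry, \<open>E\<^sup>I \<otimes> F\<close>. Since the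
  \<open>{y. E t \<otimes> y \<subseteq> S t}\<close> form a product subsystem of \<open>F\<close>, it is enough that \<open>x \<otimes> w L \<in> S L\<close> for \<open>x \<in> E L\<close>
  and a normalised unit \<open>w\<close> of \<open>F\<close>. Let \<open>p\<close> be the projection of \<open>E h\<close> onto the span of \<open>u h\<close> and
  \<open>\<lambda> = \<langle>v h, w h\<rangle>\<close>. For \<open>z \<in> E h\<close> the vector \<open>p z \<otimes> w h + \<lambda> ((1 - p) z \<otimes> v h)\<close> lies in \<open>S h\<close>, and its squared
  distance from \<open>z \<otimes> w h\<close> is \<open>(1 - |\<lambda>|\<^sup>2) |(1 - p) z|\<^sup>2 = O(h) |(1 - p) z|\<^sup>2\<close>. Applied to the time slot
  \<open>[a, a + h]\<close> of \<open>x\<close>, this shows that the squared distance of \<open>x \<otimes> w L\<close> from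
  \<open>S a \<otimes> (E \<otimes> F) (L - a)\<close> has right derivative 0 in \<open>a\<close>, because the component of \<open>x\<close> that differs from
  \<open>u h\<close> in this slot tends to 0 as \<open>h\<close> does; the latter is a consequence of separability. The distance
  tends to 0 as \<open>a\<close> does, hence vanishes also at \<open>a = L\<close>.
\<close>

section \<open>Closed subspaces, projections and isometries\<close>

text \<open>The obstacle is that an error arises in every slot. Replacing \<open>w h\<close> by a
  multiple of \<open>v h\<close> costs a squared distance of order h, so doing it for all of x in
  each of the L/h slots leaves an error of order L. Keeping \<open>w h\<close> on the part of x that
  carries \<open>u h\<close> leaves only a component that is o(1), which turns O(h) into o(h).
  Squared distances are the right measure: the projections for disjoint slots commute, so squares
  add, whereas an unsquared error of order sqrt h per slot could not be summed. The bound 1 -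
  |\<lambda>|^2 = O(h) and the smallness of the component have one source. A nonzero vector
  orthogonal to everything that begins with v could be shifted in time to give uncountably many
  orthogonal vectors of equal norm. Hence vectors beginning with v are dense, which makes the
  overlap of v and w nonzero at some time, and multiplicativity converts one nonzero value into the
  linear bound. Structure maps are traded for products x \<cdot> y inside one Hilbert space, because
  iterated structure maps land in ever larger tensor powers.\<close>

instantiation prod :: (complex_inner, complex_inner) complex_inner
begin

definition "c *\<^sub>C p = (c *\<^sub>C fst p, c *\<^sub>C snd p)"
definition "cinner p q = cinner (fst p) (fst q) + cinner (snd p) (snd q)"

instance
proof
  fix x y z :: "'a \<times> 'b" and r :: real and c d :: complex
  show "r *\<^sub>R x = complex_of_real r *\<^sub>C x"
    by (simp add: scaleC_prod_def scaleR_scaleC scaleR_prod_def)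
  show "c *\<^sub>C (x + y) = c *\<^sub>C x + c *\<^sub>C y" "(c + d) *\<^sub>C x = c *\<^sub>C x + d *\<^sub>C x"
    "c *\<^sub>C d *\<^sub>C x = (c * d) *\<^sub>C x"
    by (simp_all add: scaleC_prod_def scaleC_add_left scaleC_add_right scaleC_scaleC)
  show "cinner x y = cnj (cinner y x)"
    unfolding cinner_prod_def cinner_commute[of "fst x"] cinner_commute[of "snd x"] by simp
  show "cinner x (y + z) = cinner x y + cinner x z" "cinner x (c *\<^sub>C y) = c * cinner x y"
    by (simp_all add: cinner_prod_def scaleC_prod_def cinner_add_right cinner_scaleC_right distrib_left)
  show "norm x = sqrt (Re (cinner x x))"
    by (simp add: cinner_prod_def norm_prod_def cinner_self)
qed

end

text \<open>Direct sums serve as the home of graphs: a closed span of pairs becomes the graph of an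
  extended isometry, and corresponding words of two systems are compared as pairs. The norm on pairs
  is already the Hilbert norm, so completeness carries over.\<close>

instance prod :: (chilbert, chilbert) chilbert ..

lemma norm_add_square:
  fixes x y :: "'a::complex_inner"
  shows "(norm (x + y))\<^sup>2 = (norm x)\<^sup>2 + (norm y)\<^sup>2 + 2 * Re (cinner x y)"
  using norm_diff_square[of x "- y"] by (simp add: cinner_minus_right)

lemma cinner_eq_0_commute: "cinner x y = 0 \<longleftrightarrow> cinner y x = 0"
  by (metis cinner_commute complex_cnj_zero)

lemma cinner_self_eq_0: "cinner x x = 0 \<longleftrightarrow> x = 0"
  by (simp add: cinner_self)

lemma closed_csubspaceD:
  assumes "closed_csubspace S"
  shows "closed S" "0 \<in> S" "x \<in> S \<Longrightarrow> y \<in> S \<Longrightarrow> x + y \<in> S" "x \<in> S \<Longrightarrow> c *\<^sub>C x \<in> S"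
    "x \<in> S \<Longrightarrow> y \<in> S \<Longrightarrow> x - y \<in> S"
proof -
  show *: "closed S" "0 \<in> S" "\<And>x y. x \<in> S \<Longrightarrow> y \<in> S \<Longrightarrow> x + y \<in> S" "\<And>c x. x \<in> S \<Longrightarrow> c *\<^sub>C x \<in> S"
    using assms by (auto simp: closed_csubspace_def)
  show "x \<in> S \<Longrightarrow> y \<in> S \<Longrightarrow> x - y \<in> S"
    using *(3)[of x "- y"] *(4)[of y "-1"] by (simp add: scaleC_minus1)
qed

lemma closed_csubspaceI:
  assumes "closed S" "0 \<in> S" "\<And>x y. x \<in> S \<Longrightarrow> y \<in> S \<Longrightarrow> x + y \<in> S"
    "\<And>c x. x \<in> S \<Longrightarrow> c *\<^sub>C x \<in> S"
  shows "closed_csubspace S"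
  using assms by (auto simp: closed_csubspace_def)

lemma closed_csubspace_UNIV: "closed_csubspace UNIV"
  by (simp add: closed_csubspace_def)

lemma closed_csubspace_0: "closed_csubspace {0}"
  by (simp add: closed_csubspace_def)

lemma closed_csubspace_Inter:
  "(\<And>S. S \<in> \<S> \<Longrightarrow> closed_csubspace S) \<Longrightarrow> closed_csubspace (\<Inter>\<S>)"
  unfolding closed_csubspace_def by (auto intro!: closed_Inter)

lemma closed_csubspace_Int:
  "closed_csubspace S \<Longrightarrow> closed_csubspace T \<Longrightarrow> closed_csubspace (S \<inter> T)"
  unfolding closed_csubspace_def by (auto intro!: closed_Int)

lemma closed_cspan_superset: "X \<subseteq> closed_cspan X"
  by (auto simp: closed_cspan_def)

lemma closed_cspan_base: "x \<in> X \<Longrightarrow> x \<in> closed_cspan X"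
  using closed_cspan_superset by blast

lemma closed_cspan_minimal: "closed_csubspace S \<Longrightarrow> X \<subseteq> S \<Longrightarrow> closed_cspan X \<subseteq> S"
  by (auto simp: closed_cspan_def)

lemma closed_cspan_mono: "X \<subseteq> Y \<Longrightarrow> closed_cspan X \<subseteq> closed_cspan Y"
  by (meson closed_cspan_minimal closed_cspan_superset closed_csubspace_closed_cspan order_trans)

lemma closed_cspan_id: "closed_csubspace S \<Longrightarrow> closed_cspan S = S"
  by (simp add: closed_cspan_minimal closed_cspan_superset subset_antisym)

lemma closed_csubspace_closure:
  fixes V :: "'a::complex_inner set"
  assumes "0 \<in> V" "\<And>x y. x \<in> V \<Longrightarrow> y \<in> V \<Longrightarrow> x + y \<in> V" "\<And>c x. x \<in> V \<Longrightarrow> c *\<^sub>C x \<in> V"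
  shows "closed_csubspace (closure V)"
proof (rule closed_csubspaceI)
  show "0 \<in> closure V" using assms(1) closure_subset by blast
  show "x + y \<in> closure V" if xy: "x \<in> closure V" "y \<in> closure V" for x y
  proof -
    obtain X Y where XY: "\<And>n. X n \<in> V" "X \<longlonglongrightarrow> x" "\<And>n. Y n \<in> V" "Y \<longlonglongrightarrow> y"
      using xy unfolding closure_sequential by blast
    then have "(\<lambda>n. X n + Y n) \<longlonglongrightarrow> x + y" by (intro tendsto_add)
    then show ?thesis
      unfolding closure_sequential using assms(2)[OF XY(1) XY(3)] by (intro exI conjI allI)
  qed
  show "c *\<^sub>C x \<in> closure V" if "x \<in> closure V" for c x
    unfolding closure_approachable
  proof (intro allI impI)
    fix \<epsilon> :: real assume "\<epsilon> > 0"
    \<comment> \<open>The summand 1 covers the case c = 0.\<close>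
    have p: "cmod c + 1 > 0" using norm_ge_zero[of c] by linarith
    with \<open>\<epsilon> > 0\<close> have "\<epsilon> / (cmod c + 1) > 0" by simp
    then obtain y where y: "y \<in> V" "dist y x < \<epsilon> / (cmod c + 1)"
      using \<open>x \<in> closure V\<close> unfolding closure_approachable by blast
    have "dist (c *\<^sub>C y) (c *\<^sub>C x) = norm (c *\<^sub>C (y - x))"
      using scaleC_add_right[of c "y - x" x] by (simp add: dist_norm)
    also have "\<dots> = cmod c * dist y x" by (simp add: norm_scaleC dist_norm)
    also have "\<dots> \<le> (cmod c + 1) * dist y x" by (simp add: mult_right_mono)
    also have "\<dots> < \<epsilon>" using y(2) p by (simp add: field_simps)
    finally show "\<exists>z\<in>V. dist z (c *\<^sub>C x) < \<epsilon>" using assms(3)[OF y(1)] by blast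
  qed
qed simp

lemma scaleC_diff_right: "c *\<^sub>C (x - y) = c *\<^sub>C x - c *\<^sub>C (y :: 'a::complex_inner)"
  using scaleC_add_right[of c "x - y" y] by (simp add: algebra_simps)

subsection \<open>Bounded operators on closed subspaces\<close>

lemma clinear_on_0: "clinear_on W f \<Longrightarrow> 0 \<in> W \<Longrightarrow> f 0 = 0"
  unfolding clinear_on_def by (metis scaleC_zero_left)

lemma clinear_on_add: "clinear_on W f \<Longrightarrow> x \<in> W \<Longrightarrow> y \<in> W \<Longrightarrow> f (x + y) = f x + f y"
  by (simp add: clinear_on_def)

lemma clinear_on_scaleC: "clinear_on W f \<Longrightarrow> x \<in> W \<Longrightarrow> f (c *\<^sub>C x) = c *\<^sub>C f x"
  by (simp add: clinear_on_def)

lemma clinear_on_diff: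
  assumes "closed_csubspace W" "clinear_on W f" "x \<in> W" "y \<in> W"
  shows "f (x - y) = f x - f y"
  using clinear_on_add[OF assms(2) closed_csubspaceD(5)[OF assms(1,3,4)] assms(4)] by simp

lemma bounded_opE:
  assumes "bounded_op W K f"
  obtains M where "\<And>x. x \<in> W \<Longrightarrow> norm (f x) \<le> M * norm x" "clinear_on W f" "f ` W \<subseteq> K"
  using assms unfolding bounded_op_def by blast

lemma bounded_op_continuous_on:
  assumes W: "closed_csubspace W" and f: "bounded_op W K f"
  shows "continuous_on W f"
proof -
  obtain M where M: "\<And>x. x \<in> W \<Longrightarrow> norm (f x) \<le> M * norm x" and lin: "clinear_on W f"
    by (rule bounded_opE[OF f]) blast
  have "dist (f x) (f y) \<le> max M 0 * dist x y" if "x \<in> W" "y \<in> W" for x y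
  proof -
    have "dist (f x) (f y) \<le> M * dist x y"
      using M[OF closed_csubspaceD(5)[OF W that]] clinear_on_diff[OF W lin that] by (simp add: dist_norm)
    also have "\<dots> \<le> max M 0 * dist x y" by (simp add: mult_right_mono)
    finally show ?thesis .
  qed
  then have "(max M 0)-lipschitz_on W f" by (auto simp: lipschitz_on_def)
  then show ?thesis by (rule lipschitz_on_continuous_on)
qed

text \<open>This is what makes it enough to check a membership on generators: the vectors that
  satisfy it form a closed subspace, which then contains the closed span.\<close>

lemma closed_csubspace_preimage:
  assumes W: "closed_csubspace W" and f: "bounded_op W L f" and K: "closed_csubspace K"
  shows "closed_csubspace {x \<in> W. f x \<in> K}"
proof (rule closed_csubspaceI)
  have lin: "clinear_on W f" using f by (simp add: bounded_op_def)
  have "closed (W \<inter> f -` K)"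
    using bounded_op_continuous_on[OF W f] W K
    by (intro continuous_closed_preimage) (auto simp: closed_csubspace_def)
  then show "closed {x \<in> W. f x \<in> K}" by (simp add: vimage_def Int_def)
  show "0 \<in> {x \<in> W. f x \<in> K}"
    using clinear_on_0[OF lin] W K by (simp add: closed_csubspace_def)
  show "x + y \<in> {x \<in> W. f x \<in> K}" if "x \<in> {x \<in> W. f x \<in> K}" "y \<in> {x \<in> W. f x \<in> K}" for x y
    using that clinear_on_add[OF lin, of x y] W K by (simp add: closed_csubspace_def)
  show "c *\<^sub>C x \<in> {x \<in> W. f x \<in> K}" if "x \<in> {x \<in> W. f x \<in> K}" for c x
    using that clinear_on_scaleC[OF lin] W K by (simp add: closed_csubspace_def)
qed

lemma bounded_op_diff:
  assumes f: "bounded_op W K f" and g: "bounded_op W L g"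
  shows "bounded_op W UNIV (\<lambda>x. f x - g x)"
proof -
  obtain M where M: "\<And>x. x \<in> W \<Longrightarrow> norm (f x) \<le> M * norm x" and lf: "clinear_on W f"
    by (rule bounded_opE[OF f]) blast
  obtain N where N: "\<And>x. x \<in> W \<Longrightarrow> norm (g x) \<le> N * norm x" and lg: "clinear_on W g"
    by (rule bounded_opE[OF g]) blast
  have "norm (f x - g x) \<le> (M + N) * norm x" if "x \<in> W" for x
    using norm_triangle_ineq4[of "f x" "g x"] M[OF that] N[OF that] by (simp add: distrib_right)
  moreover have "clinear_on W (\<lambda>x. f x - g x)"
    using lf lg by (simp add: clinear_on_def scaleC_diff_right)
  ultimately show ?thesis by (auto simp: bounded_op_def)
qed

lemma bounded_op_eqI:
  assumes W: "closed_csubspace W" and f: "bounded_op W K f" and g: "bounded_op W L g"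
    and X: "X \<subseteq> W" "\<And>x. x \<in> X \<Longrightarrow> f x = g x" and x: "x \<in> closed_cspan X"
  shows "f x = g x"
proof -
  have "closed_cspan X \<subseteq> {x \<in> W. f x - g x \<in> {0}}"
    by (rule closed_cspan_minimal)
       (use closed_csubspace_preimage[OF W bounded_op_diff[OF f g] closed_csubspace_0] X in auto)
  with x show ?thesis by auto
qed

lemma bounded_op_subset: "bounded_op W K f \<Longrightarrow> V \<subseteq> W \<Longrightarrow> bounded_op V K f"
  unfolding bounded_op_def clinear_on_def by (meson image_mono subset_iff subset_trans)

lemma bounded_op_compose:
  assumes f: "bounded_op W K f" and g: "bounded_op K L g"
  shows "bounded_op W L (\<lambda>x. g (f x))"
proof -
  obtain M where M: "\<And>x. x \<in> W \<Longrightarrow> norm (f x) \<le> M * norm x" and lf: "clinear_on W f"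
    and fK: "f ` W \<subseteq> K" by (rule bounded_opE[OF f]) blast
  obtain N where N: "\<And>x. x \<in> K \<Longrightarrow> norm (g x) \<le> N * norm x" and lg: "clinear_on K g"
    and gL: "g ` K \<subseteq> L" by (rule bounded_opE[OF g]) blast
  have "norm (g (f x)) \<le> (max N 0 * M) * norm x" if "x \<in> W" for x
  proof -
    have "norm (g (f x)) \<le> N * norm (f x)" using N fK that by blast
    also have "\<dots> \<le> max N 0 * norm (f x)" by (simp add: mult_right_mono)
    also have "\<dots> \<le> max N 0 * (M * norm x)" using M[OF that] by (simp add: mult_left_mono)
    finally show ?thesis by (simp add: mult.assoc)
  qed
  moreover have "clinear_on W (\<lambda>x. g (f x))"
    using lf lg fK by (simp add: clinear_on_def image_subset_iff)
  moreover have "(\<lambda>x. g (f x)) ` W \<subseteq> L"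
    using fK gL by blast
  ultimately show ?thesis unfolding bounded_op_def by blast
qed

text \<open>Both sides are conjugate linear in x, so the solutions form a complex subspace. With b
  in the role of the adjoint of f at a, an adjoint relation extends from a total set to W.\<close>

lemma closed_csubspace_cinner_eq: 
  fixes f :: "'a::complex_inner \<Rightarrow> 'b::complex_inner"
  assumes W: "closed_csubspace W" and f: "bounded_op W K f"
  shows "closed_csubspace {x \<in> W. cinner (f x) a = cinner x b}"
proof (rule closed_csubspaceI)
  have lin: "clinear_on W f" using f by (simp add: bounded_op_def)
  have cont: "continuous_on S (\<lambda>x. cinner c x)" for S and c :: "'d::complex_inner"
    by (rule linear_continuous_on[OF bounded_linear_cinner_right])
  have fc: "continuous_on W f" by (rule bounded_op_continuous_on[OF W f])
  have "continuous_on W (\<lambda>x. cinner a (f x))"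
    using continuous_on_compose[OF fc cont] by (simp add: o_def)
  then have "continuous_on W (\<lambda>x. cinner a (f x) - cinner b x)"
    by (intro continuous_intros cont)
  then have "closed (W \<inter> (\<lambda>x. cinner a (f x) - cinner b x) -` {0})"
    using W by (intro continuous_closed_preimage) (auto simp: closed_csubspace_def)
  moreover have "cinner (f x) a = cinner x b \<longleftrightarrow> cinner a (f x) - cinner b x = 0" for x
    by (metis cinner_commute complex_cnj_cnj right_minus_eq)
  ultimately show "closed {x \<in> W. cinner (f x) a = cinner x b}"
    by (simp add: vimage_def Int_def)
  show "0 \<in> {x \<in> W. cinner (f x) a = cinner x b}"
    using clinear_on_0[OF lin] W by (simp add: closed_csubspace_def)
  show "x + y \<in> {x \<in> W. cinner (f x) a = cinner x b}"
    if "x \<in> {x \<in> W. cinner (f x) a = cinner x b}" "y \<in> {x \<in> W. cinner (f x) a = cinner x b}" for x y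
    using that clinear_on_add[OF lin] W by (simp add: closed_csubspace_def cinner_add_left)
  show "c *\<^sub>C x \<in> {x \<in> W. cinner (f x) a = cinner x b}"
    if "x \<in> {x \<in> W. cinner (f x) a = cinner x b}" for c x
    using that clinear_on_scaleC[OF lin] W by (simp add: closed_csubspace_def cinner_scaleC_left)
qed

subsection \<open>Isometries\<close>

text \<open>Preserving inner products on a closed subspace forces linearity
  (\<open>isometry_on_clinear_on\<close>), so an isometry is verified on inner products
  alone.\<close>

definition isometry_on :: "'a::complex_inner set \<Rightarrow> ('a \<Rightarrow> 'b::complex_inner) \<Rightarrow> bool" where
  "isometry_on W f \<longleftrightarrow> (\<forall>x\<in>W. \<forall>y\<in>W. cinner (f x) (f y) = cinner x y)"

lemma isometry_onD: "isometry_on W f \<Longrightarrow> x \<in> W \<Longrightarrow> y \<in> W \<Longrightarrow> cinner (f x) (f y) = cinner x y"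
  by (simp add: isometry_on_def)

text \<open>The square norm of the defect, such as \<open>f (x + y) - (f x + f y)\<close>, expands
  into inner products of values of f; these equal the ones in W, where the defect is 0.\<close>

lemma isometry_on_clinear_on:
  assumes W: "closed_csubspace W" and f: "isometry_on W f"
  shows "clinear_on W f"
  unfolding clinear_on_def
proof (intro conjI ballI allI)
  note D = closed_csubspaceD[OF W] isometry_onD[OF f]
  fix x assume x: "x \<in> W"
  show "f (x + y) = f x + f y" if y: "y \<in> W" for y
  proof -
    have "cinner (f (x + y) - (f x + f y)) (f (x + y) - (f x + f y)) = 0"
      using D x y
      by (simp add: cinner_diff_left cinner_diff_right cinner_add_left cinner_add_right)
    then show ?thesis by (simp add: cinner_self_eq_0)
  qed
  show "f (c *\<^sub>C x) = c *\<^sub>C f x" for c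
  proof -
    have "cinner (f (c *\<^sub>C x) - c *\<^sub>C f x) (f (c *\<^sub>C x) - c *\<^sub>C f x) = 0"
      using D x
      by (simp add: cinner_diff_left cinner_diff_right cinner_scaleC_left cinner_scaleC_right)
    then show ?thesis by (simp add: cinner_self_eq_0)
  qed
qed

lemma isometry_on_norm: "isometry_on W f \<Longrightarrow> x \<in> W \<Longrightarrow> norm (f x) = norm x"
  by (simp add: norm_eq_sqrt_cinner isometry_on_def)

lemma isometry_on_bounded_op:
  "closed_csubspace W \<Longrightarrow> isometry_on W f \<Longrightarrow> f ` W \<subseteq> K \<Longrightarrow> bounded_op W K f"
  unfolding bounded_op_def using isometry_on_clinear_on isometry_on_norm
  by (metis mult_1 order_refl)

lemma norm_preserving_isometry_on:
  assumes W: "closed_csubspace W" and f: "clinear_on W f" "\<And>x. x \<in> W \<Longrightarrow> norm (f x) = norm x"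
  shows "isometry_on W f"
  unfolding isometry_on_def
proof (intro ballI)
  fix x y assume xy: "x \<in> W" "y \<in> W"
  note D = closed_csubspaceD[OF W] xy
  have "norm (f x + c *\<^sub>C f y) = norm (x + c *\<^sub>C y)" "norm (f x - c *\<^sub>C f y) = norm (x - c *\<^sub>C y)" for c
    using f(2)[of "x + c *\<^sub>C y"] f(2)[of "x - c *\<^sub>C y"] D
      clinear_on_add[OF f(1)] clinear_on_scaleC[OF f(1)] clinear_on_diff[OF W f(1)] by auto
  from this[of 1] this[of \<i>] show "cinner (f x) (f y) = cinner x y"
    unfolding polarization[of "f x" "f y"] polarization[of x y] by simp
qed

text \<open>Closedness comes from completeness of the source: a convergent sequence of images is
  Cauchy, so its preimages are Cauchy and have a limit in W.\<close>

lemma isometry_on_image_closed_csubspace: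
  fixes f :: "'a::chilbert \<Rightarrow> 'b::complex_inner"
  assumes W: "closed_csubspace W" and f: "isometry_on W f"
  shows "closed_csubspace (f ` W)"
proof (rule closed_csubspaceI)
  note lin = isometry_on_clinear_on[OF W f] and D = closed_csubspaceD[OF W]
  show "0 \<in> f ` W" using clinear_on_0[OF lin] D(2) by (metis image_eqI)
  show "x + y \<in> f ` W" if "x \<in> f ` W" "y \<in> f ` W" for x y
    using that clinear_on_add[OF lin] D(3) by (metis (no_types, lifting) imageE image_eqI)
  show "c *\<^sub>C x \<in> f ` W" if "x \<in> f ` W" for c x
    using that clinear_on_scaleC[OF lin] D(4) by (metis (no_types, lifting) imageE image_eqI)
  have d: "dist (f x) (f y) = dist x y" if "x \<in> W" "y \<in> W" for x y
    using that clinear_on_diff[OF W lin that] isometry_on_norm[OF f D(5)[OF that]] by (simp add: dist_norm)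
  show "closed (f ` W)"
    unfolding closed_sequential_limits
  proof (intro allI impI, elim conjE)
    fix Y l assume Y: "\<forall>n. Y n \<in> f ` W" and lim: "Y \<longlonglongrightarrow> l"
    then have "\<exists>X. \<forall>n. X n \<in> W \<and> Y n = f (X n)" by (intro choice) (metis imageE)
    then obtain X where X: "\<And>n. X n \<in> W" "\<And>n. Y n = f (X n)" by blast
    have "Cauchy Y" using lim LIMSEQ_imp_Cauchy by blast
    then have "Cauchy X" unfolding Cauchy_def X(2) d[OF X(1) X(1)] .
    then obtain x where x: "X \<longlonglongrightarrow> x" using Cauchy_convergent convergent_def by blast
    then have "x \<in> W" using D(1) X(1) closed_sequentially by blast
    have "(\<lambda>n. dist (Y n) (f x)) \<longlonglongrightarrow> 0"
      unfolding X(2) d[OF X(1) \<open>x \<in> W\<close>] using x tendsto_dist_iff by blast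
    then have "Y \<longlonglongrightarrow> f x" using tendsto_dist_iff by blast
    then show "l \<in> f ` W" using lim LIMSEQ_unique \<open>x \<in> W\<close> by blast
  qed
qed

lemma isometry_on_image_closed_cspan:
  fixes f :: "'a::chilbert \<Rightarrow> 'b::complex_inner"
  assumes W: "closed_csubspace W" and f: "isometry_on W f" and X: "X \<subseteq> W"
  shows "f ` closed_cspan X = closed_cspan (f ` X)"
proof (rule subset_antisym)
  have XW: "closed_cspan X \<subseteq> W" by (rule closed_cspan_minimal[OF W X])
  have "closed_cspan X \<subseteq> {x \<in> W. f x \<in> closed_cspan (f ` X)}"
    using closed_csubspace_preimage[OF W isometry_on_bounded_op[OF W f subset_UNIV]
        closed_csubspace_closed_cspan] X closed_cspan_superset
    by (intro closed_cspan_minimal) blast+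
  then show "f ` closed_cspan X \<subseteq> closed_cspan (f ` X)" by auto
  have "isometry_on (closed_cspan X) f" using f XW by (auto simp: isometry_on_def)
  then show "closed_cspan (f ` X) \<subseteq> f ` closed_cspan X"
    using closed_cspan_superset
    by (intro closed_cspan_minimal isometry_on_image_closed_csubspace closed_csubspace_closed_cspan
        image_mono)
qed

text \<open>Compatibility with one fixed pair q is a closed linear condition on the other pair.
  Agreement of inner products therefore passes from generating pairs to their closed span, one
  argument at a time.\<close>

lemma closed_csubspace_cinner_agree:
  "closed_csubspace {p. cinner (snd q) (snd p) = cinner (fst q) (fst p)}"
  for q :: "'a::complex_inner \<times> 'b::complex_inner"
proof (rule closed_csubspaceI)
  have "closed ((\<lambda>p. cinner (snd q) (snd p) - cinner (fst q) (fst p)) -` {0})"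
    by (intro continuous_closed_vimage continuous_diff
        bounded_linear.continuous[OF bounded_linear_cinner_right] continuous_fst continuous_snd
        continuous_ident closed_singleton)
  then show "closed {p. cinner (snd q) (snd p) = cinner (fst q) (fst p)}" by (simp add: vimage_def)
qed (auto simp: scaleC_prod_def cinner_add_right cinner_scaleC_right)

text \<open>The closed span of the relation in the direct sum is the graph of the extension.\<close>

lemma isometry_extension:
  fixes R :: "('a::chilbert \<times> 'b::chilbert) set"
  assumes R: "\<And>a b a' b'. (a, b) \<in> R \<Longrightarrow> (a', b') \<in> R \<Longrightarrow> cinner b b' = cinner a a'"
  obtains T where "isometry_on (closed_cspan (fst ` R)) T" "\<And>a b. (a, b) \<in> R \<Longrightarrow> T a = b"
    "T ` closed_cspan (fst ` R) = closed_cspan (snd ` R)"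
proof -
  define D where "D = closed_cspan R"
  have D: "closed_csubspace D" by (simp add: D_def closed_csubspace_closed_cspan)
  have fs: "fst (x + y) = fst x + fst y" "snd (x + y) = snd x + snd y"
    "fst (c *\<^sub>C x) = c *\<^sub>C fst x" "snd (c *\<^sub>C x) = c *\<^sub>C snd x" for c and x y :: "'a \<times> 'b"
    by (simp_all add: scaleC_prod_def)
  have 1: "cinner (snd q) (snd p) = cinner (fst q) (fst p)" if "q \<in> R" "p \<in> D" for p q
  proof -
    have "D \<subseteq> {p. cinner (snd q) (snd p) = cinner (fst q) (fst p)}"
      unfolding D_def using R[of "fst q" "snd q"] that by (intro closed_cspan_minimal[OF closed_csubspace_cinner_agree]) auto
    with that show ?thesis by auto
  qed
  have 2: "cinner (snd q) (snd p) = cinner (fst q) (fst p)" if "q \<in> D" "p \<in> D" for p q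
  proof -
    have "D \<subseteq> {q. cinner (snd p) (snd q) = cinner (fst p) (fst q)}"
      unfolding D_def
    proof (intro closed_cspan_minimal[OF closed_csubspace_cinner_agree] subsetI CollectI)
      fix q assume "q \<in> R"
      from 1[OF this \<open>p \<in> D\<close>] show "cinner (snd p) (snd q) = cinner (fst p) (fst q)"
        by (metis cinner_commute)
    qed
    with that show ?thesis by (metis (mono_tags, lifting) cinner_commute mem_Collect_eq subsetD)
  qed
  have eq: "(complex_of_real (sqrt 2))\<^sup>2 = 2"
    by (metis of_real_numeral of_real_power real_sqrt_pow2 zero_le_numeral)
  \<comment> \<open>On D both components have the same inner products, so the direct sum norm is
    sqrt 2 times the norm of either component. The rescaled coordinate maps are isometries, which
    makes the two projections of D closed.\<close>
  have iso: "isometry_on D (\<lambda>p. complex_of_real (sqrt 2) *\<^sub>C fst p)"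
      "isometry_on D (\<lambda>p. complex_of_real (sqrt 2) *\<^sub>C snd p)"
    unfolding isometry_on_def
    using eq by (auto simp: cinner_scaleC_left cinner_scaleC_right cinner_prod_def 2 power2_eq_square
        mult.assoc[symmetric])
  have sc: "(\<lambda>p. complex_of_real (sqrt 2) *\<^sub>C g p) ` D = g ` D"
    if g: "\<And>c p. g (c *\<^sub>C p) = c *\<^sub>C g p" for g :: "'a \<times> 'b \<Rightarrow> 'c::complex_inner"
  proof (rule subset_antisym; safe)
    fix p assume "p \<in> D"
    then have pD: "c *\<^sub>C p \<in> D" for c using closed_csubspaceD(4)[OF D] by blast
    show "complex_of_real (sqrt 2) *\<^sub>C g p \<in> g ` D" using pD g by (metis image_eqI)
    have "g p = complex_of_real (sqrt 2) *\<^sub>C g (complex_of_real (1 / sqrt 2) *\<^sub>C p)"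
      unfolding g scaleC_scaleC of_real_mult[symmetric] by simp
    then show "g p \<in> (\<lambda>p. complex_of_real (sqrt 2) *\<^sub>C g p) ` D" using pD by (metis image_eqI)
  qed
  have img: "fst ` D = closed_cspan (fst ` R)" "snd ` D = closed_cspan (snd ` R)"
  proof -
    have cl: "closed_csubspace (fst ` D)" "closed_csubspace (snd ` D)"
      using isometry_on_image_closed_csubspace[OF D iso(1)] isometry_on_image_closed_csubspace[OF D iso(2)]
        sc[of fst] sc[of snd] by (simp_all add: fs)
    show "fst ` D = closed_cspan (fst ` R)"
    proof
      have "D \<subseteq> {p \<in> UNIV. fst p \<in> closed_cspan (fst ` R)}"
        unfolding D_def
        by (rule closed_cspan_minimal, rule closed_csubspace_preimage[OF closed_csubspace_UNIV, where L = UNIV])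
          (auto simp: bounded_op_def clinear_on_def fs closed_csubspace_closed_cspan
            intro!: exI[of _ 1] norm_fst_le closed_cspan_base)
      then show "fst ` D \<subseteq> closed_cspan (fst ` R)" by auto
      show "closed_cspan (fst ` R) \<subseteq> fst ` D"
        unfolding D_def
        by (intro closed_cspan_minimal cl(1)[unfolded D_def] image_mono closed_cspan_superset)
    qed
    show "snd ` D = closed_cspan (snd ` R)"
    proof
      have "D \<subseteq> {p \<in> UNIV. snd p \<in> closed_cspan (snd ` R)}"
        unfolding D_def
        by (rule closed_cspan_minimal, rule closed_csubspace_preimage[OF closed_csubspace_UNIV, where L = UNIV])
          (auto simp: bounded_op_def clinear_on_def fs closed_csubspace_closed_cspan
            intro!: exI[of _ 1] norm_snd_le closed_cspan_base)
      then show "snd ` D \<subseteq> closed_cspan (snd ` R)" by auto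
      show "closed_cspan (snd ` R) \<subseteq> snd ` D"
        unfolding D_def
        by (intro closed_cspan_minimal cl(2)[unfolded D_def] image_mono closed_cspan_superset)
    qed
  qed
  have "\<forall>a. \<exists>b. a \<in> fst ` D \<longrightarrow> (a, b) \<in> D" by force
  then obtain T where T: "\<And>a. a \<in> fst ` D \<Longrightarrow> (a, T a) \<in> D" by metis
  \<comment> \<open>A pair (0, d) in D satisfies d = 0 because its components have equal norm; hence
    D is a graph.\<close>
  have uniq: "T a = b" if "(a, b) \<in> D" for a b
  proof -
    have "a \<in> fst ` D" using that by force
    from closed_csubspaceD(5)[OF D that T[OF this]] have "(0, b - T a) \<in> D" by simp
    from 2[OF this this] show ?thesis by (simp add: cinner_self)
  qed
  show thesis
  proof (rule that)
    show "isometry_on (closed_cspan (fst ` R)) T"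
      unfolding img(1)[symmetric] isometry_on_def using 2[OF T T] by simp
    show "T a = b" if "(a, b) \<in> R" for a b
      using uniq that closed_cspan_base[of "(a, b)" R] by (simp add: D_def)
    have "T ` (fst ` D) = snd ` D" using uniq by force
    then show "T ` closed_cspan (fst ` R) = closed_cspan (snd ` R)" by (simp add: img)
  qed
qed

subsection \<open>Orthogonal projections\<close>

lemma scaleC_scaleR_half: "(1/2) *\<^sub>R x = complex_of_real (1/2) *\<^sub>C (x::'a::complex_inner)"
  by (rule scaleR_scaleC)

lemma parallelogram:
  fixes x y :: "'a::complex_inner"
  shows "(norm (x - y))\<^sup>2 = 2 * (norm x)\<^sup>2 + 2 * (norm y)\<^sup>2 - 4 * (norm ((1/2) *\<^sub>R (x + y)))\<^sup>2"
proof -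
  have "(norm ((1/2) *\<^sub>R (x + y)))\<^sup>2 = (norm (x + y))\<^sup>2 / 4" by (simp add: power_divide)
  then show ?thesis using norm_add_square[of x y] norm_diff_square[of x y] by linarith
qed

lemma closed_csubspace_nearest:
  fixes S :: "'a::chilbert set"
  assumes S: "closed_csubspace S"
  obtains p where "p \<in> S" "\<And>s. s \<in> S \<Longrightarrow> (norm (z - p))\<^sup>2 \<le> (norm (z - s))\<^sup>2"
proof -
  define d where "d = (INF s\<in>S. (norm (z - s))\<^sup>2)"
  note D = closed_csubspaceD[OF S]
  have bdd: "bdd_below ((\<lambda>s. (norm (z - s))\<^sup>2) ` S)" by (rule bdd_belowI2[of _ 0]) simp
  have le: "d \<le> (norm (z - s))\<^sup>2" if "s \<in> S" for s
    unfolding d_def by (rule cINF_lower[OF bdd that])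
  have "\<exists>s\<in>S. (norm (z - s))\<^sup>2 < d + 1 / real (Suc n)" for n
  proof (rule ccontr)
    assume "\<not> ?thesis"
    then have "d + 1 / real (Suc n) \<le> d"
      unfolding d_def using D(2) by (intro cINF_greatest) (auto simp: not_less d_def)
    then show False by simp
  qed
  then obtain s where s: "\<And>n. s n \<in> S" "\<And>n. (norm (z - s n))\<^sup>2 < d + 1 / real (Suc n)" by metis
  \<comment> \<open>The midpoint of two members lies in S, so its squared distance from z is at
    least d; the parallelogram law then bounds the distance of the members.\<close>
  have dist: "(dist (s m) (s n))\<^sup>2 < 4 / real (Suc m)" if "m \<le> n" for m n
  proof -
    have "(1/2) *\<^sub>R (s m + s n) \<in> S" unfolding scaleC_scaleR_half by (intro D(3,4) s(1))
    from le[OF this] have "d \<le> (norm ((1/2) *\<^sub>R ((z - s m) + (z - s n))))\<^sup>2"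
      by (simp add: algebra_simps) (simp flip: scaleR_add_left)
    moreover have "(norm ((z - s m) - (z - s n)))\<^sup>2 = (dist (s m) (s n))\<^sup>2"
      by (simp add: dist_norm norm_minus_commute)
    moreover have "1 / real (Suc n) \<le> 1 / real (Suc m)" using that by (simp add: field_simps)
    ultimately show ?thesis
      using parallelogram[of "z - s m" "z - s n"] s(2)[of m] s(2)[of n] by simp
  qed
  have "Cauchy s"
  proof (rule CauchyI')
    fix e :: real assume "0 < e"
    then obtain N where N: "1 / real (Suc N) < e\<^sup>2 / 4"
      using nat_approx_posE[of "e\<^sup>2 / 4"] by auto
    have "dist (s m) (s n) < e" if "N \<le> m" "m < n" for m n
    proof -
      have "(dist (s m) (s n))\<^sup>2 < 4 / real (Suc m)" using dist[of m n] that by simp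
      also have "\<dots> \<le> 4 / real (Suc N)" using that by (simp add: field_simps)
      also have "\<dots> < e\<^sup>2" using N by simp
      finally show ?thesis using \<open>0 < e\<close> by (meson less_imp_le power_less_imp_less_base)
    qed
    then show "\<exists>M. \<forall>m\<ge>M. \<forall>n>m. dist (s m) (s n) < e" by blast
  qed
  then obtain p where p: "s \<longlonglongrightarrow> p" using Cauchy_convergent convergent_def by blast
  have pS: "p \<in> S" using D(1) s(1) p closed_sequentially by blast
  have "(\<lambda>n. (norm (z - s n))\<^sup>2) \<longlonglongrightarrow> (norm (z - p))\<^sup>2" by (intro tendsto_intros p)
  moreover have "(\<lambda>n. d + 1 / real (Suc n)) \<longlonglongrightarrow> d + 0"
    by (intro tendsto_add tendsto_const LIMSEQ_Suc[OF lim_1_over_n])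
  ultimately have "(norm (z - p))\<^sup>2 \<le> d + 0"
    using s(2) by (meson LIMSEQ_le less_imp_le)
  then show thesis using le by (intro that[OF pS]) (metis add_0_right order_trans)
qed

lemma closed_csubspace_projection:
  fixes S :: "'a::chilbert set"
  assumes S: "closed_csubspace S"
  shows "\<exists>p. p \<in> S \<and> (\<forall>s\<in>S. cinner s (z - p) = 0)"
proof -
  obtain p where p: "p \<in> S" "\<And>s. s \<in> S \<Longrightarrow> (norm (z - p))\<^sup>2 \<le> (norm (z - s))\<^sup>2"
    using closed_csubspace_nearest[OF S, where z = z] by metis
  have "cinner s (z - p) = 0" if s: "s \<in> S" for s
  proof (cases "s = 0")
    case False
    then have n: "(norm s)\<^sup>2 > 0" by simp
    \<comment> \<open>The optimal coefficient in direction s: moving p by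
      \<open>c *\<^sub>C s\<close> would decrease the distance unless the inner product is
      0.\<close>
    define c where "c = cinner s (z - p) / complex_of_real ((norm s)\<^sup>2)"
    have "p + c *\<^sub>C s \<in> S" by (intro closed_csubspaceD[OF S] p s)
    from p(2)[OF this] have "(norm (z - p))\<^sup>2 \<le> (norm ((z - p) - c *\<^sub>C s))\<^sup>2"
      by (simp add: algebra_simps)
    also have "\<dots> = (norm (z - p))\<^sup>2 + (norm (c *\<^sub>C s))\<^sup>2 - 2 * Re (c * cinner (z - p) s)"
      by (simp add: norm_diff_square cinner_scaleC_right)
    also have "c * cinner (z - p) s = complex_of_real ((cmod (cinner s (z - p)))\<^sup>2 / (norm s)\<^sup>2)"
      unfolding c_def cinner_commute[of "z - p" s] of_real_divide complex_norm_square by simp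
    also have "(norm (c *\<^sub>C s))\<^sup>2 = (cmod (cinner s (z - p)))\<^sup>2 / (norm s)\<^sup>2"
    proof -
      have "norm c = cmod (cinner s (z - p)) / (norm s)\<^sup>2"
        unfolding c_def norm_divide norm_of_real by simp
      then show ?thesis using False by (simp add: norm_scaleC power2_eq_square field_simps)
    qed
    finally have "(cmod (cinner s (z - p)))\<^sup>2 / (norm s)\<^sup>2 \<le> 0" by simp
    then show ?thesis using n by (simp add: field_simps)
  qed simp
  with p show ?thesis by blast
qed

definition hproj :: "'a::chilbert set \<Rightarrow> 'a \<Rightarrow> 'a" where
  "hproj S z = (SOME p. p \<in> S \<and> (\<forall>s\<in>S. cinner s (z - p) = 0))"

lemma hproj:
  assumes "closed_csubspace S"
  shows "hproj S z \<in> S" "s \<in> S \<Longrightarrow> cinner s (z - hproj S z) = 0"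
  using someI_ex[OF closed_csubspace_projection[OF assms, of z]] unfolding hproj_def by blast+

lemma norm_diff_hproj_square:
  assumes S: "closed_csubspace S" and s: "s \<in> S"
  shows "(norm (z - s))\<^sup>2 = (norm (z - hproj S z))\<^sup>2 + (norm (hproj S z - s))\<^sup>2"
proof -
  have "hproj S z - s \<in> S" by (intro closed_csubspaceD[OF S] hproj[OF S] s)
  then have "cinner (z - hproj S z) (hproj S z - s) = 0"
    using hproj(2)[OF S] cinner_eq_0_commute by blast
  then show ?thesis using norm_add_square[of "z - hproj S z" "hproj S z - s"] by simp
qed

lemma norm_diff_hproj_le:
  "closed_csubspace S \<Longrightarrow> s \<in> S \<Longrightarrow> (norm (z - hproj S z))\<^sup>2 \<le> (norm (z - s))\<^sup>2"
  using norm_diff_hproj_square[of S s z] by simp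

lemma hproj_eqI:
  assumes S: "closed_csubspace S" and p: "p \<in> S" "\<And>s. s \<in> S \<Longrightarrow> cinner s (z - p) = 0"
  shows "hproj S z = p"
proof -
  have d: "hproj S z - p \<in> S" by (intro closed_csubspaceD[OF S] hproj[OF S] p)
  have "cinner (hproj S z - p) ((z - p) - (z - hproj S z)) = 0"
    by (subst cinner_diff_right) (simp add: p(2)[OF d] hproj(2)[OF S d])
  then show ?thesis by (simp add: cinner_self_eq_0)
qed

lemma hproj_id: "closed_csubspace S \<Longrightarrow> z \<in> S \<Longrightarrow> hproj S z = z"
  by (rule hproj_eqI) auto

lemma mem_closed_csubspace_hproj: "closed_csubspace S \<Longrightarrow> norm (z - hproj S z) = 0 \<Longrightarrow> z \<in> S"
  using hproj(1)[of S z] by simp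

lemma hproj_bounded_op:
  assumes S: "closed_csubspace S"
  shows "bounded_op W S (hproj S)"
  unfolding bounded_op_def
proof (intro conjI exI[of _ 1] ballI)
  show "hproj S ` W \<subseteq> S" using hproj(1)[OF S] by blast
  show "clinear_on W (hproj S)"
    unfolding clinear_on_def
  proof (intro conjI ballI allI)
    fix x y c
    have "cinner s ((x + y) - (hproj S x + hproj S y)) = 0" if "s \<in> S" for s
      using hproj(2)[OF S that, of x] hproj(2)[OF S that, of y]
      by (simp add: cinner_diff_right cinner_add_right)
    then show "hproj S (x + y) = hproj S x + hproj S y"
      by (intro hproj_eqI closed_csubspaceD[OF S] hproj(1)[OF S] S)
    have "cinner s (c *\<^sub>C x - c *\<^sub>C hproj S x) = 0" if "s \<in> S" for s
      using hproj(2)[OF S that, of x] by (simp add: cinner_diff_right cinner_scaleC_right)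
    then show "hproj S (c *\<^sub>C x) = c *\<^sub>C hproj S x"
      by (intro hproj_eqI closed_csubspaceD[OF S] hproj(1)[OF S] S)
  qed
  fix x
  have "(norm (hproj S x))\<^sup>2 \<le> (norm x)\<^sup>2"
    using norm_diff_hproj_square[OF S closed_csubspaceD(2)[OF S], of x] by simp
  then show "norm (hproj S x) \<le> 1 * norm x" using power2_le_imp_le[of "norm (hproj S x)" "norm x"] by simp
qed

definition ocomp :: "'a::complex_inner set \<Rightarrow> 'a set" where
  "ocomp X = {y. \<forall>x\<in>X. cinner x y = 0}"

lemma closed_csubspace_orthogonal: "closed_csubspace {y. cinner x y = 0}"
proof (rule closed_csubspaceI)
  have "closed ((\<lambda>y. cinner x y) -` {0})"
    by (intro continuous_closed_vimage bounded_linear.continuous[OF bounded_linear_cinner_right]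
        continuous_ident closed_singleton)
  then show "closed {y. cinner x y = 0}" by (simp add: vimage_def)
qed (auto simp: cinner_add_right cinner_scaleC_right)

lemma ocomp_closed_cspan: "ocomp (closed_cspan X) = ocomp X"
proof (rule subset_antisym)
  show "ocomp (closed_cspan X) \<subseteq> ocomp X" using closed_cspan_superset by (auto simp: ocomp_def)
  show "ocomp X \<subseteq> ocomp (closed_cspan X)"
  proof
    fix y assume y: "y \<in> ocomp X"
    have "closed_cspan X \<subseteq> {x. cinner y x = 0}"
      using y by (intro closed_cspan_minimal closed_csubspace_orthogonal)
        (auto simp: ocomp_def cinner_eq_0_commute[of y])
    then show "y \<in> ocomp (closed_cspan X)" by (auto simp: ocomp_def cinner_eq_0_commute[of y])
  qed
qed

text \<open>Double complement: the component of z orthogonal to the closed span is itself an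
  admissible y, hence orthogonal to z, hence 0.\<close>

lemma mem_closed_cspan_iff:
  fixes z :: "'a::chilbert"
  shows "z \<in> closed_cspan X \<longleftrightarrow> (\<forall>y\<in>ocomp X. cinner y z = 0)"
proof
  assume "z \<in> closed_cspan X"
  then show "\<forall>y\<in>ocomp X. cinner y z = 0"
    by (metis (mono_tags, lifting) cinner_eq_0_commute mem_Collect_eq ocomp_closed_cspan ocomp_def)
next
  assume *: "\<forall>y\<in>ocomp X. cinner y z = 0"
  let ?S = "closed_cspan X" and ?y = "z - hproj (closed_cspan X) z"
  note S = closed_csubspace_closed_cspan[of X]
  have y: "?y \<in> ocomp X"
    using hproj(2)[OF S closed_cspan_base] by (simp add: ocomp_def)
  have "cinner ?y z = 0" "cinner ?y (hproj ?S z) = 0"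
    using * y hproj(2)[OF S hproj(1)[OF S], of z z] by (auto simp: cinner_eq_0_commute)
  then have "cinner ?y ?y = 0" by (subst (1) cinner_diff_right) simp
  then have "z = hproj ?S z" by (simp add: cinner_self_eq_0)
  then show "z \<in> ?S" using hproj(1)[OF S] by metis
qed

lemma closed_cspan_eq_if_total:
  fixes W :: "'a::chilbert set"
  assumes W: "closed_csubspace W" "X \<subseteq> W" "\<And>y. y \<in> W \<Longrightarrow> (\<And>x. x \<in> X \<Longrightarrow> cinner x y = 0) \<Longrightarrow> y = 0"
  shows "closed_cspan X = W"
proof
  show "closed_cspan X \<subseteq> W" by (rule closed_cspan_minimal[OF W(1,2)])
  then have *: "hproj (closed_cspan X) z \<in> W" for z
    using hproj(1)[OF closed_csubspace_closed_cspan] by blast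
  show "W \<subseteq> closed_cspan X"
  proof
    fix z assume "z \<in> W"
    have "z - hproj (closed_cspan X) z = 0"
      by (intro W(3) closed_csubspaceD[OF W(1)] \<open>z \<in> W\<close> * hproj(2)[OF closed_csubspace_closed_cspan]
          closed_cspan_base)
    then show "z \<in> closed_cspan X" using hproj(1)[OF closed_csubspace_closed_cspan, of X z] by simp
  qed
qed

text \<open>The adjoint of an isometry is the projection onto its closed range followed by the
  inverse of g.\<close>

lemma isometry_adjoint:
  fixes g :: "'a::chilbert \<Rightarrow> 'b::chilbert"
  assumes K: "closed_csubspace K" and g: "isometry_on K g"
  obtains y' where "y' \<in> K" "\<And>k. k \<in> K \<Longrightarrow> cinner (g k) y = cinner k y'"
proof -
  note S = isometry_on_image_closed_csubspace[OF K g]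
  obtain y' where y': "y' \<in> K" "hproj (g ` K) y = g y'" using hproj(1)[OF S, of y] by blast
  have "cinner (g k) y = cinner k y'" if "k \<in> K" for k
    using hproj(2)[OF S, of "g k" y] that isometry_onD[OF g that y'(1)]
    by (simp add: cinner_diff_right y'(2))
  with y'(1) that show thesis by blast
qed

section \<open>Multiplicative form of product systems\<close>

text \<open>Double complement relative to W: the part of y orthogonal to A stays in W, so
  \<open>orth\<close> makes it orthogonal to y and therefore to itself.\<close>

lemma mem_csubspace_if_orthogonal:
  fixes y :: "'a::chilbert"
  assumes A: "closed_csubspace A" "A \<subseteq> W" and W: "closed_csubspace W" and y: "y \<in> W"
    and orth: "\<And>c. c \<in> W \<Longrightarrow> c \<in> ocomp A \<Longrightarrow> cinner c y = 0"
  shows "y \<in> A"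
proof -
  let ?c = "y - hproj A y"
  have h: "hproj A y \<in> A" by (rule hproj(1)[OF A(1)])
  have "?c \<in> W" using h A(2) y by (intro closed_csubspaceD[OF W]) auto
  moreover have "?c \<in> ocomp A" using hproj(2)[OF A(1)] by (simp add: ocomp_def)
  ultimately have "cinner ?c y = 0" by (rule orth)
  moreover have "cinner ?c (hproj A y) = 0"
    using hproj(2)[OF A(1) h, of y] cinner_eq_0_commute by blast
  ultimately have "cinner ?c ?c = 0" by (subst cinner_diff_right) simp
  then show ?thesis using h by (simp add: cinner_self_eq_0)
qed

text \<open>Multiplying or tensoring by a fixed vector scales all inner products by one constant. As
  for isometries, such maps are automatically linear, so bilinearity and boundedness of products
  need only the inner product law.\<close>

lemma similarity_bounded_op:
  fixes f :: "'a::complex_inner \<Rightarrow> 'b::complex_inner"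
  assumes W: "closed_csubspace W" and f: "f ` W \<subseteq> K"
    "\<And>x y. x \<in> W \<Longrightarrow> y \<in> W \<Longrightarrow> cinner (f x) (f y) = k * cinner x y"
  shows "bounded_op W K f"
  unfolding bounded_op_def clinear_on_def
proof (intro conjI ballI allI exI[of _ "sqrt (cmod k)"] f(1))
  note D = closed_csubspaceD[OF W]
  fix x assume x: "x \<in> W"
  show "f (x + y) = f x + f y" if y: "y \<in> W" for y
  proof -
    have "cinner (f (x + y) - (f x + f y)) (f (x + y) - (f x + f y)) = 0"
      using D f(2) x y
      by (simp add: cinner_diff_left cinner_diff_right cinner_add_left cinner_add_right algebra_simps)
    then show ?thesis by (simp add: cinner_self_eq_0)
  qed
  show "f (c *\<^sub>C x) = c *\<^sub>C f x" for c
  proof -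
    have "cinner (f (c *\<^sub>C x) - c *\<^sub>C f x) (f (c *\<^sub>C x) - c *\<^sub>C f x) = 0"
      using D f(2) x
      by (simp add: cinner_diff_left cinner_diff_right cinner_scaleC_left cinner_scaleC_right)
    then show ?thesis by (simp add: cinner_self_eq_0)
  qed
  have "complex_of_real ((norm (f x))\<^sup>2) = k * complex_of_real ((norm x)\<^sup>2)"
    using f(2)[OF x x] by (simp only: cinner_self)
  then have "(norm (f x))\<^sup>2 = cmod k * (norm x)\<^sup>2"
    by (metis norm_mult norm_of_real abs_power2)
  then have "norm (f x) = sqrt (cmod k * (norm x)\<^sup>2)" by (metis norm_ge_zero real_sqrt_unique)
  then show "norm (f x) \<le> sqrt (cmod k) * norm x" by (simp add: real_sqrt_mult)
qed

text \<open>Here \<open>m s t x y\<close> plays the role of \<open>x \<cdot> y\<close>. Unitarity of the structure maps becomes \<open>cinner_m\<close>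
  together with \<open>m_total\<close>, and coassociativity becomes \<open>m_assoc\<close>.\<close>

locale mult_system =
  fixes H :: "real \<Rightarrow> 'h::chilbert set" and m :: "real \<Rightarrow> real \<Rightarrow> 'h \<Rightarrow> 'h \<Rightarrow> 'h"
  assumes fibre_closed: "t > 0 \<Longrightarrow> closed_csubspace (H t)"
    and cinner_m: "\<lbrakk>s > 0; t > 0; x \<in> H s; x' \<in> H s; y \<in> H t; y' \<in> H t\<rbrakk> \<Longrightarrow>
      cinner (m s t x y) (m s t x' y') = cinner x x' * cinner y y'"
    and m_total: "\<lbrakk>s > 0; t > 0\<rbrakk> \<Longrightarrow> closed_cspan {m s t x y | x y. x \<in> H s \<and> y \<in> H t} = H (s + t)"
    and m_assoc: "\<lbrakk>r > 0; s > 0; t > 0; x \<in> H r; y \<in> H s; z \<in> H t\<rbrakk> \<Longrightarrow>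
      m (r + s) t (m r s x y) z = m r (s + t) x (m s t y z)"
begin

text \<open>The copy of the Hilbert tensor product of A and B that multiplication embeds into
  \<open>H (s + t)\<close>.\<close>

definition sprod :: "real \<Rightarrow> real \<Rightarrow> 'h set \<Rightarrow> 'h set \<Rightarrow> 'h set" where
  "sprod s t A B = closed_cspan {m s t x y | x y. x \<in> A \<and> y \<in> B}"

definition msub :: "(real \<Rightarrow> 'h set) \<Rightarrow> bool" where
  "msub G \<longleftrightarrow> (\<forall>t>0. closed_csubspace (G t) \<and> G t \<subseteq> H t) \<and>
    (\<forall>s>0. \<forall>t>0. sprod s t (G s) (G t) = G (s + t))"

lemma msubD:
  assumes "msub G"
  shows "t > 0 \<Longrightarrow> closed_csubspace (G t)" "t > 0 \<Longrightarrow> G t \<subseteq> H t"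
    "s > 0 \<Longrightarrow> t > 0 \<Longrightarrow> sprod s t (G s) (G t) = G (s + t)"
  using assms by (auto simp: msub_def)

lemma m_in: "\<lbrakk>s > 0; t > 0; x \<in> H s; y \<in> H t\<rbrakk> \<Longrightarrow> m s t x y \<in> H (s + t)"
  by (subst m_total[symmetric]) (auto intro!: closed_cspan_base)

lemma m_bounded_op_left:
  "\<lbrakk>s > 0; t > 0; y \<in> H t\<rbrakk> \<Longrightarrow> bounded_op (H s) (H (s + t)) (\<lambda>x. m s t x y)"
  by (rule similarity_bounded_op[where k = "cinner y y"]) (auto simp: fibre_closed m_in cinner_m)

lemma m_bounded_op_right:
  "\<lbrakk>s > 0; t > 0; x \<in> H s\<rbrakk> \<Longrightarrow> bounded_op (H t) (H (s + t)) (m s t x)"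
  by (rule similarity_bounded_op[where k = "cinner x x"]) (auto simp: fibre_closed m_in cinner_m)

lemma m_clinear_left: "\<lbrakk>s > 0; t > 0; y \<in> H t\<rbrakk> \<Longrightarrow> clinear_on (H s) (\<lambda>x. m s t x y)"
  using m_bounded_op_left by (auto simp: bounded_op_def)

lemma m_clinear_right: "\<lbrakk>s > 0; t > 0; x \<in> H s\<rbrakk> \<Longrightarrow> clinear_on (H t) (m s t x)"
  using m_bounded_op_right by (auto simp: bounded_op_def)

lemma m_diff_left:
  "\<lbrakk>s > 0; t > 0; x \<in> H s; x' \<in> H s; y \<in> H t\<rbrakk> \<Longrightarrow> m s t (x - x') y = m s t x y - m s t x' y"
  using clinear_on_diff[OF fibre_closed m_clinear_left] by blast

lemma m_diff_right:
  "\<lbrakk>s > 0; t > 0; x \<in> H s; y \<in> H t; y' \<in> H t\<rbrakk> \<Longrightarrow> m s t x (y - y') = m s t x y - m s t x y'"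
  using clinear_on_diff[OF fibre_closed m_clinear_right] by blast

lemma m_add_right:
  "\<lbrakk>s > 0; t > 0; x \<in> H s; y \<in> H t; y' \<in> H t\<rbrakk> \<Longrightarrow> m s t x (y + y') = m s t x y + m s t x y'"
  using clinear_on_add[OF m_clinear_right] by blast

lemma m_scaleC_left:
  "\<lbrakk>s > 0; t > 0; x \<in> H s; y \<in> H t\<rbrakk> \<Longrightarrow> m s t (c *\<^sub>C x) y = c *\<^sub>C m s t x y"
  using clinear_on_scaleC[OF m_clinear_left] by blast

lemma m_scaleC_right:
  "\<lbrakk>s > 0; t > 0; x \<in> H s; y \<in> H t\<rbrakk> \<Longrightarrow> m s t x (c *\<^sub>C y) = c *\<^sub>C m s t x y"
  using clinear_on_scaleC[OF m_clinear_right] by blast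

lemma norm_m:
  assumes "s > 0" "t > 0" "x \<in> H s" "y \<in> H t"
  shows "norm (m s t x y) = norm x * norm y"
proof -
  have "complex_of_real ((norm (m s t x y))\<^sup>2) = complex_of_real ((norm x)\<^sup>2 * (norm y)\<^sup>2)"
    unfolding of_real_mult cinner_self[symmetric] using assms by (intro cinner_m)
  then have "(norm (m s t x y))\<^sup>2 = (norm x * norm y)\<^sup>2"
    by (simp only: of_real_eq_iff power_mult_distrib)
  then show ?thesis by simp
qed

lemma closed_csubspace_sprod: "closed_csubspace (sprod s t A B)"
  by (simp add: sprod_def closed_csubspace_closed_cspan)

lemma sprod_base: "x \<in> A \<Longrightarrow> y \<in> B \<Longrightarrow> m s t x y \<in> sprod s t A B"
  unfolding sprod_def by (rule closed_cspan_base) blast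

lemma sprod_minimal:
  "closed_csubspace S \<Longrightarrow> (\<And>x y. x \<in> A \<Longrightarrow> y \<in> B \<Longrightarrow> m s t x y \<in> S) \<Longrightarrow> sprod s t A B \<subseteq> S"
  unfolding sprod_def by (rule closed_cspan_minimal) auto

lemma sprod_mono: "A \<subseteq> A' \<Longrightarrow> B \<subseteq> B' \<Longrightarrow> sprod s t A B \<subseteq> sprod s t A' B'"
  unfolding sprod_def by (rule closed_cspan_mono) auto

lemma sprod_fibre: "s > 0 \<Longrightarrow> t > 0 \<Longrightarrow> sprod s t (H s) (H t) = H (s + t)"
  unfolding sprod_def by (rule m_total)

lemma sprod_subset: "\<lbrakk>s > 0; t > 0; A \<subseteq> H s; B \<subseteq> H t\<rbrakk> \<Longrightarrow> sprod s t A B \<subseteq> H (s + t)"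
  using sprod_mono[of A "H s" B "H t" s t] by (simp add: sprod_fibre)

lemma msub_fibre: "msub H"
  by (simp add: msub_def fibre_closed sprod_fibre)

lemma sprod_closed_cspan_mem:
  assumes st: "s > 0" "t > 0" and AB: "A \<subseteq> H s" "B \<subseteq> H t"
    and x: "x \<in> closed_cspan A" and y: "y \<in> closed_cspan B"
  shows "m s t x y \<in> sprod s t A B"
proof -
  have *: "m s t a y \<in> sprod s t A B" if "a \<in> A" for a
  proof -
    have "closed_cspan B \<subseteq> {y \<in> H t. m s t a y \<in> sprod s t A B}"
      using AB that sprod_base st
      by (intro closed_cspan_minimal closed_csubspace_preimage[OF fibre_closed m_bounded_op_right]
          closed_csubspace_sprod) auto
    with y show ?thesis by blast
  qed
  have "y \<in> H t" using y AB st closed_cspan_minimal[OF fibre_closed] by blast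
  then have "closed_cspan A \<subseteq> {x \<in> H s. m s t x y \<in> sprod s t A B}"
    using AB st *
    by (intro closed_cspan_minimal closed_csubspace_preimage[OF fibre_closed m_bounded_op_left]
        closed_csubspace_sprod) auto
  with x show ?thesis by blast
qed

lemma sprod_closed_cspan:
  assumes "s > 0" "t > 0" "A \<subseteq> H s" "B \<subseteq> H t"
  shows "sprod s t (closed_cspan A) (closed_cspan B) = sprod s t A B"
proof
  show "sprod s t (closed_cspan A) (closed_cspan B) \<subseteq> sprod s t A B"
    by (rule sprod_minimal[OF closed_csubspace_sprod sprod_closed_cspan_mem[OF assms]])
  show "sprod s t A B \<subseteq> sprod s t (closed_cspan A) (closed_cspan B)"
    by (intro sprod_mono closed_cspan_superset)
qed

lemma sprod_assoc:
  assumes rst: "r > 0" "s > 0" "t > 0" and ABC: "A \<subseteq> H r" "B \<subseteq> H s" "C \<subseteq> H t"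
  shows "sprod (r + s) t (sprod r s A B) C = sprod r (s + t) A (sprod s t B C)"
proof (rule subset_antisym; rule sprod_minimal[OF closed_csubspace_sprod])
  let ?AB = "{m r s x y | x y. x \<in> A \<and> y \<in> B}" and ?BC = "{m s t x y | x y. x \<in> B \<and> y \<in> C}"
  have AB: "?AB \<subseteq> H (r + s)" and BC: "?BC \<subseteq> H (s + t)"
    using ABC rst by (auto intro!: m_in)
  fix p z
  show "m (r + s) t p z \<in> sprod r (s + t) A (sprod s t B C)"
    if p: "p \<in> sprod r s A B" and z: "z \<in> C"
  proof -
    have "m (r + s) t p z \<in> sprod (r + s) t ?AB C"
      using p z AB ABC rst unfolding sprod_def[of r s]
      by (intro sprod_closed_cspan_mem) (auto intro: closed_cspan_base)
    also have "sprod (r + s) t ?AB C \<subseteq> sprod r (s + t) A (sprod s t B C)"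
    proof (rule sprod_minimal[OF closed_csubspace_sprod])
      fix q z assume "q \<in> ?AB" "z \<in> C"
      then obtain x y where q: "q = m r s x y" "x \<in> A" "y \<in> B" by blast
      then have "m (r + s) t q z = m r (s + t) x (m s t y z)"
        using m_assoc[of r s t x y z] rst ABC \<open>z \<in> C\<close> by (simp add: subset_iff)
      then show "m (r + s) t q z \<in> sprod r (s + t) A (sprod s t B C)"
        using sprod_base[OF q(2) sprod_base[OF q(3) \<open>z \<in> C\<close>]] by simp
    qed
    finally show ?thesis .
  qed
  show "m r (s + t) p z \<in> sprod (r + s) t (sprod r s A B) C"
    if p: "p \<in> A" and z: "z \<in> sprod s t B C"
  proof -
    have "m r (s + t) p z \<in> sprod r (s + t) A ?BC"
      using p z BC ABC rst unfolding sprod_def[of s t]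
      by (intro sprod_closed_cspan_mem) (auto intro: closed_cspan_base)
    also have "sprod r (s + t) A ?BC \<subseteq> sprod (r + s) t (sprod r s A B) C"
    proof (rule sprod_minimal[OF closed_csubspace_sprod])
      fix x q assume "x \<in> A" "q \<in> ?BC"
      then obtain y z where q: "q = m s t y z" "y \<in> B" "z \<in> C" by blast
      then have "m r (s + t) x q = m (r + s) t (m r s x y) z"
        using m_assoc[of r s t x y z] rst ABC \<open>x \<in> A\<close> by (simp add: subset_iff)
      then show "m r (s + t) x q \<in> sprod (r + s) t (sprod r s A B) C"
        using sprod_base[OF sprod_base[OF \<open>x \<in> A\<close> q(2)] q(3)] by simp
    qed
    finally show ?thesis .
  qed
qed

section \<open>Projections and orthogonality in products of subspaces\<close>

lemma hproj_sprod_left: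
  assumes st: "s > 0" "t > 0" and A: "closed_csubspace A" "A \<subseteq> H s" and x: "x \<in> H s" and y: "y \<in> H t"
  shows "hproj (sprod s t A (H t)) (m s t x y) = m s t (hproj A x) y"
proof (rule hproj_eqI[OF closed_csubspace_sprod])
  have px: "hproj A x \<in> A" "hproj A x \<in> H s" using hproj(1)[OF A(1)] A(2) by auto
  show "m s t (hproj A x) y \<in> sprod s t A (H t)" by (intro sprod_base px y)
  have dx: "x - hproj A x \<in> H s" by (intro closed_csubspaceD[OF fibre_closed] st x px)
  have "cinner (m s t a b) (m s t (x - hproj A x) y) = 0" if "a \<in> A" "b \<in> H t" for a b
    using that A(2) cinner_m[OF st, of a "x - hproj A x" b y] dx y hproj(2)[OF A(1), of a x] by auto
  then have "m s t (x - hproj A x) y \<in> ocomp (sprod s t A (H t))"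
    unfolding sprod_def ocomp_closed_cspan by (auto simp: ocomp_def)
  then show "cinner n (m s t x y - m s t (hproj A x) y) = 0" if "n \<in> sprod s t A (H t)" for n
    using that m_diff_left[OF st x px(2) y] by (simp add: ocomp_def)
qed

text \<open>The projections onto \<open>A \<cdot> H t\<close> and \<open>H s \<cdot> M\<close> commute, and their product is the projection onto
  \<open>A \<cdot> M\<close>.\<close>

lemma norm_diff_hproj_sprod_le:
  assumes st: "s > 0" "t > 0" and A: "closed_csubspace A" "A \<subseteq> H s" and M: "closed_csubspace M" "M \<subseteq> H t"
  shows "(norm (z - hproj (sprod s t A M) z))\<^sup>2 \<le>
    (norm (z - hproj (sprod s t A (H t)) z))\<^sup>2 + (norm (z - hproj (sprod s t (H s) M) z))\<^sup>2"
proof -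
  let ?N1 = "sprod s t A (H t)" and ?N2 = "sprod s t (H s) M" and ?N = "sprod s t A M"
  note cl = closed_csubspace_sprod
  have "?N2 \<subseteq> {z \<in> UNIV. hproj ?N1 z \<in> ?N}"
  proof (rule sprod_minimal[OF closed_csubspace_preimage[OF closed_csubspace_UNIV hproj_bounded_op[OF cl] cl]])
    fix x y assume xy: "x \<in> H s" "y \<in> M"
    then have "hproj ?N1 (m s t x y) = m s t (hproj A x) y"
      using M(2) by (intro hproj_sprod_left st A) auto
    also have "\<dots> \<in> ?N" by (intro sprod_base hproj(1) A(1) xy(2))
    finally show "m s t x y \<in> {z \<in> UNIV. hproj ?N1 z \<in> ?N}" by simp
  qed
  then have in12: "hproj ?N1 (hproj ?N2 z) \<in> ?N" using hproj(1)[OF cl] by blast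
  have lin: "hproj ?N1 (z - hproj ?N2 z) = hproj ?N1 z - hproj ?N1 (hproj ?N2 z)"
    using hproj_bounded_op[OF cl, of UNIV] clinear_on_diff[OF closed_csubspace_UNIV]
    unfolding bounded_op_def by blast
  have le: "(norm (hproj ?N1 w))\<^sup>2 \<le> (norm w)\<^sup>2" for w
    using norm_diff_hproj_square[OF cl closed_csubspaceD(2)[OF cl], of w s t A "H t"] by simp
  \<comment> \<open>With P1, P2 the projections onto \<open>?N1\<close>, \<open>?N2\<close>, the
    competitor is P1 P2 z, and z - P1 P2 z is the orthogonal sum of z - P1 z and P1 (z - P2
    z).\<close>
  have "(norm (z - hproj ?N z))\<^sup>2 \<le> (norm (z - hproj ?N1 (hproj ?N2 z)))\<^sup>2"
    by (rule norm_diff_hproj_le[OF cl in12])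
  also have "\<dots> = (norm (z - hproj ?N1 z))\<^sup>2 + (norm (hproj ?N1 (z - hproj ?N2 z)))\<^sup>2"
    unfolding lin by (rule norm_diff_hproj_square[OF cl hproj(1)[OF cl]])
  also have "\<dots> \<le> (norm (z - hproj ?N1 z))\<^sup>2 + (norm (z - hproj ?N2 z))\<^sup>2"
    using le by simp
  finally show ?thesis .
qed

text \<open>In the fibre, the complement of A \<cdot> \<open>H t\<close> is spanned by products a
  \<cdot> b with a orthogonal to A: the complementary projection maps x \<cdot> y to such a product,
  with a the part of x orthogonal to A.\<close>

lemma mem_sprod_left:
  assumes st: "s > 0" "t > 0" and A: "closed_csubspace A" "A \<subseteq> H s" and z: "z \<in> H (s + t)"
    and orth: "\<And>a b. a \<in> H s \<Longrightarrow> a \<in> ocomp A \<Longrightarrow> b \<in> H t \<Longrightarrow> cinner (m s t a b) z = 0"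
  shows "z \<in> sprod s t A (H t)"
proof (rule mem_csubspace_if_orthogonal[OF closed_csubspace_sprod _ fibre_closed z])
  show sub: "sprod s t A (H t) \<subseteq> H (s + t)" using A st by (intro sprod_subset) auto
  fix c assume c: "c \<in> H (s + t)" "c \<in> ocomp (sprod s t A (H t))"
  have "cinner w z = 0" if w: "w \<in> H (s + t)" "w \<in> ocomp (sprod s t A (H t))" for w
  proof -
    let ?P = "hproj (sprod s t A (H t))"
    have "H (s + t) \<subseteq> {w \<in> UNIV. w - ?P w \<in> {y. cinner z y = 0}}"
      unfolding m_total[OF st, symmetric]
    proof (rule closed_cspan_minimal[OF closed_csubspace_preimage[OF closed_csubspace_UNIV bounded_op_diff
            closed_csubspace_orthogonal]])
      show "bounded_op UNIV UNIV (\<lambda>w :: 'h. w)" by (auto simp: bounded_op_def clinear_on_def intro!: exI[of _ 1])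
      show "bounded_op UNIV (sprod s t A (H t)) ?P" by (rule hproj_bounded_op[OF closed_csubspace_sprod])
      have "cinner (m s t x y - ?P (m s t x y)) z = 0" if xy: "x \<in> H s" "y \<in> H t" for x y
      proof -
        have px: "hproj A x \<in> H s" using hproj(1)[OF A(1)] A(2) by auto
        have "m s t x y - ?P (m s t x y) = m s t (x - hproj A x) y"
          using hproj_sprod_left[OF st A xy] m_diff_left[OF st xy(1) px xy(2)] by simp
        moreover have "x - hproj A x \<in> ocomp A" using hproj(2)[OF A(1)] by (simp add: ocomp_def)
        moreover have "x - hproj A x \<in> H s" by (intro closed_csubspaceD[OF fibre_closed] st xy px)
        ultimately show ?thesis using orth xy by simp
      qed
      then show "{m s t x y |x y. x \<in> H s \<and> y \<in> H t} \<subseteq> {w \<in> UNIV. w - ?P w \<in> {y. cinner z y = 0}}"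
        by (auto simp: cinner_eq_0_commute[of z])
    qed
    then have "cinner z (w - ?P w) = 0" using w by blast
    moreover have "?P w = 0"
      using w(2) by (intro hproj_eqI closed_csubspace_sprod closed_csubspaceD(2)) (auto simp: ocomp_def)
    ultimately show ?thesis by (simp add: cinner_eq_0_commute)
  qed
  then show "cinner c z = 0" using c by blast
qed (use st in auto)

text \<open>Reversal of time. It turns every statement about the left factor into one about the
  right factor.\<close>

lemma opposite: "mult_system H (\<lambda>s t x y. m t s y x)"
proof
  fix s t :: real assume st: "s > 0" "t > 0"
  have "{m t s y x | x y. x \<in> H s \<and> y \<in> H t} = {m t s x y | x y. x \<in> H t \<and> y \<in> H s}" by auto
  then show "closed_cspan {m t s y x | x y. x \<in> H s \<and> y \<in> H t} = H (s + t)"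
    using m_total[OF st(2,1)] by (simp add: add.commute)
next
  fix r s t :: real and x y z
  assume "r > 0" "s > 0" "t > 0" "x \<in> H r" "y \<in> H s" "z \<in> H t"
  then show "m t (r + s) z (m s r y x) = m (s + t) r (m t s z y) x"
    using m_assoc[of t s r z y x] by (simp add: add.commute)
qed (simp_all add: fibre_closed cinner_m mult.commute)

lemma sprod_opposite: "mult_system.sprod (\<lambda>s t x y. m t s y x) s t A B = sprod t s B A"
  unfolding mult_system.sprod_def[OF opposite] sprod_def by (rule arg_cong[where f = closed_cspan]) auto

lemma mem_sprod_right:
  assumes "s > 0" "t > 0" "closed_csubspace B" "B \<subseteq> H t" "z \<in> H (s + t)"
    and "\<And>a b. a \<in> H s \<Longrightarrow> b \<in> H t \<Longrightarrow> b \<in> ocomp B \<Longrightarrow> cinner (m s t a b) z = 0"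
  shows "z \<in> sprod s t (H s) B"
  using mult_system.mem_sprod_left[OF opposite, of t s B z] assms
  by (simp add: sprod_opposite add.commute)

text \<open>A \<cdot> B is the intersection of A \<cdot> \<open>H t\<close> and \<open>H s\<close>
  \<cdot> B, since a vector at distance 0 from both is at distance 0 from A \<cdot> B by
  \<open>norm_diff_hproj_sprod_le\<close>.\<close>

lemma mem_sprodI:
  assumes st: "s > 0" "t > 0" and A: "closed_csubspace A" "A \<subseteq> H s" and B: "closed_csubspace B" "B \<subseteq> H t"
    and z: "z \<in> H (s + t)"
    and "\<And>a b. a \<in> H s \<Longrightarrow> a \<in> ocomp A \<Longrightarrow> b \<in> H t \<Longrightarrow> cinner (m s t a b) z = 0"
    and "\<And>a b. a \<in> H s \<Longrightarrow> b \<in> H t \<Longrightarrow> b \<in> ocomp B \<Longrightarrow> cinner (m s t a b) z = 0"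
  shows "z \<in> sprod s t A B"
proof (rule mem_closed_csubspace_hproj[OF closed_csubspace_sprod])
  have "hproj (sprod s t A (H t)) z = z" "hproj (sprod s t (H s) B) z = z"
    using mem_sprod_left[OF st A z] mem_sprod_right[OF st B z] assms(8,9)
    by (auto intro!: hproj_id closed_csubspace_sprod)
  then show "norm (z - hproj (sprod s t A B) z) = 0"
    using norm_diff_hproj_sprod_le[OF st A B, of z] by simp
qed

section \<open>Intersections of product subsystems\<close>

lemma sprod_orthogonal_left:
  assumes st: "s > 0" "t > 0" and AB: "A \<subseteq> H s" "B \<subseteq> H t" and a: "a \<in> H s" "a \<in> ocomp A"
    and b: "b \<in> H t" and z: "z \<in> sprod s t A B"
  shows "cinner (m s t a b) z = 0"
proof -
  have "sprod s t A B \<subseteq> {z. cinner (m s t a b) z = 0}"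
    using assms by (intro sprod_minimal closed_csubspace_orthogonal)
      (auto simp: cinner_m subset_iff ocomp_def cinner_eq_0_commute[of a])
  with z show ?thesis by blast
qed

text \<open>Inside W, the complement of an intersection is the closed span of the complements. A
  test vector y orthogonal to all of them is first projected to W; the projection then lies in every
  member of the family.\<close>

lemma ocomp_Inter_subset:
  assumes \<G>: "\<And>A. A \<in> \<G> \<Longrightarrow> closed_csubspace A \<and> A \<subseteq> W" and W: "closed_csubspace (W :: 'h set)"
    and V: "closed_csubspace V" "\<And>A a. A \<in> \<G> \<Longrightarrow> a \<in> W \<Longrightarrow> a \<in> ocomp A \<Longrightarrow> a \<in> V"
    and a: "a \<in> W" "a \<in> ocomp (W \<inter> \<Inter>\<G>)"
  shows "a \<in> V"
proof -
  let ?X = "{a \<in> W. \<exists>A\<in>\<G>. a \<in> ocomp A}"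
  have "a \<in> closed_cspan ?X"
    unfolding mem_closed_cspan_iff
  proof
    fix y assume y: "y \<in> ocomp ?X"
    let ?p = "hproj W y"
    have d: "cinner (y - ?p) w = 0" if "w \<in> W" for w
      using hproj(2)[OF W that] cinner_eq_0_commute by blast
    have "?p \<in> A" if A: "A \<in> \<G>" for A
    proof (rule mem_csubspace_if_orthogonal[of A W])
      fix c assume c: "c \<in> W" "c \<in> ocomp A"
      then have "cinner c y = 0" using y A by (auto simp: ocomp_def)
      moreover have "cinner c (y - ?p) = 0" using d[OF c(1)] cinner_eq_0_commute by blast
      ultimately show "cinner c ?p = 0" by (simp add: cinner_diff_right)
    qed (use \<G>[OF A] W hproj(1)[OF W] in auto)
    then have "cinner ?p a = 0" using a(2) hproj(1)[OF W] by (auto simp: ocomp_def)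
    then show "cinner y a = 0" using d[OF a(1)] by (simp add: cinner_diff_left)
  qed
  moreover have "closed_cspan ?X \<subseteq> V" using V by (intro closed_cspan_minimal) auto
  ultimately show ?thesis by blast
qed

lemma msub_opposite: "mult_system.msub H (\<lambda>s t x y. m t s y x) G \<longleftrightarrow> msub G"
  unfolding msub_def mult_system.msub_def[OF opposite] sprod_opposite by (metis add.commute)

lemma orthogonal_Inter_left:
  assumes \<G>: "\<And>G. G \<in> \<G> \<Longrightarrow> msub G" "\<G> \<noteq> {}" and st: "s > 0" "t > 0"
    and z: "\<And>G. G \<in> \<G> \<Longrightarrow> z \<in> G (s + t)"
    and a: "a \<in> H s" "a \<in> ocomp (\<Inter>G\<in>\<G>. G s)" and b: "b \<in> H t"
  shows "cinner (m s t a b) z = 0"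
proof -
  have eq: "(\<Inter>G\<in>\<G>. G s) = H s \<inter> \<Inter>((\<lambda>G. G s) ` \<G>)"
    using msubD(2)[OF \<G>(1) st(1)] \<G>(2) by blast
  have a2: "a \<in> ocomp (H s \<inter> \<Inter>((\<lambda>G. G s) ` \<G>))"
    unfolding eq[symmetric] by (rule a(2))
  have "a \<in> {a \<in> H s. m s t a b \<in> {w. cinner z w = 0}}"
  proof (rule ocomp_Inter_subset[OF _ _ _ _ a(1) a2])
    show "closed_csubspace {a \<in> H s. m s t a b \<in> {w. cinner z w = 0}}"
      by (intro closed_csubspace_preimage[OF fibre_closed m_bounded_op_left]
          closed_csubspace_orthogonal st b)
    fix A c assume c: "A \<in> (\<lambda>G. G s) ` \<G>" "c \<in> H s" "c \<in> ocomp A"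
    then obtain G where G: "G \<in> \<G>" "A = G s" by blast
    note D = msubD[OF \<G>(1)[OF G(1)]]
    have "cinner (m s t c b) z = 0"
      using sprod_orthogonal_left[OF st D(2)[OF st(1)] D(2)[OF st(2)] c(2) c(3)[unfolded G(2)] b]
        D(3)[OF st] z[OF G(1)] by simp
    then show "c \<in> {a \<in> H s. m s t a b \<in> {w. cinner z w = 0}}"
      using c(2) by (simp add: cinner_eq_0_commute[of z])
  qed (use msubD[OF \<G>(1)] st fibre_closed in \<open>auto simp: subset_iff\<close>)
  then show ?thesis by (simp add: cinner_eq_0_commute[of z])
qed

lemma orthogonal_Inter_right:
  assumes "\<And>G. G \<in> \<G> \<Longrightarrow> msub G" "\<G> \<noteq> {}" "s > 0" "t > 0" "\<And>G. G \<in> \<G> \<Longrightarrow> z \<in> G (s + t)"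
    and "b \<in> H t" "b \<in> ocomp (\<Inter>G\<in>\<G>. G t)" "a \<in> H s"
  shows "cinner (m s t a b) z = 0"
  using mult_system.orthogonal_Inter_left[OF opposite, of \<G> t s z b a] assms
  by (simp add: msub_opposite add.commute)

text \<open>The hard inclusion is that an element common to all \<open>G (s + t)\<close> splits
  along the intersections. By \<open>mem_sprodI\<close> it must be orthogonal to a \<cdot> b with a
  in the complement of the intersection of the \<open>G s\<close>; that complement is spanned by the
  complements of the single \<open>G s\<close>, for which orthogonality is known. The right factor
  is symmetric.\<close>

lemma msub_Inter:
  assumes \<G>: "\<And>G. G \<in> \<G> \<Longrightarrow> msub G" "\<G> \<noteq> {}"
  shows "msub (\<lambda>t. \<Inter>G\<in>\<G>. G t)"
proof -
  let ?I = "\<lambda>t. \<Inter>G\<in>\<G>. G t"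
  have cl: "closed_csubspace (?I t)" and sub: "?I t \<subseteq> H t" if "t > 0" for t
  proof -
    show "closed_csubspace (?I t)" using msubD[OF \<G>(1)] that by (auto intro!: closed_csubspace_Inter)
    show "?I t \<subseteq> H t" using msubD(2)[OF \<G>(1)] that \<G>(2) by blast
  qed
  moreover have "sprod s t (?I s) (?I t) = ?I (s + t)" if st: "s > 0" "t > 0" for s t
  proof
    show "sprod s t (?I s) (?I t) \<subseteq> ?I (s + t)"
    proof (rule INT_greatest)
      fix G assume G: "G \<in> \<G>"
      have "sprod s t (?I s) (?I t) \<subseteq> sprod s t (G s) (G t)" using G by (intro sprod_mono) auto
      then show "sprod s t (?I s) (?I t) \<subseteq> G (s + t)" using msubD(3)[OF \<G>(1)[OF G] st] by simp
    qed
    show "?I (s + t) \<subseteq> sprod s t (?I s) (?I t)"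
    proof
      fix z assume z: "z \<in> ?I (s + t)"
      then have zG: "\<And>G. G \<in> \<G> \<Longrightarrow> z \<in> G (s + t)" by blast
      show "z \<in> sprod s t (?I s) (?I t)"
      proof (rule mem_sprodI[OF st cl[OF st(1)] sub[OF st(1)] cl[OF st(2)] sub[OF st(2)]])
        show "z \<in> H (s + t)" using z sub[of "s + t"] st by auto
        show "cinner (m s t a b) z = 0" if "a \<in> H s" "a \<in> ocomp (?I s)" "b \<in> H t" for a b
          by (rule orthogonal_Inter_left[where \<G> = \<G>, OF _ \<G>(2) st _ that]) (fact \<G>(1) zG)+
        show "cinner (m s t a b) z = 0" if "a \<in> H s" "b \<in> H t" "b \<in> ocomp (?I t)" for a b
          by (rule orthogonal_Inter_right[where \<G> = \<G>, OF _ \<G>(2) st _ that(2,3,1)]) (fact \<G>(1) zG)+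
      qed
    qed
  qed
  ultimately show ?thesis by (auto simp: msub_def)
qed

end

section \<open>Multiplicative sections and separability\<close>

text \<open>For a slope \<delta> > 0 let c be the supremum of the times at which the bound with
  slope \<delta> holds. The one-sided estimate \<open>lip\<close> excludes an upward jump, so the
  bound holds at c, and \<open>deriv\<close> would carry it past c unless c = b. Then \<delta> tends
  to 0.\<close>

lemma le_if_right_derivative_nonpos:
  fixes \<phi> :: "real \<Rightarrow> real"
  assumes ab: "a \<le> b" and C: "C \<ge> 0"
    and lip: "\<And>x y. a \<le> x \<Longrightarrow> x \<le> y \<Longrightarrow> y \<le> b \<Longrightarrow> \<phi> y \<le> \<phi> x + C * (y - x)"
    and deriv: "\<And>x \<delta>. a \<le> x \<Longrightarrow> x < b \<Longrightarrow> \<delta> > 0 \<Longrightarrow>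
      \<exists>h0>0. \<forall>h. 0 < h \<and> h \<le> h0 \<and> x + h \<le> b \<longrightarrow> \<phi> (x + h) \<le> \<phi> x + \<delta> * h"
  shows "\<phi> b \<le> \<phi> a"
proof -
  have le: "\<phi> b \<le> \<phi> a + \<delta> * (b - a)" if \<delta>: "\<delta> > 0" for \<delta>
  proof -
    define A where "A = {c \<in> {a..b}. \<phi> c \<le> \<phi> a + \<delta> * (c - a)}"
    define c where "c = Sup A"
    have bdd: "bdd_above A" by (rule bdd_aboveI[of _ b]) (auto simp: A_def)
    have aA: "a \<in> A" using ab by (simp add: A_def)
    have up: "c' \<le> c" if "c' \<in> A" for c' unfolding c_def by (rule cSup_upper[OF that bdd])
    have ac: "a \<le> c" using up[OF aA] .
    have cb: "c \<le> b" unfolding c_def using aA by (intro cSup_least) (auto simp: A_def)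
    have "\<phi> c \<le> \<phi> a + \<delta> * (c - a) + \<eta>" if "\<eta> > 0" for \<eta>
    proof -
      have pos: "\<eta> / (C + 1) > 0" using that C by simp
      then have "\<exists>c'\<in>A. c - \<eta> / (C + 1) < c'"
        using less_cSup_iff[OF _ bdd, of "c - \<eta> / (C + 1)"] aA unfolding c_def by auto
      then obtain c' where c': "c' \<in> A" "c - \<eta> / (C + 1) < c'" by blast
      have cc: "c' \<le> c" by (rule up[OF c'(1)])
      have "\<phi> c \<le> \<phi> c' + C * (c - c')" using c'(1) cc cb by (intro lip) (auto simp: A_def)
      also have "\<phi> c' \<le> \<phi> a + \<delta> * (c' - a)" using c'(1) by (simp add: A_def)
      also have "\<delta> * (c' - a) \<le> \<delta> * (c - a)" using \<delta> cc by simp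
      also have "C * (c - c') \<le> (C + 1) * (c - c')" using cc by (simp add: mult_right_mono)
      also have "(C + 1) * (c - c') \<le> (C + 1) * (\<eta> / (C + 1))"
        using c'(2) C by (intro mult_left_mono) auto
      also have "\<dots> = \<eta>" using C by simp
      finally show ?thesis by simp
    qed
    then have "\<phi> c \<le> \<phi> a + \<delta> * (c - a)" by (rule field_le_epsilon)
    moreover have "c = b"
    proof (rule ccontr)
      assume "c \<noteq> b"
      then have "c < b" using cb by simp
      then obtain h0 where h0: "h0 > 0" "\<And>h. 0 < h \<Longrightarrow> h \<le> h0 \<Longrightarrow> c + h \<le> b \<Longrightarrow> \<phi> (c + h) \<le> \<phi> c + \<delta> * h"
        using deriv[OF ac _ \<delta>] by blast
      define h where "h = min h0 (b - c)"
      have h: "0 < h" "h \<le> h0" "c + h \<le> b" using h0(1) \<open>c < b\<close> by (auto simp: h_def)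
      have "\<phi> (c + h) \<le> \<phi> a + \<delta> * (c + h - a)"
        using h0(2)[OF h] \<open>\<phi> c \<le> \<phi> a + \<delta> * (c - a)\<close> by (simp add: algebra_simps)
      then have "c + h \<in> A" using h ac by (simp add: A_def)
      from up[OF this] show False using h by simp
    qed
    ultimately show ?thesis by simp
  qed
  show ?thesis
  proof (rule field_le_epsilon)
    fix e :: real assume e: "e > 0"
    have "b - a + 1 > 0" using ab by simp
    have "\<phi> b \<le> \<phi> a + e / (b - a + 1) * (b - a)" using e ab by (intro le) simp
    also have "e / (b - a + 1) * (b - a) \<le> e / (b - a + 1) * (b - a + 1)"
      using e ab by (intro mult_left_mono) auto
    also have "\<dots> = e" using \<open>b - a + 1 > 0\<close> by simp
    finally show "\<phi> b \<le> \<phi> a + e" by simp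
  qed
qed

text \<open>About r/s copies of s fit into r, so that power of \<open>f s\<close> is at least
  \<open>f r\<close>. Taking logarithms, -ln (f s) is at most of order s, and it dominates 1 - f
  s.\<close>

lemma multiplicative_linear_bound:
  fixes f :: "real \<Rightarrow> real"
  assumes f: "\<And>s. s > 0 \<Longrightarrow> 0 \<le> f s \<and> f s \<le> 1" "\<And>s t. s > 0 \<Longrightarrow> t > 0 \<Longrightarrow> f (s + t) = f s * f t"
    and r: "r > 0" "f r > 0"
  obtains c where "c \<ge> 0" "\<And>s. s > 0 \<Longrightarrow> 1 - f s \<le> c * s"
proof -
  have pow: "f (real (Suc n) * s) = f s ^ Suc n" if "s > 0" for s n
  proof (induction n)
    case (Suc n)
    have "real (Suc (Suc n)) * s = real (Suc n) * s + s" by (simp add: algebra_simps)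
    then have "f (real (Suc (Suc n)) * s) = f (real (Suc n) * s) * f s"
      using f(2)[of "real (Suc n) * s" s] that by simp
    with Suc show ?case by (simp add: mult.commute)
  qed simp
  define q where "q = f r"
  have q: "0 < q" "q \<le> 1" using r f(1)[of r] by (auto simp: q_def)
  then have lq: "ln q \<le> 0" by simp
  \<comment> \<open>The term -2 ln q / r serves s \<le> r, the 2 coming from n \<ge> r/(2 s); the
    term 1/r serves s > r, where 1 - f s \<le> 1 \<le> s/r.\<close>
  define c where "c = (1 - 2 * ln q) / r"
  have bound: "1 - f s \<le> c * s" if s: "s > 0" for s
  proof (cases "s \<le> r")
    case True
    define n where "n = nat \<lfloor>r / s\<rfloor>"
    have rs: "r / s \<ge> 1" using True s by simp
    then have n1: "n \<ge> 1" by (simp add: n_def le_nat_iff)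
    have nle: "real n \<le> r / s" and nge: "r / s < real n + 1" using rs by (simp_all add: n_def)
    then have n2: "r / s \<le> 2 * real n" using n1 by linarith
    have ns: "real n * s \<le> r" using nle s by (simp add: field_simps)
    have "q \<le> f (real n * s)"
    proof (cases "real n * s = r")
      case False
      then have d: "r - real n * s > 0" "real n * s > 0" using ns n1 s by auto
      have "q = f (real n * s) * f (r - real n * s)" using f(2)[OF d(2,1)] by (simp add: q_def)
      also have "\<dots> \<le> f (real n * s) * 1" using f(1) d by (intro mult_left_mono) auto
      finally show ?thesis by simp
    qed (simp add: q_def)
    also have "f (real n * s) = f s ^ n" using pow[OF s, of "n - 1"] n1 by simp
    finally have qn: "q \<le> f s ^ n" .
    then have fs: "f s > 0"
      using q(1) f(1)[OF s] n1 by (metis less_le not_less_eq_eq power_0_left zero_less_power_eq One_nat_def le_zero_eq linorder_not_le)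
    have "ln q \<le> real n * ln (f s)"
      using qn q(1) fs by (metis ln_le_cancel_iff ln_realpow zero_less_power)
    then have "- ln (f s) \<le> - ln q / real n" using n1 by (simp add: field_simps)
    also have "\<dots> \<le> - ln q * (2 * s / r)"
    proof -
      have "1 / real n \<le> 2 * s / r" using n2 n1 s r by (simp add: field_simps)
      then show ?thesis using mult_left_mono[of "1 / real n" "2 * s / r" "- ln q"] lq by simp
    qed
    also have "\<dots> \<le> c * s" using s r by (simp add: c_def field_simps)
    finally have "- ln (f s) \<le> c * s" .
    moreover have "ln (f s) \<le> f s - 1" by (rule ln_le_minus_one[OF fs])
    ultimately show ?thesis by simp
  next
    case False
    have "1 - f s \<le> 1" using f(1)[OF s] by simp
    also have "1 \<le> s / r" using False r by simp
    also have "s / r \<le> c * s"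
    proof -
      have "1 / r \<le> c" using lq r by (simp add: c_def divide_right_mono)
      then show ?thesis using mult_right_mono[of "1 / r" c s] s by simp
    qed
    finally show ?thesis .
  qed
  have "c \<ge> 0" using lq r by (simp add: c_def)
  with bound that show thesis by blast
qed

text \<open>Each value is within c/2 of a point of D, and values at distance at least c cannot share
  such a point; so I injects into D.\<close>

lemma countable_if_separated:
  fixes g :: "real \<Rightarrow> 'a::metric_space"
  assumes D: "countable D" and g: "g ` I \<subseteq> closure D" and c: "c > 0"
    and sep: "\<And>s t. s \<in> I \<Longrightarrow> t \<in> I \<Longrightarrow> s < t \<Longrightarrow> dist (g s) (g t) \<ge> c"
  shows "countable I"
proof -
  have "\<exists>d\<in>D. dist d (g t) < c / 2" if "t \<in> I" for t
  proof -
    have "g t \<in> closure D" using g that by blast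
    then show ?thesis using c unfolding closure_approachable by (meson half_gt_zero)
  qed
  then obtain d where d: "\<And>t. t \<in> I \<Longrightarrow> d t \<in> D" "\<And>t. t \<in> I \<Longrightarrow> dist (d t) (g t) < c / 2" by metis
  have "inj_on d I"
  proof (rule linorder_inj_onI')
    fix s t assume st: "s \<in> I" "t \<in> I" "s < t"
    show "d s \<noteq> d t"
    proof
      assume "d s = d t"
      then have "dist (g s) (g t) < c"
        using d(2)[OF st(1)] d(2)[OF st(2)] dist_triangle_half_l[of "d s" "g s" c "g t"]
        by (metis dist_commute dist_triangle_half_r)
      with sep[OF st] show False by simp
    qed
  qed
  moreover have "countable (d ` I)" using D d(1) by (meson countable_subset image_subsetI)
  ultimately show ?thesis by (meson countable_image_inj_on)
qed

section \<open>Right continuity and overlap of sections from separability\<close>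

context mult_system
begin

lemma m_assoc': "\<lbrakk>r > 0; s > 0; t > 0; x \<in> H r; y \<in> H s; z \<in> H t; r + s = a; s + t = b\<rbrakk> \<Longrightarrow>
    m a t (m r s x y) z = m r b x (m s t y z)"
  using m_assoc by blast

lemma m_in': "\<lbrakk>s > 0; t > 0; x \<in> H s; y \<in> H t; s + t = a\<rbrakk> \<Longrightarrow> m s t x y \<in> H a"
  using m_in by blast

text \<open>The algebraic content of a normalised unit. The regularity used below comes from
  separable fibres through \<open>section_right_continuous\<close>.\<close>

definition msection :: "(real \<Rightarrow> 'h) \<Rightarrow> bool" where
  "msection w \<longleftrightarrow> (\<forall>t>0. w t \<in> H t \<and> norm (w t) = 1) \<and> (\<forall>s>0. \<forall>t>0. w (s + t) = m s t (w s) (w t))"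

lemma msectionD:
  assumes "msection w"
  shows "t > 0 \<Longrightarrow> w t \<in> H t" "t > 0 \<Longrightarrow> norm (w t) = 1" "t > 0 \<Longrightarrow> cinner (w t) (w t) = 1"
    "\<lbrakk>s > 0; t > 0; s + t = a\<rbrakk> \<Longrightarrow> w a = m s t (w s) (w t)"
  using assms by (auto simp: msection_def cinner_self)

definition separable_fibres :: bool where
  "separable_fibres \<longleftrightarrow> (\<forall>t>0. \<exists>D. countable D \<and> H t \<subseteq> closure D)"

text \<open>If \<open>x\<close> is orthogonal to all \<open>v \<epsilon> \<cdot> H (r - \<epsilon>)\<close>, then the vectors \<open>v \<tau> \<cdot> x \<cdot> v (1 - \<tau>)\<close>,
  \<open>0 < \<tau> < 1\<close>, are pairwise orthogonal, so separability forces \<open>x = 0\<close>.\<close>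

lemma orthogonal_to_sections_0:
  assumes sep: separable_fibres and v: "msection v" and r: "r > 0" and x: "x \<in> H r"
    and orth: "\<And>\<epsilon> y. 0 < \<epsilon> \<Longrightarrow> \<epsilon> < r \<Longrightarrow> y \<in> H (r - \<epsilon>) \<Longrightarrow> cinner (m \<epsilon> (r - \<epsilon>) (v \<epsilon>) y) x = 0"
  shows "x = 0"
proof (rule ccontr)
  assume x0: "x \<noteq> 0"
  note V = msectionD[OF v]
  \<comment> \<open>\<open>Y \<tau>\<close> is the word v, x, v of total length r + 1 in which x
    occupies the slot from \<tau> to \<tau> + r.\<close>
  define X where "X \<tau> = m r (1 - \<tau>) x (v (1 - \<tau>))" for \<tau>
  define Y where "Y \<tau> = m \<tau> (r + 1 - \<tau>) (v \<tau>) (X \<tau>)" for \<tau>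
  have X: "X \<tau> \<in> H (r + 1 - \<tau>)" "norm (X \<tau>) = norm x" if "0 < \<tau>" "\<tau> < 1" for \<tau>
    unfolding X_def using that r x V by (auto intro!: m_in' simp: norm_m)
  have Y: "Y \<tau> \<in> H (r + 1)" "norm (Y \<tau>) = norm x" if "0 < \<tau>" "\<tau> < 1" for \<tau>
    unfolding Y_def using that r X[OF that] V by (auto intro!: m_in' simp: norm_m)
  have orth': "cinner (Y \<tau>) (Y \<sigma>) = 0" if \<tau>: "0 < \<tau>" "\<tau> < \<sigma>" "\<sigma> < 1" for \<tau> \<sigma>
  proof -
    \<comment> \<open>From time \<tau> on, \<open>Y \<sigma>\<close> continues with v for a duration
      \<sigma> - \<tau>, whereas \<open>Y \<tau>\<close> has x there. Halving the minimum keeps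
      \<epsilon> strictly below both that duration and r, so that \<open>v \<epsilon>\<close> can be
      split off and \<open>orth\<close> applied against x.\<close>
    define \<epsilon> where "\<epsilon> = min (\<sigma> - \<tau>) r / 2"
    have \<epsilon>: "0 < \<epsilon>" "\<epsilon> < \<sigma> - \<tau>" "\<epsilon> < r" using \<tau> r by (auto simp: \<epsilon>_def min_def)
    define b where "b = r + 1 - \<tau> - \<epsilon>"
    have b: "b > 0" "\<epsilon> + b = r + 1 - \<tau>" using \<tau> \<epsilon> r by (auto simp: b_def)
    define q where "q = m (\<sigma> - \<tau> - \<epsilon>) (r + 1 - \<sigma>) (v (\<sigma> - \<tau> - \<epsilon>)) (X \<sigma>)"
    have X\<sigma>: "X \<sigma> \<in> H (r + 1 - \<sigma>)" using X \<tau> by simp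
    have q: "q \<in> H b" unfolding q_def using V X\<sigma> \<tau> \<epsilon> r by (intro m_in') (auto simp: b_def)
    have vq: "m \<epsilon> b (v \<epsilon>) q \<in> H (r + 1 - \<tau>)" using V q \<epsilon> b by (intro m_in') auto
    have "m \<epsilon> b (v \<epsilon>) q = m (\<sigma> - \<tau>) (r + 1 - \<sigma>) (m \<epsilon> (\<sigma> - \<tau> - \<epsilon>) (v \<epsilon>) (v (\<sigma> - \<tau> - \<epsilon>))) (X \<sigma>)"
      unfolding q_def using V X\<sigma> \<tau> \<epsilon> r by (intro m_assoc'[symmetric]) (auto simp: b_def)
    also have "m \<epsilon> (\<sigma> - \<tau> - \<epsilon>) (v \<epsilon>) (v (\<sigma> - \<tau> - \<epsilon>)) = v (\<sigma> - \<tau>)"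
      using \<epsilon> by (intro V(4)[symmetric]) auto
    finally have eq1: "m \<epsilon> b (v \<epsilon>) q = m (\<sigma> - \<tau>) (r + 1 - \<sigma>) (v (\<sigma> - \<tau>)) (X \<sigma>)" .
    have "Y \<sigma> = m \<sigma> (r + 1 - \<sigma>) (m \<tau> (\<sigma> - \<tau>) (v \<tau>) (v (\<sigma> - \<tau>))) (X \<sigma>)"
      unfolding Y_def using V(4)[of \<tau> "\<sigma> - \<tau>" \<sigma>] \<tau> by simp
    also have "\<dots> = m \<tau> (r + 1 - \<tau>) (v \<tau>) (m \<epsilon> b (v \<epsilon>) q)"
      unfolding eq1 using V X\<sigma> \<tau> r by (intro m_assoc') auto
    finally have Y\<sigma>: "Y \<sigma> = m \<tau> (r + 1 - \<tau>) (v \<tau>) (m \<epsilon> b (v \<epsilon>) q)" .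
    \<comment> \<open>Cutting the remainder q where x ends separates the factor paired with x from
      the one paired with \<open>v (1 - \<tau>)\<close>.\<close>
    have "b = (r - \<epsilon>) + (1 - \<tau>)" by (simp add: b_def)
    then have "H b = closed_cspan {m (r - \<epsilon>) (1 - \<tau>) y z | y z. y \<in> H (r - \<epsilon>) \<and> z \<in> H (1 - \<tau>)}"
      using m_total[of "r - \<epsilon>" "1 - \<tau>"] \<tau> \<epsilon> by simp
    also have "\<dots> \<subseteq> {q \<in> H b. m \<epsilon> b (v \<epsilon>) q \<in> {w. cinner (X \<tau>) w = 0}}"
    proof (rule closed_cspan_minimal)
      show "closed_csubspace {q \<in> H b. m \<epsilon> b (v \<epsilon>) q \<in> {w. cinner (X \<tau>) w = 0}}"
        using V(1) \<epsilon> b(1)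
        by (intro closed_csubspace_preimage[OF fibre_closed m_bounded_op_right] closed_csubspace_orthogonal) auto
      have "m (r - \<epsilon>) (1 - \<tau>) y z \<in> H b \<and> cinner (X \<tau>) (m \<epsilon> b (v \<epsilon>) (m (r - \<epsilon>) (1 - \<tau>) y z)) = 0"
        if yz: "y \<in> H (r - \<epsilon>)" "z \<in> H (1 - \<tau>)" for y z
      proof
        show "m (r - \<epsilon>) (1 - \<tau>) y z \<in> H b" using yz \<tau> \<epsilon> by (intro m_in') (auto simp: b_def)
        have "m \<epsilon> b (v \<epsilon>) (m (r - \<epsilon>) (1 - \<tau>) y z) = m r (1 - \<tau>) (m \<epsilon> (r - \<epsilon>) (v \<epsilon>) y) z"
          using V yz \<tau> \<epsilon> by (intro m_assoc'[symmetric]) (auto simp: b_def)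
        moreover have "m \<epsilon> (r - \<epsilon>) (v \<epsilon>) y \<in> H r" using V yz \<epsilon> by (intro m_in') auto
        moreover have "cinner x (m \<epsilon> (r - \<epsilon>) (v \<epsilon>) y) = 0"
          using orth[OF \<epsilon>(1,3) yz(1)] cinner_eq_0_commute by blast
        ultimately show "cinner (X \<tau>) (m \<epsilon> b (v \<epsilon>) (m (r - \<epsilon>) (1 - \<tau>) y z)) = 0"
          unfolding X_def using x r V \<tau> yz by (simp add: cinner_m)
      qed
      then show "{m (r - \<epsilon>) (1 - \<tau>) y z |y z. y \<in> H (r - \<epsilon>) \<and> z \<in> H (1 - \<tau>)}
          \<subseteq> {q \<in> H b. m \<epsilon> b (v \<epsilon>) q \<in> {w. cinner (X \<tau>) w = 0}}" by auto
    qed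
    finally have "cinner (X \<tau>) (m \<epsilon> b (v \<epsilon>) q) = 0" using q by blast
    then show ?thesis
      unfolding Y\<sigma> unfolding Y_def using V X[of \<tau>] vq \<tau> r by (simp add: cinner_m)
  qed
  obtain D where D: "countable D" "H (r + 1) \<subseteq> closure D"
    using sep r unfolding separable_fibres_def by (metis add_pos_pos zero_less_one)
  have "countable {0<..<1::real}"
  proof (rule countable_if_separated[OF D(1)])
    show "Y ` {0<..<1} \<subseteq> closure D" using Y(1) D(2) by auto
    show "norm x > 0" using x0 by simp
    fix s t :: real assume st: "s \<in> {0<..<1}" "t \<in> {0<..<1}" "s < t"
    have "(dist (Y s) (Y t))\<^sup>2 = (norm x)\<^sup>2 + (norm x)\<^sup>2"
      unfolding dist_norm norm_diff_square using orth' Y(2) st by simp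
    then have "(norm x)\<^sup>2 \<le> (dist (Y s) (Y t))\<^sup>2" by simp
    then show "norm x \<le> dist (Y s) (Y t)" using power2_le_imp_le zero_le_dist by blast
  qed
  then show False using uncountable_open_interval[of 0 "1::real"] by simp
qed

text \<open>Since \<open>v \<epsilon>\<close> begins with \<open>v \<epsilon>'\<close>, the
  subspaces \<open>v \<epsilon>\<close> \<cdot> \<open>H (r - \<epsilon>)\<close> grow as \<epsilon>
  decreases. Their union is therefore closed under addition, and an approximation found for one
  \<epsilon> is available for all smaller ones.\<close>

lemma section_times_mono:
  assumes v: "msection v" and \<epsilon>: "0 < \<epsilon>'" "\<epsilon>' \<le> \<epsilon>" "\<epsilon> < r" and y: "y \<in> H (r - \<epsilon>)"
  shows "\<exists>y'\<in>H (r - \<epsilon>'). m \<epsilon> (r - \<epsilon>) (v \<epsilon>) y = m \<epsilon>' (r - \<epsilon>') (v \<epsilon>') y'"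
proof (cases "\<epsilon>' = \<epsilon>")
  case False
  then have d: "\<epsilon> - \<epsilon>' > 0" using \<epsilon> by simp
  note V = msectionD[OF v]
  have "m \<epsilon> (r - \<epsilon>) (v \<epsilon>) y = m \<epsilon> (r - \<epsilon>) (m \<epsilon>' (\<epsilon> - \<epsilon>') (v \<epsilon>') (v (\<epsilon> - \<epsilon>'))) y"
    using V(4)[of \<epsilon>' "\<epsilon> - \<epsilon>'" \<epsilon>] d \<epsilon> by simp
  also have "\<dots> = m \<epsilon>' (r - \<epsilon>') (v \<epsilon>') (m (\<epsilon> - \<epsilon>') (r - \<epsilon>) (v (\<epsilon> - \<epsilon>')) y)"
    using V d \<epsilon> y by (intro m_assoc') auto
  finally have eq: "m \<epsilon> (r - \<epsilon>) (v \<epsilon>) y = m \<epsilon>' (r - \<epsilon>') (v \<epsilon>') (m (\<epsilon> - \<epsilon>') (r - \<epsilon>) (v (\<epsilon> - \<epsilon>')) y)" .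
  have "m (\<epsilon> - \<epsilon>') (r - \<epsilon>) (v (\<epsilon> - \<epsilon>')) y \<in> H (r - \<epsilon>')"
    using V d \<epsilon> y by (intro m_in') auto
  with eq show ?thesis by blast
qed (use y in blast)

text \<open>By \<open>orthogonal_to_sections_0\<close> the increasing union U of the subspaces
  \<open>v \<epsilon>\<close> \<cdot> \<open>H (r - \<epsilon>)\<close> has trivial complement in
  \<open>H r\<close>, so it is dense; monotonicity makes one approximant good for every small
  \<epsilon>.\<close>

lemma section_right_continuous:
  assumes sep: separable_fibres and v: "msection v" and r: "r > 0" and x: "x \<in> H r" and \<delta>: "\<delta> > 0"
  shows "\<exists>\<epsilon>0. 0 < \<epsilon>0 \<and> \<epsilon>0 < r \<and>
    (\<forall>\<epsilon>. 0 < \<epsilon> \<and> \<epsilon> \<le> \<epsilon>0 \<longrightarrow> (\<exists>y\<in>H (r - \<epsilon>). norm (x - m \<epsilon> (r - \<epsilon>) (v \<epsilon>) y) < \<delta>))"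
proof -
  note V = msectionD[OF v]
  define U where "U = {m \<epsilon> (r - \<epsilon>) (v \<epsilon>) y | \<epsilon> y. 0 < \<epsilon> \<and> \<epsilon> < r \<and> y \<in> H (r - \<epsilon>)}"
  have UI: "m \<epsilon> (r - \<epsilon>) (v \<epsilon>) y \<in> U" if "0 < \<epsilon>" "\<epsilon> < r" "y \<in> H (r - \<epsilon>)" for \<epsilon> y
    using that by (auto simp: U_def)
  have "closed_csubspace (closure U)"
  proof (rule closed_csubspace_closure)
    have "m (r/2) (r - r/2) (v (r/2)) 0 = 0"
      using clinear_on_0[OF m_clinear_right closed_csubspaceD(2)[OF fibre_closed]] r V by simp
    then show "0 \<in> U" using UI[of "r/2" 0] r closed_csubspaceD(2)[OF fibre_closed, of "r - r/2"] by simp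
    fix p assume "p \<in> U"
    then obtain \<epsilon> y where p: "p = m \<epsilon> (r - \<epsilon>) (v \<epsilon>) y" "0 < \<epsilon>" "\<epsilon> < r" "y \<in> H (r - \<epsilon>)"
      by (auto simp: U_def)
    show "c *\<^sub>C p \<in> U" for c
      using UI[OF p(2,3), of "c *\<^sub>C y"] m_scaleC_right[of \<epsilon> "r - \<epsilon>" "v \<epsilon>" y c] p V
        closed_csubspaceD(4)[OF fibre_closed] by simp
    fix q assume "q \<in> U"
    then obtain \<epsilon>' y' where q: "q = m \<epsilon>' (r - \<epsilon>') (v \<epsilon>') y'" "0 < \<epsilon>'" "\<epsilon>' < r" "y' \<in> H (r - \<epsilon>')"
      by (auto simp: U_def)
    define \<eta> where "\<eta> = min \<epsilon> \<epsilon>'"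
    have \<eta>: "0 < \<eta>" "\<eta> \<le> \<epsilon>" "\<eta> \<le> \<epsilon>'" "\<eta> < r" using p q by (auto simp: \<eta>_def)
    obtain y1 where y1: "y1 \<in> H (r - \<eta>)" "p = m \<eta> (r - \<eta>) (v \<eta>) y1"
      using section_times_mono[OF v \<eta>(1,2) p(3,4)] p(1) by auto
    obtain y2 where y2: "y2 \<in> H (r - \<eta>)" "q = m \<eta> (r - \<eta>) (v \<eta>) y2"
      using section_times_mono[OF v \<eta>(1,3) q(3,4)] q(1) by auto
    have "p + q = m \<eta> (r - \<eta>) (v \<eta>) (y1 + y2)" using m_add_right[of \<eta> "r - \<eta>"] V \<eta> y1 y2 by simp
    then show "p + q \<in> U"
      using UI[OF \<eta>(1,4)] closed_csubspaceD(3)[OF fibre_closed y1(1) y2(1)] \<eta> by simp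
  qed
  then have "closed_cspan U \<subseteq> closure U" by (rule closed_cspan_minimal[OF _ closure_subset])
  moreover have "closed_cspan U = H r"
  proof (rule closed_cspan_eq_if_total[OF fibre_closed[OF r]])
    show "U \<subseteq> H r" using V r by (auto simp: U_def intro!: m_in')
    show "y = 0" if "y \<in> H r" "\<And>x. x \<in> U \<Longrightarrow> cinner x y = 0" for y
      using orthogonal_to_sections_0[OF sep v r that(1)] that(2) UI by blast
  qed
  ultimately obtain p where "p \<in> U" "dist p x < \<delta>"
    using x \<delta> closure_approachable by blast
  then obtain \<epsilon>0 y0 where p: "dist (m \<epsilon>0 (r - \<epsilon>0) (v \<epsilon>0) y0) x < \<delta>" "0 < \<epsilon>0" "\<epsilon>0 < r" "y0 \<in> H (r - \<epsilon>0)"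
    by (auto simp: U_def)
  have "\<exists>y\<in>H (r - \<epsilon>). norm (x - m \<epsilon> (r - \<epsilon>) (v \<epsilon>) y) < \<delta>" if "0 < \<epsilon>" "\<epsilon> \<le> \<epsilon>0" for \<epsilon>
    using section_times_mono[OF v that p(3,4)] p(1) by (metis dist_norm dist_commute)
  with p show ?thesis by blast
qed

text \<open>Were \<open>v \<epsilon>\<close> orthogonal to \<open>w \<epsilon>\<close>, then
  \<open>w 1\<close> would be orthogonal to every vector beginning with \<open>v \<epsilon>\<close>
  and hence at distance at least 1 from it, contradicting density. One nonzero overlap suffices
  because the squared overlap is multiplicative in time.\<close>

lemma sections_overlap_bound:
  assumes sep: separable_fibres and v: "msection v" and w: "msection w"
  obtains c where "c \<ge> 0" "\<And>s. s > 0 \<Longrightarrow> 1 - (cmod (cinner (v s) (w s)))\<^sup>2 \<le> c * s"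
proof -
  note V = msectionD[OF v] and W = msectionD[OF w]
  obtain \<epsilon> where \<epsilon>: "0 < \<epsilon>" "\<epsilon> < 1" "\<exists>y\<in>H (1 - \<epsilon>). norm (w 1 - m \<epsilon> (1 - \<epsilon>) (v \<epsilon>) y) < 1"
    using section_right_continuous[OF sep v zero_less_one W(1)[OF zero_less_one] zero_less_one] by auto
  then obtain y where y: "y \<in> H (1 - \<epsilon>)" "norm (w 1 - m \<epsilon> (1 - \<epsilon>) (v \<epsilon>) y) < 1" by blast
  have "cinner (v \<epsilon>) (w \<epsilon>) \<noteq> 0"
  proof
    assume "cinner (v \<epsilon>) (w \<epsilon>) = 0"
    then have "cinner (w \<epsilon>) (v \<epsilon>) = 0" using cinner_eq_0_commute by blast
    then have "cinner (m \<epsilon> (1 - \<epsilon>) (w \<epsilon>) (w (1 - \<epsilon>))) (m \<epsilon> (1 - \<epsilon>) (v \<epsilon>) y) = 0"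
      using V(1) W(1) y \<epsilon> by (simp add: cinner_m)
    moreover have "w 1 = m \<epsilon> (1 - \<epsilon>) (w \<epsilon>) (w (1 - \<epsilon>))" using \<epsilon> by (intro W(4)) auto
    ultimately have "cinner (w 1) (m \<epsilon> (1 - \<epsilon>) (v \<epsilon>) y) = 0" by simp
    then have "(norm (w 1 - m \<epsilon> (1 - \<epsilon>) (v \<epsilon>) y))\<^sup>2 \<ge> 1"
      using W(2)[of 1] by (simp add: norm_diff_square)
    moreover have "(norm (w 1 - m \<epsilon> (1 - \<epsilon>) (v \<epsilon>) y))\<^sup>2 < 1\<^sup>2"
      using y(2) by (intro power_strict_mono) auto
    ultimately show False by simp
  qed
  then have pos: "(cmod (cinner (v \<epsilon>) (w \<epsilon>)))\<^sup>2 > 0" by simp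
  show thesis
  proof (rule multiplicative_linear_bound[of "\<lambda>s. (cmod (cinner (v s) (w s)))\<^sup>2" \<epsilon>])
    fix s :: real assume s: "s > 0"
    have "cmod (cinner (v s) (w s)) \<le> 1"
      using complex_Cauchy_Schwarz[of "v s" "w s"] V(2)[OF s] W(2)[OF s] by simp
    then show "0 \<le> (cmod (cinner (v s) (w s)))\<^sup>2 \<and> (cmod (cinner (v s) (w s)))\<^sup>2 \<le> 1"
      by (simp add: power_le_one)
    fix t :: real assume t: "t > 0"
    have "cinner (v (s + t)) (w (s + t)) = cinner (v s) (w s) * cinner (v t) (w t)"
      using V(4)[OF s t refl] W(4)[OF s t refl] V(1) W(1) s t by (simp add: cinner_m)
    then show "(cmod (cinner (v (s + t)) (w (s + t))))\<^sup>2 = (cmod (cinner (v s) (w s)))\<^sup>2 * (cmod (cinner (v t) (w t)))\<^sup>2"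
      by (simp add: norm_mult power_mult_distrib)
  qed (use \<epsilon> pos that in auto)
qed

end

section \<open>Tensor pairings\<close>

text \<open>Lets a convergence statement about approximation by varying subspaces be checked on
  elementary products only.\<close>

lemma closed_csubspace_approximable:
  fixes U :: "'i \<Rightarrow> 'a::complex_inner set"
  assumes U: "\<And>h. closed_csubspace (U h)"
  shows "closed_csubspace {x. \<forall>\<delta>>0. \<forall>\<^sub>F h in F. \<exists>q\<in>U h. norm (x - q) < \<delta>}"
    (is "closed_csubspace {x. \<forall>\<delta>>0. ?P \<delta> x}")
proof (rule closed_csubspaceI)
  note D = closed_csubspaceD[OF U]
  show "closed {x. \<forall>\<delta>>0. ?P \<delta> x}"
    unfolding closed_sequential_limits
  proof (intro allI impI CollectI, elim conjE)
    fix X l and \<delta> :: real assume X: "\<forall>n. X n \<in> {x. \<forall>\<delta>>0. ?P \<delta> x}" "X \<longlonglongrightarrow> l" and \<delta>: "\<delta> > 0"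
    then obtain n where n: "dist (X n) l < \<delta> / 2" unfolding LIMSEQ_def by (meson half_gt_zero order_refl)
    have "X n \<in> {x. \<forall>\<delta>>0. ?P \<delta> x}" using X(1) by (rule spec)
    then have "?P (\<delta> / 2) (X n)" using half_gt_zero[OF \<delta>] by (elim CollectE allE impE)
    then show "?P \<delta> l"
    proof (rule eventually_mono)
      fix h assume "\<exists>q\<in>U h. norm (X n - q) < \<delta> / 2"
      then obtain q where q: "q \<in> U h" "norm (X n - q) < \<delta> / 2" by blast
      have "norm (l - q) \<le> dist (X n) l + norm (X n - q)"
        using norm_triangle_ineq[of "l - X n" "X n - q"] by (simp add: dist_norm norm_minus_commute)
      then have "norm (l - q) < \<delta>" using n q(2) by linarith
      with q(1) show "\<exists>q\<in>U h. norm (l - q) < \<delta>" by blast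
    qed
  qed
  show "0 \<in> {x. \<forall>\<delta>>0. ?P \<delta> x}"
    using D(2) by (auto intro!: always_eventually bexI[of _ 0])
  show "x + y \<in> {x. \<forall>\<delta>>0. ?P \<delta> x}" if xy: "x \<in> {x. \<forall>\<delta>>0. ?P \<delta> x}" "y \<in> {x. \<forall>\<delta>>0. ?P \<delta> x}" for x y
  proof (intro allI impI CollectI)
    fix \<delta> :: real assume \<delta>: "\<delta> > 0"
    have "?P (\<delta> / 2) x" "?P (\<delta> / 2) y"
      using xy[THEN CollectD, THEN spec, THEN mp, OF half_gt_zero[OF \<delta>]] .
    then show "?P \<delta> (x + y)"
    proof (rule eventually_elim2)
      fix h assume "\<exists>q\<in>U h. norm (x - q) < \<delta> / 2" "\<exists>q\<in>U h. norm (y - q) < \<delta> / 2"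
      then obtain q q' where q: "q \<in> U h" "norm (x - q) < \<delta> / 2" "q' \<in> U h" "norm (y - q') < \<delta> / 2" by blast
      have "norm (x + y - (q + q')) \<le> norm (x - q) + norm (y - q')"
        using norm_triangle_ineq[of "x - q" "y - q'"] by (simp add: algebra_simps)
      then have "norm (x + y - (q + q')) < \<delta>" using q by linarith
      then show "\<exists>q\<in>U h. norm (x + y - q) < \<delta>" using D(3)[OF q(1,3)] by blast
    qed
  qed
  show "c *\<^sub>C x \<in> {x. \<forall>\<delta>>0. ?P \<delta> x}" if x: "x \<in> {x. \<forall>\<delta>>0. ?P \<delta> x}" for c x
  proof (intro allI impI CollectI)
    fix \<delta> :: real assume \<delta>: "\<delta> > 0"
    have p: "cmod c + 1 > 0" using norm_ge_zero[of c] by linarith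
    then have "?P (\<delta> / (cmod c + 1)) x"
      using x divide_pos_pos[OF \<delta> p] by (elim CollectE allE impE)
    then show "?P \<delta> (c *\<^sub>C x)"
    proof (rule eventually_mono)
      fix h assume "\<exists>q\<in>U h. norm (x - q) < \<delta> / (cmod c + 1)"
      then obtain q where q: "q \<in> U h" "norm (x - q) < \<delta> / (cmod c + 1)" by blast
      have "norm (c *\<^sub>C x - c *\<^sub>C q) = cmod c * norm (x - q)"
        by (simp flip: norm_scaleC scaleC_diff_right)
      also have "\<dots> \<le> (cmod c + 1) * norm (x - q)" by (simp add: mult_right_mono)
      also have "\<dots> < \<delta>" using q(2) p by (simp add: field_simps)
      finally show "\<exists>q\<in>U h. norm (c *\<^sub>C x - q) < \<delta>" using D(4)[OF q(1)] by blast
    qed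
  qed
qed

text \<open>The pairing is left abstract so that it can be read in the order F, E on the same space
  H (\<open>flip\<close>) and with time reversed (\<open>opposite\<close>); each one-sided result
  then yields its mirror images.\<close>

locale tensor_pairing =
  E: mult_system E mE + F: mult_system F mF + H: mult_system H mH
  for E :: "real \<Rightarrow> 'a::chilbert set" and mE and F :: "real \<Rightarrow> 'b::chilbert set" and mF
    and H :: "real \<Rightarrow> 'h::chilbert set" and mH +
  fixes tp :: "'a \<Rightarrow> 'b \<Rightarrow> 'h"
  assumes cinner_tp: "cinner (tp x y) (tp x' y') = cinner x x' * cinner y y'"
    and tp_total: "t > 0 \<Longrightarrow> closed_cspan {tp x y | x y. x \<in> E t \<and> y \<in> F t} = H t"
    and mH_tp: "\<lbrakk>s > 0; t > 0; x \<in> E s; x' \<in> E t; y \<in> F s; y' \<in> F t\<rbrakk> \<Longrightarrow>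
      mH s t (tp x y) (tp x' y') = tp (mE s t x x') (mF s t y y')"
begin

lemma flip: "tensor_pairing F mF E mE H mH (\<lambda>y x. tp x y)"
proof
  fix t :: real assume t: "t > 0"
  have "{tp x y | y x. y \<in> F t \<and> x \<in> E t} = {tp x y | x y. x \<in> E t \<and> y \<in> F t}" by blast
  then show "closed_cspan {tp x y | y x. y \<in> F t \<and> x \<in> E t} = H t" using tp_total[OF t] by simp
qed (simp_all add: cinner_tp mH_tp mult.commute)

lemma opposite: "tensor_pairing E (\<lambda>s t x y. mE t s y x) F (\<lambda>s t x y. mF t s y x) H (\<lambda>s t x y. mH t s y x) tp"
  by (intro tensor_pairing.intro E.opposite F.opposite H.opposite tensor_pairing_axioms.intro
      cinner_tp tp_total mH_tp)

lemma tp_bounded_op_left: "bounded_op UNIV UNIV (\<lambda>x. tp x y)"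
  by (rule similarity_bounded_op[where k = "cinner y y"]) (auto simp: closed_csubspace_UNIV cinner_tp)

lemma tp_bounded_op_right: "bounded_op UNIV UNIV (tp x)"
  by (rule similarity_bounded_op[where k = "cinner x x"]) (auto simp: closed_csubspace_UNIV cinner_tp)

lemma tp_diff_left: "tp (x - x') y = tp x y - tp x' y"
  using clinear_on_diff[OF closed_csubspace_UNIV, of "\<lambda>x. tp x y"] tp_bounded_op_left
  by (simp add: bounded_op_def)

lemma tp_diff_right: "tp x (y - y') = tp x y - tp x y'"
  using clinear_on_diff[OF closed_csubspace_UNIV, of "tp x"] tp_bounded_op_right
  by (simp add: bounded_op_def)

lemma norm_tp: "norm (tp x y) = norm x * norm y"
proof -
  have "complex_of_real ((norm (tp x y))\<^sup>2) = complex_of_real ((norm x)\<^sup>2 * (norm y)\<^sup>2)"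
    unfolding of_real_mult cinner_self[symmetric] by (rule cinner_tp)
  then have "(norm (tp x y))\<^sup>2 = (norm x * norm y)\<^sup>2"
    by (simp only: of_real_eq_iff power_mult_distrib)
  then show ?thesis by simp
qed

lemma tp_in: "t > 0 \<Longrightarrow> x \<in> E t \<Longrightarrow> y \<in> F t \<Longrightarrow> tp x y \<in> H t"
  by (subst tp_total[symmetric]) (auto intro!: closed_cspan_base)

text \<open>Joins two time slots. The F leg is one fixed product vector, so only the E leg has to be
  extended linearly from products a \<cdot> b, where \<open>mH_tp\<close> separates the
  slots.\<close>

lemma tp_sprod:
  assumes st: "s > 0" "t > 0" and AB: "A \<subseteq> E s" "B \<subseteq> E t" and y: "y \<in> F s" "y' \<in> F t"
    and P: "\<And>x. x \<in> A \<Longrightarrow> tp x y \<in> P" and Q: "\<And>x. x \<in> B \<Longrightarrow> tp x y' \<in> Q"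
    and x: "x \<in> E.sprod s t A B"
  shows "tp x (mF s t y y') \<in> H.sprod s t P Q"
proof -
  have "E.sprod s t A B \<subseteq> {x \<in> UNIV. tp x (mF s t y y') \<in> H.sprod s t P Q}"
  proof (rule E.sprod_minimal)
    show "closed_csubspace {x \<in> UNIV. tp x (mF s t y y') \<in> H.sprod s t P Q}"
      by (rule closed_csubspace_preimage[OF closed_csubspace_UNIV tp_bounded_op_left H.closed_csubspace_sprod])
    fix a b assume ab: "a \<in> A" "b \<in> B"
    have "mH s t (tp a y) (tp b y') \<in> H.sprod s t P Q" by (rule H.sprod_base[OF P[OF ab(1)] Q[OF ab(2)]])
    moreover have "mH s t (tp a y) (tp b y') = tp (mE s t a b) (mF s t y y')"
      using ab AB y st by (intro mH_tp) auto
    ultimately show "mE s t a b \<in> {x \<in> UNIV. tp x (mF s t y y') \<in> H.sprod s t P Q}" by simp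
  qed
  with x show ?thesis by blast
qed

text \<open>The competitor in N keeps y on the projection of x to U and substitutes y' on the
  remainder. Its difference from \<open>tp x y\<close> is the single tensor of that remainder with y
  - y', so the norm factorises.\<close>

lemma norm_diff_hproj_tp_le:
  assumes N: "closed_csubspace N" and U: "closed_csubspace U" "U \<subseteq> E L" and x: "x \<in> E L" and L: "L > 0"
    and 1: "\<And>x. x \<in> U \<Longrightarrow> tp x y \<in> N" and 2: "\<And>x. x \<in> E L \<Longrightarrow> tp x y' \<in> N"
  shows "(norm (tp x y - hproj N (tp x y)))\<^sup>2 \<le> (norm (y - y'))\<^sup>2 * (norm (x - hproj U x))\<^sup>2"
proof -
  let ?p = "hproj U x"
  have p: "?p \<in> U" by (rule hproj(1)[OF U(1)])
  have "x - ?p \<in> E L" using p U(2) x L by (intro closed_csubspaceD[OF E.fibre_closed]) auto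
  then have "tp ?p y + tp (x - ?p) y' \<in> N" by (intro closed_csubspaceD(3)[OF N] 1 2 p)
  from norm_diff_hproj_le[OF N this, of "tp x y"]
  have "(norm (tp x y - hproj N (tp x y)))\<^sup>2 \<le> (norm (tp x y - (tp ?p y + tp (x - ?p) y')))\<^sup>2" .
  also have "tp x y - (tp ?p y + tp (x - ?p) y') = tp (x - ?p) (y - y')"
    by (simp add: tp_diff_left tp_diff_right)
  finally show ?thesis by (simp add: norm_tp power_mult_distrib mult.commute)
qed

definition right_factor :: "(real \<Rightarrow> 'h set) \<Rightarrow> real \<Rightarrow> 'b set" where
  "right_factor S t = {y \<in> F t. \<forall>x\<in>E t. tp x y \<in> S t}"

text \<open>The vector \<open>y'\<close> is the slice of \<open>y\<close> along the unit vector \<open>b'\<close>.\<close>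

lemma right_factor_orthogonal:
  assumes S: "H.msub S" and st: "s > 0" "t > 0" and e: "e \<in> E t" "norm e = 1"
    and y: "y \<in> right_factor S (s + t)"
    and a: "a \<in> F s" "a \<in> ocomp (right_factor S s)" and b: "b \<in> F t"
  shows "cinner (mF s t a b) y = 0"
proof (cases "b = 0")
  case True
  then have "mF s t a b = 0"
    using clinear_on_0[OF F.m_clinear_right[OF st a(1)] closed_csubspaceD(2)[OF F.fibre_closed[OF st(2)]]] by simp
  then show ?thesis by simp
next
  case False
  define b' where "b' = complex_of_real (1 / norm b) *\<^sub>C b"
  have b': "b' \<in> F t" "norm b' = 1" "b = complex_of_real (norm b) *\<^sub>C b'"
    using b False st closed_csubspaceD(4)[OF F.fibre_closed]
    by (auto simp: b'_def norm_scaleC norm_divide scaleC_scaleC simp flip: of_real_mult)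
  have b'1: "cinner b' b' = 1" and e1: "cinner e e = 1" using b' e by (simp_all add: cinner_self)
  have "isometry_on (F s) (\<lambda>k. mF s t k b')"
    unfolding isometry_on_def using st b' b'1 by (simp add: F.cinner_m)
  from isometry_adjoint[OF F.fibre_closed[OF st(1)] this, of y]
  obtain y' where y': "y' \<in> F s" "\<And>k. k \<in> F s \<Longrightarrow> cinner (mF s t k b') y = cinner k y'" by blast
  have yF: "y \<in> F (s + t)" using y by (simp add: right_factor_def)
  have "y' \<in> right_factor S s"
    unfolding right_factor_def
  proof (intro CollectI conjI ballI y')
    fix x assume x: "x \<in> E s"
    \<comment> \<open>The unit vector e fills the E leg over the second slot. Slicing
      \<open>tp (mE s t x e) y\<close> along \<open>tp e b'\<close> returns \<open>tp x y'\<close>,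
      and a vector orthogonal to \<open>S s\<close> annihilates every slice of an element of S s
      \<cdot> S t.\<close>
    have xe: "mE s t x e \<in> E (s + t)" using x e st by (intro E.m_in)
    then have zS: "tp (mE s t x e) y \<in> H.sprod s t (S s) (S t)"
      using y H.msubD(3)[OF S st] by (simp add: right_factor_def)
    have eb: "tp e b' \<in> H t" using e b' st by (intro tp_in)
    show "tp x y' \<in> S s"
    proof (rule mem_csubspace_if_orthogonal[OF H.msubD(1,2)[OF S st(1)]
          H.fibre_closed[OF st(1)] tp_in[OF st(1) x y'(1)], rotated])
      fix q assume q: "q \<in> H s" "q \<in> ocomp (S s)"
      have "H s \<subseteq> {q \<in> H s. cinner (mH s t q (tp e b')) (tp (mE s t x e) y) = cinner q (tp x y')}"
      proof (subst tp_total[OF st(1), symmetric], rule closed_cspan_minimal)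
        show "closed_csubspace {q \<in> H s. cinner (mH s t q (tp e b')) (tp (mE s t x e) y) = cinner q (tp x y')}"
          by (rule closed_csubspace_cinner_eq[OF H.fibre_closed[OF st(1)] H.m_bounded_op_left[OF st eb]])
        show "{tp p q |p q. p \<in> E s \<and> q \<in> F s}
          \<subseteq> {q \<in> H s. cinner (mH s t q (tp e b')) (tp (mE s t x e) y) = cinner q (tp x y')}"
          using st x e b' e1 y'(2) by (auto simp: tp_in mH_tp cinner_tp E.cinner_m)
      qed
      then have "cinner q (tp x y') = cinner (mH s t q (tp e b')) (tp (mE s t x e) y)" using q by auto
      also have "\<dots> = 0"
        by (rule H.sprod_orthogonal_left[OF st H.msubD(2)[OF S st(1)] H.msubD(2)[OF S st(2)] q eb zS])
      finally show "cinner q (tp x y') = 0" .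
    qed
  qed
  then have "cinner a y' = 0" using a(2) cinner_eq_0_commute[of a y'] by (auto simp: ocomp_def)
  then have "cinner (mF s t a b') y = 0" using y'(2)[OF a(1)] by simp
  then show ?thesis
    using F.m_scaleC_right[OF st a(1) b'(1), of "complex_of_real (norm b)"] b'(3)
    by (simp add: cinner_scaleC_left)
qed

text \<open>Stability under products is \<open>tp_sprod\<close> with both slots in S. Splitting
  follows from \<open>mem_sprodI\<close>, whose two conditions are
  \<open>right_factor_orthogonal\<close> and its time reversal; u provides the unit vector e at each
  time.\<close>

lemma msub_right_factor:
  assumes S: "H.msub S" and u: "E.msection u"
  shows "F.msub (right_factor S)"
  unfolding F.msub_def
proof (intro conjI allI impI)
  note U = E.msectionD[OF u]
  have cl: "closed_csubspace (right_factor S t)" and sub: "right_factor S t \<subseteq> F t" if t: "t > 0" for t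
  proof -
    have "right_factor S t = F t \<inter> \<Inter> ((\<lambda>x. {y \<in> UNIV. tp x y \<in> S t}) ` E t)"
      by (auto simp: right_factor_def)
    then show "closed_csubspace (right_factor S t)"
      using closed_csubspace_preimage[OF closed_csubspace_UNIV tp_bounded_op_right H.msubD(1)[OF S t]]
      by (auto intro!: closed_csubspace_Int F.fibre_closed[OF t] closed_csubspace_Inter)
    show "right_factor S t \<subseteq> F t" by (auto simp: right_factor_def)
  qed
  show "\<And>t. t > 0 \<Longrightarrow> closed_csubspace (right_factor S t)" "\<And>t. t > 0 \<Longrightarrow> right_factor S t \<subseteq> F t"
    by (rule cl, assumption) (rule sub, assumption)
  fix s t :: real assume st: "s > 0" "t > 0"
  show "F.sprod s t (right_factor S s) (right_factor S t) = right_factor S (s + t)"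
  proof
    show "F.sprod s t (right_factor S s) (right_factor S t) \<subseteq> right_factor S (s + t)"
    proof (rule F.sprod_minimal[OF cl])
      fix y y' assume y: "y \<in> right_factor S s" "y' \<in> right_factor S t"
      then have yF: "y \<in> F s" "y' \<in> F t" by (auto simp: right_factor_def)
      have "tp x (mF s t y y') \<in> S (s + t)" if "x \<in> E (s + t)" for x
      proof -
        have "tp x (mF s t y y') \<in> H.sprod s t (S s) (S t)"
        proof (rule tp_sprod[OF st subset_refl subset_refl yF])
          show "x \<in> E.sprod s t (E s) (E t)" using that E.sprod_fibre[OF st] by simp
        qed (use y in \<open>auto simp: right_factor_def\<close>)
        then show ?thesis using H.msubD(3)[OF S st] by simp
      qed
      then show "mF s t y y' \<in> right_factor S (s + t)"
        using F.m_in[OF st yF] by (simp add: right_factor_def)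
    qed (use st in simp)
    show "right_factor S (s + t) \<subseteq> F.sprod s t (right_factor S s) (right_factor S t)"
    proof
      fix y assume y: "y \<in> right_factor S (s + t)"
      show "y \<in> F.sprod s t (right_factor S s) (right_factor S t)"
      proof (rule F.mem_sprodI[OF st cl[OF st(1)] sub[OF st(1)] cl[OF st(2)] sub[OF st(2)]])
        show "y \<in> F (s + t)" using y by (simp add: right_factor_def)
        fix a b assume ab: "a \<in> F s" "b \<in> F t"
        show "cinner (mF s t a b) y = 0" if "a \<in> ocomp (right_factor S s)"
          using right_factor_orthogonal[OF S st U(1)[OF st(2)] U(2)[OF st(2)] y ab(1) that ab(2)] .
        interpret op: tensor_pairing E "\<lambda>s t x y. mE t s y x" F "\<lambda>s t x y. mF t s y x" H "\<lambda>s t x y. mH t s y x" tp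
          by (rule opposite)
        show "cinner (mF s t a b) y = 0" if "b \<in> ocomp (right_factor S t)"
          using op.right_factor_orthogonal[OF _ st(2,1) U(1)[OF st(1)] U(2)[OF st(1)], of S y b a] ab that y S
          by (simp add: H.msub_opposite add.commute)
      qed
    qed
  qed
qed

end

section \<open>Distance of a tensored section from a product subsystem\<close>

lemma norm_diff_unit_projection:
  fixes v w :: "'a::complex_inner"
  assumes "norm v = 1" "norm w = 1"
  shows "(norm (w - cinner v w *\<^sub>C v))\<^sup>2 = 1 - (cmod (cinner v w))\<^sup>2"
proof -
  have "cinner w (cinner v w *\<^sub>C v) = complex_of_real ((cmod (cinner v w))\<^sup>2)"
    unfolding complex_norm_square cinner_scaleC_right cinner_commute[of w v] by simp
  then show ?thesis using assms by (simp add: norm_diff_square norm_scaleC)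
qed

context tensor_pairing
begin

context
  fixes S :: "real \<Rightarrow> 'h set" and u :: "real \<Rightarrow> 'a" and v w :: "real \<Rightarrow> 'b" and L :: real
  assumes sepE: E.separable_fibres and sepF: F.separable_fibres
    and S: "H.msub S" and u: "E.msection u" and v: "F.msection v" and w: "F.msection w"
    and Sv: "\<And>t x. t > 0 \<Longrightarrow> x \<in> E t \<Longrightarrow> tp x (v t) \<in> S t"
    and Su: "\<And>t y. t > 0 \<Longrightarrow> y \<in> F t \<Longrightarrow> tp (u t) y \<in> S t"
    and L: "L > 0"
begin

definition gap :: "'a \<Rightarrow> real \<Rightarrow> real" where
  "gap x a = (let N = H.sprod a (L - a) (S a) (H (L - a)) in (norm (tp x (w L) - hproj N (tp x (w L))))\<^sup>2)"

definition overlap :: "real \<Rightarrow> real" where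
  "overlap s = (cmod (cinner (v s) (w s)))\<^sup>2"

text \<open>The vectors of \<open>E L\<close> that carry \<open>u h\<close> in the slot from a to a
  + h and are arbitrary elsewhere. The projection onto them is the p of the overview acting in that
  slot only.\<close>

definition core :: "real \<Rightarrow> real \<Rightarrow> 'a set" where
  "core a h = E.sprod a (L - a) (E a) (E.sprod h (L - a - h) {u h} (E (L - a - h)))"

private lemma V: "t > 0 \<Longrightarrow> v t \<in> F t" "t > 0 \<Longrightarrow> norm (v t) = 1"
  "\<lbrakk>s > 0; t > 0; s + t = r\<rbrakk> \<Longrightarrow> v r = mF s t (v s) (v t)"
  using F.msectionD[OF v] by blast+

private lemma W: "t > 0 \<Longrightarrow> w t \<in> F t" "t > 0 \<Longrightarrow> norm (w t) = 1"
  "\<lbrakk>s > 0; t > 0; s + t = r\<rbrakk> \<Longrightarrow> w r = mF s t (w s) (w t)"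
  using F.msectionD[OF w] by blast+

private lemma U: "t > 0 \<Longrightarrow> u t \<in> E t"
  using E.msectionD[OF u] by blast

text \<open>The best approximation of \<open>w s\<close> by a multiple of \<open>v s\<close>. In
  contrast to \<open>w s\<close> it may be tensored with every x at once without leaving S, by
  \<open>Sv\<close>.\<close>

private abbreviation (input) "lv s \<equiv> cinner (v s) (w s) *\<^sub>C v s"

private lemma lv: "t > 0 \<Longrightarrow> lv t \<in> F t" "t > 0 \<Longrightarrow> (norm (w t - lv t))\<^sup>2 = 1 - overlap t"
  "t > 0 \<Longrightarrow> x \<in> E t \<Longrightarrow> tp x (lv t) \<in> S t"
proof -
  show "t > 0 \<Longrightarrow> lv t \<in> F t" by (intro closed_csubspaceD(4)[OF F.fibre_closed] V)
  show "t > 0 \<Longrightarrow> (norm (w t - lv t))\<^sup>2 = 1 - overlap t"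
    unfolding overlap_def by (rule norm_diff_unit_projection) (simp_all add: V W)
  assume t: "t > 0" "x \<in> E t"
  have "tp x (lv t) = cinner (v t) (w t) *\<^sub>C tp x (v t)"
    using tp_bounded_op_right[of x] clinear_on_scaleC[of UNIV "tp x"] by (auto simp: bounded_op_def)
  then show "tp x (lv t) \<in> S t" using closed_csubspaceD(4)[OF H.msubD(1)[OF S t(1)] Sv[OF t]] by simp
qed

text \<open>The case U = {0} of \<open>norm_diff_hproj_tp_le\<close>: the section is replaced for
  all of x. This crude estimate is used just for the first and the last slot.\<close>

private lemma split_estimate:
  assumes ab: "a > 0" "b > 0" "a + b = L" and x: "x \<in> E L" and y: "y \<in> F a" "y' \<in> F b"
    and P: "\<And>x. x \<in> E a \<Longrightarrow> tp x y \<in> P" and Q: "\<And>x. x \<in> E b \<Longrightarrow> tp x y' \<in> Q"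
  shows "(norm (tp x (w L) - hproj (H.sprod a b P Q) (tp x (w L))))\<^sup>2
    \<le> (norm (w L - mF a b y y'))\<^sup>2 * (norm x)\<^sup>2"
proof -
  have "(norm (tp x (w L) - hproj (H.sprod a b P Q) (tp x (w L))))\<^sup>2
      \<le> (norm (w L - mF a b y y'))\<^sup>2 * (norm (x - hproj {0} x))\<^sup>2"
  proof (rule norm_diff_hproj_tp_le[OF H.closed_csubspace_sprod closed_csubspace_0 _ x L])
    show "{0} \<subseteq> E L" using closed_csubspaceD(2)[OF E.fibre_closed[OF L]] by simp
    show "tp x (w L) \<in> H.sprod a b P Q" if "x \<in> {0}" for x
      using that clinear_on_0[of UNIV "\<lambda>x. tp x (w L)"] tp_bounded_op_left[of "w L"]
        closed_csubspaceD(2)[OF H.closed_csubspace_sprod] by (auto simp: bounded_op_def)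
    show "tp x (mF a b y y') \<in> H.sprod a b P Q" if "x \<in> E L" for x
    proof (rule tp_sprod[OF ab(1,2) subset_refl subset_refl y P Q])
      show "x \<in> E.sprod a b (E a) (E b)" using that E.sprod_fibre[OF ab(1,2)] ab(3) by simp
    qed
  qed
  moreover have "hproj {0} x = 0" using hproj(1)[OF closed_csubspace_0, of x] by simp
  ultimately show ?thesis by simp
qed

text \<open>Starting value: in the slot from 0 to a the vector \<open>w a\<close> is replaced by
  \<open>lv a\<close> at the cost of one overlap defect.\<close>

private lemma gap_le_left:
  assumes a: "0 < a" "a < L" and x: "x \<in> E L"
  shows "gap x a \<le> (1 - overlap a) * (norm x)\<^sup>2"
proof -
  define b where "b = L - a"
  have b: "b > 0" "a + b = L" using a by (auto simp: b_def)
  have d: "w a - lv a \<in> F a" using a by (intro closed_csubspaceD(5)[OF F.fibre_closed] W lv) auto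
  have "w L - mF a b (lv a) (w b) = mF a b (w a - lv a) (w b)"
    using W(3)[OF a(1) b] F.m_diff_left[OF a(1) b(1), of "w a" "lv a" "w b"] W lv a b by simp
  moreover have "norm (mF a b (w a - lv a) (w b)) = norm (w a - lv a)"
    using W b a d by (simp add: F.norm_m)
  moreover have "gap x a \<le> (norm (w L - mF a b (lv a) (w b)))\<^sup>2 * (norm x)\<^sup>2"
    unfolding gap_def Let_def b_def[symmetric]
    by (rule split_estimate[OF a(1) b x]) (use lv W tp_in a b in auto)
  ultimately show ?thesis using lv(2)[OF a(1)] by simp
qed

text \<open>The gap makes sense only before L, since the factor \<open>H (L - a)\<close> needs
  positive time. Replacing w by \<open>lv\<close> in the slot from a to L reaches \<open>S L\<close>
  at the cost of one further overlap defect.\<close>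

private lemma gap_full:
  assumes a: "0 < a" "a < L" and x: "x \<in> E L"
  shows "(norm (tp x (w L) - hproj (S L) (tp x (w L))))\<^sup>2 \<le> gap x a + (1 - overlap (L - a)) * (norm x)\<^sup>2"
proof -
  define b where "b = L - a"
  have b: "b > 0" "a + b = L" using a by (auto simp: b_def)
  let ?z = "tp x (w L)"
  have d: "w b - lv b \<in> F b" using b by (intro closed_csubspaceD(5)[OF F.fibre_closed] W lv) auto
  have "w L - mF a b (w a) (lv b) = mF a b (w a) (w b - lv b)"
    using W(3)[OF a(1) b] F.m_diff_right[OF a(1) b(1), of "w a" "w b" "lv b"] W lv a b by simp
  moreover have "norm (mF a b (w a) (w b - lv b)) = norm (w b - lv b)"
    using W b a d by (simp add: F.norm_m)
  moreover have "(norm (?z - hproj (H.sprod a b (H a) (S b)) ?z))\<^sup>2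
      \<le> (norm (w L - mF a b (w a) (lv b)))\<^sup>2 * (norm x)\<^sup>2"
    by (rule split_estimate[OF a(1) b x]) (use lv W tp_in a b in auto)
  moreover have "(norm (?z - hproj (S L) ?z))\<^sup>2 \<le>
      (norm (?z - hproj (H.sprod a b (S a) (H b)) ?z))\<^sup>2 + (norm (?z - hproj (H.sprod a b (H a) (S b)) ?z))\<^sup>2"
    using H.norm_diff_hproj_sprod_le[OF a(1) b(1) H.msubD(1,2)[OF S a(1)] H.msubD(1,2)[OF S b(1)], of ?z]
      H.msubD(3)[OF S a(1) b(1)] b(2) by simp
  ultimately show ?thesis using lv(2)[OF b(1)] by (simp add: gap_def Let_def b_def)
qed

private lemma core_closed: "closed_csubspace (core a h)"
  unfolding core_def by (rule E.closed_csubspace_sprod)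

private lemma gap_step:
  assumes ah: "0 < a" "0 < h" "a + h < L" and x: "x \<in> E L"
  shows "gap x (a + h) \<le> gap x a + (1 - overlap h) * (norm (x - hproj (core a h) x))\<^sup>2"
proof -
  define b c where "b = L - a" and "c = L - a - h"
  have bc: "b > 0" "a + b = L" "c > 0" "h + c = b" using ah by (auto simp: b_def c_def)
  let ?M = "H.sprod h c (S h) (H c)" and ?z = "tp x (w L)"
  let ?N = "H.sprod a b (H a) ?M" and ?y = "mF a b (w a) (mF h c (lv h) (w c))"
  have Sub: "S a \<subseteq> H a" "S h \<subseteq> H h" using H.msubD(2)[OF S] ah by auto
  have M: "closed_csubspace ?M" "?M \<subseteq> H b"
    using H.closed_csubspace_sprod H.sprod_subset[OF ah(2) bc(3) Sub(2) subset_refl] bc(4) by auto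
  \<comment> \<open>Reassociated, the target subspace at time a + h is \<open>S a\<close> followed
    by \<open>?M\<close>. Adding squared distances then separates the old gap from the error made in
    the new slot.\<close>
  have N: "H.sprod a b (S a) ?M = H.sprod (a + h) c (S (a + h)) (H c)"
    using H.sprod_assoc[OF ah(1,2) bc(3) Sub subset_refl] H.msubD(3)[OF S ah(1,2)] bc(4) by simp
  have eL: "E.sprod h c (E h) (E c) = E b" "E.sprod a b (E a) (E b) = E L"
    using E.sprod_fibre[OF ah(2) bc(3)] E.sprod_fibre[OF ah(1) bc(1)] bc by auto
  have uh: "{u h} \<subseteq> E h" using U ah by simp
  have Ub: "E.sprod h c {u h} (E c) \<subseteq> E b"
    using E.sprod_subset[OF ah(2) bc(3) uh subset_refl] bc(4) by simp
  have yb: "mF h c (lv h) (w c) \<in> F b" using lv W ah bc by (intro F.m_in') auto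
  have wb: "w b = mF h c (w h) (w c)" using W(3)[OF ah(2) bc(3,4)] .
  have wL: "w L = mF a b (w a) (mF h c (w h) (w c))" using W(3)[OF ah(1) bc(1,2)] wb by simp
  have "(norm (?z - hproj (H.sprod a b (S a) ?M) ?z))\<^sup>2 \<le>
      (norm (?z - hproj (H.sprod a b (S a) (H b)) ?z))\<^sup>2 + (norm (?z - hproj ?N ?z))\<^sup>2"
    by (rule H.norm_diff_hproj_sprod_le[OF ah(1) bc(1) H.msubD(1,2)[OF S ah(1)] M])
  \<comment> \<open>On \<open>core a h\<close> the section w is kept, because \<open>Su\<close> puts
    the tensor of \<open>u h\<close> and \<open>w h\<close> into \<open>S h\<close>. On the rest
    \<open>w h\<close> becomes \<open>lv h\<close>, which \<open>Sv\<close> admits.\<close>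
  also have "(norm (?z - hproj ?N ?z))\<^sup>2 \<le> (norm (w L - ?y))\<^sup>2 * (norm (x - hproj (core a h) x))\<^sup>2"
  proof (rule norm_diff_hproj_tp_le[OF H.closed_csubspace_sprod core_closed _ x L])
    have "core a h = E.sprod a b (E a) (E.sprod h c {u h} (E c))" by (simp add: core_def b_def c_def)
    then show "core a h \<subseteq> E L" using E.sprod_mono[OF subset_refl Ub, of a b "E a"] eL by simp
    show "tp x (w L) \<in> ?N" if "x \<in> core a h" for x
      unfolding wL
    proof (rule tp_sprod[OF ah(1) bc(1) subset_refl Ub])
      show "tp x (mF h c (w h) (w c)) \<in> ?M" if "x \<in> E.sprod h c {u h} (E c)" for x
        by (rule tp_sprod[OF ah(2) bc(3) uh subset_refl _ _ _ _ that]) (use W Su tp_in ah bc in auto)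
      show "x \<in> E.sprod a b (E a) (E.sprod h c {u h} (E c))" using that by (simp add: core_def b_def c_def)
      show "mF h c (w h) (w c) \<in> F b" using W ah bc by (intro F.m_in') auto
    qed (use W tp_in ah bc in auto)
    show "tp x ?y \<in> ?N" if "x \<in> E L" for x
    proof (rule tp_sprod[OF ah(1) bc(1) subset_refl subset_refl _ yb])
      show "tp x (mF h c (lv h) (w c)) \<in> ?M" if "x \<in> E b" for x
      proof (rule tp_sprod[OF ah(2) bc(3) subset_refl subset_refl])
        show "x \<in> E.sprod h c (E h) (E c)" using that eL by simp
      qed (use lv W tp_in ah bc in auto)
      show "x \<in> E.sprod a b (E a) (E b)" using that eL by simp
    qed (use W tp_in ah bc in auto)
  qed
  also have "(norm (w L - ?y))\<^sup>2 = 1 - overlap h"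
  proof -
    have d: "w h - lv h \<in> F h" using ah by (intro closed_csubspaceD(5)[OF F.fibre_closed] W lv) auto
    have 1: "mF h c (w h) (w c) - mF h c (lv h) (w c) = mF h c (w h - lv h) (w c)"
      using F.m_diff_left[OF ah(2) bc(3)] W lv ah bc by simp
    have "mF h c (w h) (w c) \<in> F b" using W ah bc by (intro F.m_in') auto
    then have 2: "w L - ?y = mF a b (w a) (mF h c (w h) (w c) - mF h c (lv h) (w c))"
      unfolding wL by (intro F.m_diff_right[symmetric] ah(1) bc(1) yb W(1))
    have "mF h c (w h - lv h) (w c) \<in> F b" using d W bc ah by (intro F.m_in') auto
    then have "norm (mF a b (w a) (mF h c (w h - lv h) (w c))) = norm (w h - lv h)"
      using d W(1,2) ah bc by (simp add: F.norm_m)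
    then have "norm (w L - ?y) = norm (w h - lv h)" unfolding 2 1 .
    then show ?thesis using lv(2)[OF ah(2)] by simp
  qed
  finally show ?thesis unfolding N by (simp add: gap_def b_def c_def algebra_simps)
qed

text \<open>For x = x1 \<cdot> x2 cut at time a this is \<open>section_right_continuous\<close> for
  u and x2; the vectors x with the property form a closed subspace.\<close>

private lemma core_converges:
  assumes a: "0 < a" "a < L" and x: "x \<in> E L" and \<delta>: "\<delta> > 0"
  shows "\<forall>\<^sub>F h in at_right 0. norm (x - hproj (core a h) x) < \<delta>"
proof -
  define b where "b = L - a"
  have b: "b > 0" "a + b = L" using a by (auto simp: b_def)
  let ?X = "{x. \<forall>\<delta>>0. \<forall>\<^sub>F h in at_right 0. \<exists>q\<in>core a h. norm (x - q) < \<delta>}"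
  have "E.sprod a b (E a) (E b) \<subseteq> ?X"
  proof (rule E.sprod_minimal[OF closed_csubspace_approximable[OF core_closed]], intro CollectI allI impI)
    fix x1 x2 and \<delta> :: real assume x12: "x1 \<in> E a" "x2 \<in> E b" and \<delta>: "\<delta> > 0"
    have p: "norm x1 + 1 > 0" using norm_ge_zero[of x1] by linarith
    obtain h0 where h0: "0 < h0" "h0 < b"
      "\<And>h. 0 < h \<Longrightarrow> h \<le> h0 \<Longrightarrow> \<exists>y\<in>E (b - h). norm (x2 - mE h (b - h) (u h) y) < \<delta> / (norm x1 + 1)"
      using E.section_right_continuous[OF sepE u b(1) x12(2) divide_pos_pos[OF \<delta> p]] by blast
    show "\<forall>\<^sub>F h in at_right 0. \<exists>q\<in>core a h. norm (mE a b x1 x2 - q) < \<delta>"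
      unfolding eventually_at_right_field
    proof (intro exI[of _ h0] conjI allI impI h0(1))
      fix h assume h: "0 < h" "h < h0"
      then obtain y where y: "y \<in> E (b - h)" "norm (x2 - mE h (b - h) (u h) y) < \<delta> / (norm x1 + 1)"
        using h0(3)[of h] by auto
      let ?y = "mE h (b - h) (u h) y"
      have yb: "?y \<in> E b" using U y(1) h h0 by (intro E.m_in') auto
      have "norm (mE a b x1 x2 - mE a b x1 ?y) = norm x1 * norm (x2 - ?y)"
        unfolding E.m_diff_right[OF a(1) b(1) x12 yb, symmetric]
        by (intro E.norm_m a(1) b(1) x12(1) closed_csubspaceD(5)[OF E.fibre_closed] x12(2) yb)
      also have "\<dots> \<le> (norm x1 + 1) * norm (x2 - ?y)" by (simp add: mult_right_mono)
      also have "\<dots> < \<delta>" using y(2) p by (simp add: field_simps)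
      finally show "\<exists>q\<in>core a h. norm (mE a b x1 x2 - q) < \<delta>"
        unfolding core_def b_def[symmetric] using x12(1) y(1) by (auto intro!: E.sprod_base)
    qed
  qed
  then have "x \<in> ?X" using x E.sprod_fibre[OF a(1) b(1)] b(2) by auto
  then have "\<forall>\<^sub>F h in at_right 0. \<exists>q\<in>core a h. norm (x - q) < \<delta>" using \<delta> by blast
  then show ?thesis
  proof (rule eventually_mono)
    fix h assume "\<exists>q\<in>core a h. norm (x - q) < \<delta>"
    then obtain q where q: "q \<in> core a h" "norm (x - q) < \<delta>" by blast
    have "norm (x - hproj (core a h) x) \<le> norm (x - q)"
      using norm_diff_hproj_le[OF core_closed q(1)] by (rule power2_le_imp_le) simp
    with q(2) show "norm (x - hproj (core a h) x) < \<delta>" by linarith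
  qed
qed

text \<open>The gap tends to 0 as \<open>a\<close> tends to 0. By \<open>gap_step\<close> and \<open>core_converges\<close> its right derivative
  in \<open>a\<close> is at most 0 everywhere, so it vanishes identically.\<close>

lemma tensor_section_mem:
  assumes x: "x \<in> E L"
  shows "tp x (w L) \<in> S L"
proof -
  obtain c where c: "c \<ge> 0" "\<And>s. s > 0 \<Longrightarrow> 1 - overlap s \<le> c * s"
    unfolding overlap_def using F.sections_overlap_bound[OF sepF v w] by blast
  \<comment> \<open>The Lipschitz constant of the gap: the distance of x to \<open>core\<close> is
    at most its distance to 0, that is, norm x.\<close>
  define k where "k = c * (norm x)\<^sup>2"
  have k: "k \<ge> 0" using c by (simp add: k_def)
  have step: "gap x (a + h) \<le> gap x a + c * h * (norm (x - hproj (core a h) x))\<^sup>2"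
    if "0 < a" "0 < h" "a + h < L" for a h
    using gap_step[OF that x] mult_right_mono[OF c(2)[OF that(2)], of "(norm (x - hproj (core a h) x))\<^sup>2"]
    by simp
  have mono: "gap x b \<le> gap x a" if ab: "0 < a" "a \<le> b" "b < L" for a b
  proof (rule le_if_right_derivative_nonpos[OF ab(2) k])
    fix y z assume yz: "a \<le> y" "y \<le> z" "z \<le> b"
    show "gap x z \<le> gap x y + k * (z - y)"
    proof (cases "y = z")
      case False
      then have h: "z - y > 0" using yz by simp
      have "(norm (x - hproj (core y (z - y)) x))\<^sup>2 \<le> (norm x)\<^sup>2"
        using norm_diff_hproj_le[OF core_closed closed_csubspaceD(2)[OF core_closed], of x] by simp
      then have "c * (z - y) * (norm (x - hproj (core y (z - y)) x))\<^sup>2 \<le> c * (z - y) * (norm x)\<^sup>2"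
        using c h by (intro mult_left_mono) auto
      then show ?thesis using step[of y "z - y"] h yz ab by (simp add: k_def algebra_simps)
    qed simp
  next
    fix y \<delta> :: real assume y: "a \<le> y" "y < b" and \<delta>: "\<delta> > 0"
    \<comment> \<open>With squared core distance at most \<delta> / (c + 1), a slot of length h
      costs at most \<open>c * h * (\<delta> / (c + 1))\<close>, which is below \<delta> h also when
      c = 0.\<close>
    have p: "\<delta> / (c + 1) > 0" using c \<delta> by simp
    have "\<forall>\<^sub>F h in at_right 0. norm (x - hproj (core y h) x) < sqrt (\<delta> / (c + 1))"
      using y ab p by (intro core_converges x) auto
    then obtain h1 where h1: "h1 > 0" "\<And>h. 0 < h \<Longrightarrow> h < h1 \<Longrightarrow> norm (x - hproj (core y h) x) < sqrt (\<delta> / (c + 1))"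
      unfolding eventually_at_right_field by blast
    have "gap x (y + h) \<le> gap x y + \<delta> * h" if h: "0 < h" "h \<le> h1 / 2" "y + h \<le> b" for h
    proof -
      have "(norm (x - hproj (core y h) x))\<^sup>2 \<le> (sqrt (\<delta> / (c + 1)))\<^sup>2"
        using h1(2)[of h] h h1(1) by (intro power_mono) auto
      then have "(norm (x - hproj (core y h) x))\<^sup>2 \<le> \<delta> / (c + 1)" using p by simp
      then have "c * h * (norm (x - hproj (core y h) x))\<^sup>2 \<le> c * h * (\<delta> / (c + 1))"
        using c h by (intro mult_left_mono) auto
      also have "\<dots> \<le> (c + 1) * h * (\<delta> / (c + 1))"
        using c h p by (intro mult_right_mono) auto
      also have "\<dots> = \<delta> * h" using c by simp
      finally have "c * h * (norm (x - hproj (core y h) x))\<^sup>2 \<le> \<delta> * h" .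
      moreover have "gap x (y + h) \<le> gap x y + c * h * (norm (x - hproj (core y h) x))\<^sup>2"
        using h y ab by (intro step) auto
      ultimately show ?thesis by linarith
    qed
    then show "\<exists>h0>0. \<forall>h. 0 < h \<and> h \<le> h0 \<and> y + h \<le> b \<longrightarrow> gap x (y + h) \<le> gap x y + \<delta> * h"
      using h1(1) by (intro exI[of _ "h1 / 2"]) auto
  qed
  have "(norm (tp x (w L) - hproj (S L) (tp x (w L))))\<^sup>2 \<le> 0"
  proof (rule field_le_epsilon)
    fix e :: real assume e: "e > 0"
    \<comment> \<open>The first and the last slot have length \<eta> and cost at most k \<eta> each,
      whence the 2 (k + 1). The bound L/2 gives \<eta> \<le> L - \<eta>, as \<open>mono\<close>
      requires between the two.\<close>
    define \<eta> where "\<eta> = min (L / 2) (e / (2 * (k + 1)))"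
    have "\<eta> \<le> L / 2" unfolding \<eta>_def by (rule min.cobounded1)
    moreover have "0 < \<eta>" using L k e by (simp add: \<eta>_def)
    ultimately have \<eta>: "0 < \<eta>" "\<eta> \<le> L - \<eta>" "L - \<eta> < L" by auto
    have "\<eta> \<le> e / (2 * (k + 1))" by (simp add: \<eta>_def)
    then have \<eta>4: "2 * (k + 1) * \<eta> \<le> e" using k by (simp add: field_simps)
    have "(norm (tp x (w L) - hproj (S L) (tp x (w L))))\<^sup>2 \<le> gap x (L - \<eta>) + (1 - overlap \<eta>) * (norm x)\<^sup>2"
      using gap_full[of "L - \<eta>" x] \<eta> x by simp
    also have "gap x (L - \<eta>) \<le> gap x \<eta>" using \<eta> by (intro mono) auto
    also have "gap x \<eta> \<le> (1 - overlap \<eta>) * (norm x)\<^sup>2" using \<eta> x by (intro gap_le_left) auto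
    also have "(1 - overlap \<eta>) * (norm x)\<^sup>2 \<le> k * \<eta>"
      using mult_right_mono[OF c(2)[OF \<eta>(1)], of "(norm x)\<^sup>2"] by (simp add: k_def mult.commute mult.left_commute)
    finally have "(norm (tp x (w L) - hproj (S L) (tp x (w L))))\<^sup>2 \<le> 2 * k * \<eta>" by (simp add: mult.commute)
    also have "\<dots> \<le> 2 * (k + 1) * \<eta>" using \<eta>(1) by simp
    also have "\<dots> \<le> 0 + e" using \<eta>4 by simp
    finally show "(norm (tp x (w L) - hproj (S L) (tp x (w L))))\<^sup>2 \<le> 0 + e" .
  qed
  then show ?thesis by (intro mem_closed_csubspace_hproj H.msubD(1)[OF S L]) simp
qed

end

end

section \<open>Generated subsystems and uniqueness of amalgamated products\<close>

lemma closed_csubspace_Times: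
  "closed_csubspace A \<Longrightarrow> closed_csubspace B \<Longrightarrow> closed_csubspace (A \<times> B)"
  by (rule closed_csubspaceI) (auto simp: closed_csubspace_def closed_Times scaleC_prod_def zero_prod_def)

lemma bounded_op_map_prod:
  assumes f: "bounded_op A K f" and g: "bounded_op B L g"
  shows "bounded_op (A \<times> B) (K \<times> L) (map_prod f g)"
proof -
  obtain M where M: "\<And>x. x \<in> A \<Longrightarrow> norm (f x) \<le> M * norm x" and lf: "clinear_on A f"
    and fK: "f ` A \<subseteq> K" by (rule bounded_opE[OF f]) blast
  obtain N where N: "\<And>x. x \<in> B \<Longrightarrow> norm (g x) \<le> N * norm x" and lg: "clinear_on B g"
    and gL: "g ` B \<subseteq> L" by (rule bounded_opE[OF g]) blast
  have "norm (map_prod f g p) \<le> (\<bar>M\<bar> + \<bar>N\<bar>) * norm p" if p: "p \<in> A \<times> B" for p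
  proof -
    have "norm (map_prod f g p) \<le> norm (f (fst p)) + norm (g (snd p))"
      by (cases p) (simp add: norm_Pair sqrt_sum_squares_le_sum)
    also have "norm (f (fst p)) \<le> \<bar>M\<bar> * norm p"
    proof -
      have "norm (f (fst p)) \<le> M * norm (fst p)" using M p by auto
      also have "\<dots> \<le> \<bar>M\<bar> * norm p" using norm_fst_le[of "fst p" "snd p"] by (intro mult_mono) auto
      finally show ?thesis .
    qed
    also have "norm (g (snd p)) \<le> \<bar>N\<bar> * norm p"
    proof -
      have "norm (g (snd p)) \<le> N * norm (snd p)" using N p by auto
      also have "\<dots> \<le> \<bar>N\<bar> * norm p" using norm_snd_le[of "snd p" "fst p"] by (intro mult_mono) auto
      finally show ?thesis .
    qed
    finally show ?thesis by (simp add: distrib_right)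
  qed
  moreover have "clinear_on (A \<times> B) (map_prod f g)"
    using lf lg by (auto simp: clinear_on_def scaleC_prod_def)
  moreover have "map_prod f g ` (A \<times> B) \<subseteq> K \<times> L" using fK gL by auto
  ultimately show ?thesis unfolding bounded_op_def by blast
qed

lemma bounded_op_range: "bounded_op W K f \<Longrightarrow> f ` W \<subseteq> L \<Longrightarrow> bounded_op W L f"
  by (simp add: bounded_op_def)

lemma bounded_op_fst: "bounded_op UNIV UNIV (fst :: 'a::complex_inner \<times> 'b::complex_inner \<Rightarrow> 'a)"
  unfolding bounded_op_def clinear_on_def
proof (intro conjI exI[of _ 1] ballI allI)
  show "norm (fst p) \<le> 1 * norm p" for p :: "'a \<times> 'b" using norm_fst_le[of "fst p" "snd p"] by simp
qed (simp_all add: scaleC_prod_def)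

lemma bounded_op_snd: "bounded_op UNIV UNIV (snd :: 'a::complex_inner \<times> 'b::complex_inner \<Rightarrow> 'b)"
  unfolding bounded_op_def clinear_on_def
proof (intro conjI exI[of _ 1] ballI allI)
  show "norm (snd p) \<le> 1 * norm p" for p :: "'a \<times> 'b" using norm_snd_le[of "snd p" "fst p"] by simp
qed (simp_all add: scaleC_prod_def)

lemma bounded_op_image_closed_cspan:
  assumes W: "closed_csubspace W" and f: "bounded_op W K f" and X: "X \<subseteq> W" and x: "x \<in> closed_cspan X"
  shows "f x \<in> closed_cspan (f ` X)"
proof -
  have "closed_cspan X \<subseteq> {x \<in> W. f x \<in> closed_cspan (f ` X)}"
    using X
    by (intro closed_cspan_minimal closed_csubspace_preimage[OF W f closed_csubspace_closed_cspan]
        subsetI CollectI conjI closed_cspan_base imageI) auto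
  with x show ?thesis by blast
qed

context mult_system
begin

definition gen :: "(real \<Rightarrow> 'h set) \<Rightarrow> real \<Rightarrow> 'h set" where
  "gen X t = \<Inter>{G t | G. msub G \<and> (\<forall>s>0. X s \<subseteq> G s)}"

lemma msub_mult:
  assumes "msub G" "s > 0" "t > 0" "x \<in> G s" "y \<in> G t"
  shows "m s t x y \<in> G (s + t)"
  unfolding msubD(3)[OF assms(1-3), symmetric] by (rule sprod_base[OF assms(4,5)])

lemma gen_superset: "t > 0 \<Longrightarrow> X t \<subseteq> gen X t"
  by (auto simp: gen_def)

lemma gen_minimal: "msub G \<Longrightarrow> (\<And>s. s > 0 \<Longrightarrow> X s \<subseteq> G s) \<Longrightarrow> gen X t \<subseteq> G t"
  by (auto simp: gen_def)

lemma msub_gen: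
  assumes "\<And>s. s > 0 \<Longrightarrow> X s \<subseteq> H s"
  shows "msub (gen X)"
proof -
  have "gen X = (\<lambda>t. \<Inter>G\<in>{G. msub G \<and> (\<forall>s>0. X s \<subseteq> G s)}. G t)"
    by (intro ext) (auto simp: gen_def)
  moreover have "msub \<dots>" using msub_fibre assms by (intro msub_Inter) auto
  ultimately show ?thesis by simp
qed

text \<open>Closure under products and divisibility of Z give the two inclusions that make the
  closed spans a product subsystem; the second part of \<open>X\<close> says that Z adds nothing
  beyond what X generates. It is applied to words.\<close>

lemma gen_eq_closed_cspan:
  assumes Z: "\<And>t. t > 0 \<Longrightarrow> Z t \<subseteq> H t"
    and mult: "\<And>s t x y. s > 0 \<Longrightarrow> t > 0 \<Longrightarrow> x \<in> Z s \<Longrightarrow> y \<in> Z t \<Longrightarrow> m s t x y \<in> Z (s + t)"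
    and split: "\<And>s t. s > 0 \<Longrightarrow> t > 0 \<Longrightarrow> Z (s + t) \<subseteq> sprod s t (Z s) (Z t)"
    and X: "\<And>t. t > 0 \<Longrightarrow> X t \<subseteq> Z t" "\<And>G t. msub G \<Longrightarrow> (\<And>s. s > 0 \<Longrightarrow> X s \<subseteq> G s) \<Longrightarrow> t > 0 \<Longrightarrow> Z t \<subseteq> G t"
    and t: "t > 0"
  shows "closed_cspan (Z t) = gen X t"
proof
  have "msub (\<lambda>t. closed_cspan (Z t))"
    unfolding msub_def
  proof (intro conjI allI impI closed_csubspace_closed_cspan)
    show "closed_cspan (Z t) \<subseteq> H t" if "t > 0" for t
      by (rule closed_cspan_minimal[OF fibre_closed[OF that] Z[OF that]])
    fix s t :: real assume st: "s > 0" "t > 0"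
    show "sprod s t (closed_cspan (Z s)) (closed_cspan (Z t)) = closed_cspan (Z (s + t))"
      unfolding sprod_closed_cspan[OF st Z[OF st(1)] Z[OF st(2)]]
    proof
      show "sprod s t (Z s) (Z t) \<subseteq> closed_cspan (Z (s + t))"
        using mult[OF st] by (intro sprod_minimal closed_csubspace_closed_cspan closed_cspan_base)
      show "closed_cspan (Z (s + t)) \<subseteq> sprod s t (Z s) (Z t)"
        by (rule closed_cspan_minimal[OF closed_csubspace_sprod split[OF st]])
    qed
  qed
  then show "gen X t \<subseteq> closed_cspan (Z t)"
    using X(1) closed_cspan_superset by (intro gen_minimal) blast+
  have "X s \<subseteq> H s" if "s > 0" for s using X(1)[OF that] Z[OF that] by blast
  then have g: "msub (gen X)" by (rule msub_gen)
  show "closed_cspan (Z t) \<subseteq> gen X t"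
    by (intro closed_cspan_minimal msubD(1)[OF g t] X(2)[OF g gen_superset t])
qed

end

section \<open>Words in two systems with matching inner products\<close>

locale two_mult_systems = G: mult_system G mG + H: mult_system H mH
  for G :: "real \<Rightarrow> 'c::chilbert set" and mG and H :: "real \<Rightarrow> 'h::chilbert set" and mH
begin

text \<open>Carries a word of G together with the corresponding word of H. Inner products of pairs
  are sums and do not multiply, so this is no \<open>mult_system\<close> on the direct sum, and
  boundedness is obtained componentwise.\<close>

definition pair_mult :: "real \<Rightarrow> real \<Rightarrow> 'c \<times> 'h \<Rightarrow> 'c \<times> 'h \<Rightarrow> 'c \<times> 'h" where
  "pair_mult s t p q = (mG s t (fst p) (fst q), mH s t (snd p) (snd q))"

lemma pair_mult_bounded_op_left:
  "\<lbrakk>s > 0; t > 0; q \<in> G t \<times> H t\<rbrakk> \<Longrightarrow>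
    bounded_op (G s \<times> H s) (G (s + t) \<times> H (s + t)) (\<lambda>p. pair_mult s t p q)"
  using bounded_op_map_prod[OF G.m_bounded_op_left H.m_bounded_op_left, of s t "fst q" s t "snd q"]
  by (auto simp: pair_mult_def[abs_def] map_prod_def case_prod_beta')

lemma pair_mult_bounded_op_right:
  "\<lbrakk>s > 0; t > 0; p \<in> G s \<times> H s\<rbrakk> \<Longrightarrow>
    bounded_op (G t \<times> H t) (G (s + t) \<times> H (s + t)) (pair_mult s t p)"
  using bounded_op_map_prod[OF G.m_bounded_op_right H.m_bounded_op_right, of s t "fst p" s t "snd p"]
  by (auto simp: pair_mult_def[abs_def] map_prod_def case_prod_beta')

lemma pair_mult_in:
  "\<lbrakk>s > 0; t > 0; p \<in> G s \<times> H s; q \<in> G t \<times> H t; s + t = r\<rbrakk> \<Longrightarrow> pair_mult s t p q \<in> G r \<times> H r"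
  by (auto simp: pair_mult_def intro: G.m_in' H.m_in')

lemma pair_mult_assoc:
  "\<lbrakk>r > 0; s > 0; t > 0; p \<in> G r \<times> H r; q \<in> G s \<times> H s; w \<in> G t \<times> H t; r + s = a; s + t = b\<rbrakk> \<Longrightarrow>
    pair_mult a t (pair_mult r s p q) w = pair_mult r b p (pair_mult s t q w)"
  by (auto simp: pair_mult_def intro: G.m_assoc' H.m_assoc')

lemma closed_fibre_pair: "t > 0 \<Longrightarrow> closed_csubspace (G t \<times> H t)"
  by (intro closed_csubspace_Times G.fibre_closed H.fibre_closed)

text \<open>The closed span in \<open>X_split\<close> is taken in the direct sum: the same
  combinations of products must approximate both components of a generator simultaneously.\<close>

context
  fixes X :: "real \<Rightarrow> ('c \<times> 'h) set"
  assumes X_in: "\<And>t. t > 0 \<Longrightarrow> X t \<subseteq> G t \<times> H t"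
    and X_cinner: "\<And>t p q. t > 0 \<Longrightarrow> p \<in> X t \<Longrightarrow> q \<in> X t \<Longrightarrow> cinner (snd p) (snd q) = cinner (fst p) (fst q)"
    and X_split: "\<And>s t. s > 0 \<Longrightarrow> t > 0 \<Longrightarrow>
      X (s + t) \<subseteq> closed_cspan {pair_mult s t p q | p q. p \<in> X s \<and> q \<in> X t}"
begin

text \<open>Words may be subdivided at any time (\<open>word_split\<close>); hence two words of the same length are
  compared on a common subdivision, where their inner products factorise.\<close>

inductive word :: "real \<Rightarrow> 'c \<times> 'h \<Rightarrow> bool" where
  generator: "t > 0 \<Longrightarrow> p \<in> X t \<Longrightarrow> word t p"
| mult: "word s p \<Longrightarrow> word t q \<Longrightarrow> word (s + t) (pair_mult s t p q)"

lemma word_in: "word t p \<Longrightarrow> t > 0 \<and> p \<in> G t \<times> H t"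
proof (induction rule: word.induct)
  case (generator t p)
  then show ?case using X_in by blast
next
  case (mult s p t q)
  then show ?case using pair_mult_in[of s t p q] by auto
qed

text \<open>The cut falls between the two factors of the word or inside one of them. In the latter
  case the induction hypothesis cuts that factor, and associativity moves the remaining piece over
  to the other one.\<close>

lemma word_split:
  "word r p \<Longrightarrow> s > 0 \<Longrightarrow> t > 0 \<Longrightarrow> r = s + t \<Longrightarrow>
    p \<in> closed_cspan {pair_mult s t a b | a b. word s a \<and> word t b}"
proof (induction arbitrary: s t rule: word.induct)
  case (generator r p)
  have "{pair_mult s t p q | p q. p \<in> X s \<and> q \<in> X t} \<subseteq> {pair_mult s t a b | a b. word s a \<and> word t b}"
    using generator(3,4) word.generator by blast
  from closed_cspan_mono[OF this] show ?case using X_split[of s t] generator by blast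
next
  case (mult s1 p s2 q)
  let ?PP = "\<lambda>s t. {pair_mult s t a b | a b. word s a \<and> word t b}"
  have pq: "s1 > 0" "p \<in> G s1 \<times> H s1" "s2 > 0" "q \<in> G s2 \<times> H s2" using word_in mult(1,2) by auto
  consider "s = s1" | "s < s1" | "s > s1" by linarith
  then show ?case
  proof cases
    case 1
    then have "t = s2" using mult.prems by simp
    then show ?thesis using 1 mult(1,2) by (intro closed_cspan_base) blast
  next
    case 2
    then have d: "s1 - s > 0" "s1 = s + (s1 - s)" "t = (s1 - s) + s2" using mult.prems by auto
    have "?PP s (s1 - s) \<subseteq> {p \<in> G s1 \<times> H s1. pair_mult s1 s2 p q \<in> closed_cspan (?PP s t)}"
    proof
      fix z assume "z \<in> ?PP s (s1 - s)"
      then obtain a b where z: "z = pair_mult s (s1 - s) a b" and ab: "word s a" "word (s1 - s) b" by blast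
      have in1: "pair_mult s (s1 - s) a b \<in> G s1 \<times> H s1"
        using ab word_in d(1) by (intro pair_mult_in) auto
      have "pair_mult s1 s2 (pair_mult s (s1 - s) a b) q = pair_mult s t a (pair_mult (s1 - s) s2 b q)"
        using ab word_in pq d by (intro pair_mult_assoc) auto
      moreover have "word t (pair_mult (s1 - s) s2 b q)" using word.mult[OF ab(2) mult(2)] d(3) by simp
      with ab(1) have PP: "pair_mult s t a (pair_mult (s1 - s) s2 b q) \<in> ?PP s t" by blast
      ultimately show "z \<in> {p \<in> G s1 \<times> H s1. pair_mult s1 s2 p q \<in> closed_cspan (?PP s t)}"
        using in1 closed_cspan_base[OF PP] z by simp
    qed
    from closed_cspan_minimal[OF closed_csubspace_preimage[OF closed_fibre_pair[OF pq(1)]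
        pair_mult_bounded_op_left[OF pq(1,3,4)] closed_csubspace_closed_cspan] this]
    show ?thesis using mult.IH(1)[OF mult.prems(1) d(1,2)] by blast
  next
    case 3
    then have d: "s - s1 > 0" "s2 = (s - s1) + t" "s = s1 + (s - s1)" using mult.prems by auto
    have "?PP (s - s1) t \<subseteq> {q \<in> G s2 \<times> H s2. pair_mult s1 s2 p q \<in> closed_cspan (?PP s t)}"
    proof
      fix z assume "z \<in> ?PP (s - s1) t"
      then obtain a b where z: "z = pair_mult (s - s1) t a b" and ab: "word (s - s1) a" "word t b" by blast
      have in1: "pair_mult (s - s1) t a b \<in> G s2 \<times> H s2"
        using ab word_in d by (intro pair_mult_in) auto
      have "pair_mult s1 s2 p (pair_mult (s - s1) t a b) = pair_mult s t (pair_mult s1 (s - s1) p a) b"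
        using ab word_in pq d by (intro pair_mult_assoc[symmetric]) auto
      moreover have "word s (pair_mult s1 (s - s1) p a)" using word.mult[OF mult(1) ab(1)] by simp
      with ab(2) have PP: "pair_mult s t (pair_mult s1 (s - s1) p a) b \<in> ?PP s t" by blast
      ultimately show "z \<in> {q \<in> G s2 \<times> H s2. pair_mult s1 s2 p q \<in> closed_cspan (?PP s t)}"
        using in1 closed_cspan_base[OF PP] z by simp
    qed
    from closed_cspan_minimal[OF closed_csubspace_preimage[OF closed_fibre_pair[OF pq(3)]
        pair_mult_bounded_op_right[OF pq(1,3,2)] closed_csubspace_closed_cspan] this]
    show ?thesis using mult.IH(2)[OF d(1) mult.prems(2) d(2)] by blast
  qed
qed

lemma cinner_pair_mult:
  assumes "s > 0" "t > 0" "p \<in> G s \<times> H s" "p' \<in> G s \<times> H s" "q \<in> G t \<times> H t" "q' \<in> G t \<times> H t"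
    and "cinner (snd p) (snd p') = cinner (fst p) (fst p')" "cinner (snd q) (snd q') = cinner (fst q) (fst q')"
  shows "cinner (snd (pair_mult s t p q)) (snd (pair_mult s t p' q')) =
    cinner (fst (pair_mult s t p q)) (fst (pair_mult s t p' q'))"
  using assms by (auto simp: pair_mult_def G.cinner_m H.cinner_m)

text \<open>Induction on the word: \<open>X_split\<close> cuts the generator p exactly where the
  word is a product, and on products the inner products of both components factorise.\<close>

lemma word_cinner_generator:
  "word t q \<Longrightarrow> p \<in> X t \<Longrightarrow> cinner (snd q) (snd p) = cinner (fst q) (fst p)"
proof (induction arbitrary: p rule: word.induct)
  case (generator t q)
  then show ?case using X_cinner by blast
next
  case (mult s q t q')
  have pos: "s > 0" "t > 0" and q: "q \<in> G s \<times> H s" "q' \<in> G t \<times> H t" using word_in mult(1,2) by auto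
  have "closed_cspan {pair_mult s t a b | a b. a \<in> X s \<and> b \<in> X t} \<subseteq>
      {p. cinner (snd (pair_mult s t q q')) (snd p) = cinner (fst (pair_mult s t q q')) (fst p)}"
  proof (rule closed_cspan_minimal[OF closed_csubspace_cinner_agree], rule subsetI)
    fix z assume "z \<in> {pair_mult s t a b | a b. a \<in> X s \<and> b \<in> X t}"
    then obtain a b where z: "z = pair_mult s t a b" and ab: "a \<in> X s" "b \<in> X t" by blast
    have "cinner (snd (pair_mult s t q q')) (snd (pair_mult s t a b)) =
        cinner (fst (pair_mult s t q q')) (fst (pair_mult s t a b))"
      using X_in[OF pos(1)] X_in[OF pos(2)] ab q mult.IH(1)[OF ab(1)] mult.IH(2)[OF ab(2)]
      by (intro cinner_pair_mult pos) auto
    then show "z \<in> {p. cinner (snd (pair_mult s t q q')) (snd p) = cinner (fst (pair_mult s t q q')) (fst p)}"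
      using z by simp
  qed
  then show ?case using X_split[OF pos] mult.prems by blast
qed

text \<open>The same induction with an arbitrary second word, which \<open>word_split\<close> cuts
  where the first one is a product; the base case is the comparison with a generator.\<close>

lemma word_cinner:
  "word t p \<Longrightarrow> word t q \<Longrightarrow> cinner (snd p) (snd q) = cinner (fst p) (fst q)"
proof (induction arbitrary: q rule: word.induct)
  case (generator t p)
  from word_cinner_generator[OF generator(3,2)] show ?case by (metis cinner_commute)
next
  case (mult s p t p')
  have pos: "s > 0" "t > 0" and p: "p \<in> G s \<times> H s" "p' \<in> G t \<times> H t" using word_in mult(1,2) by auto
  have "closed_cspan {pair_mult s t a b | a b. word s a \<and> word t b} \<subseteq>
      {q. cinner (snd (pair_mult s t p p')) (snd q) = cinner (fst (pair_mult s t p p')) (fst q)}"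
  proof (rule closed_cspan_minimal[OF closed_csubspace_cinner_agree], rule subsetI)
    fix z assume "z \<in> {pair_mult s t a b | a b. word s a \<and> word t b}"
    then obtain a b where z: "z = pair_mult s t a b" and ab: "word s a" "word t b" by blast
    have "cinner (snd (pair_mult s t p p')) (snd (pair_mult s t a b)) =
        cinner (fst (pair_mult s t p p')) (fst (pair_mult s t a b))"
      using word_in ab p mult.IH(1)[OF ab(1)] mult.IH(2)[OF ab(2)]
      by (intro cinner_pair_mult pos) auto
    then show "z \<in> {q. cinner (snd (pair_mult s t p p')) (snd q) = cinner (fst (pair_mult s t p p')) (fst q)}"
      using z by simp
  qed
  then show ?case using word_split[OF mult.prems pos refl] by blast
qed

text \<open>First components inherit closure under products and divisibility from words, as the
  coordinate map of the direct sum is bounded.\<close>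

lemma gen_fst_word:
  assumes t: "t > 0"
  shows "closed_cspan (fst ` {p. word t p}) = G.gen (\<lambda>t. fst ` X t) t"
proof (rule G.gen_eq_closed_cspan[OF _ _ _ _ _ t])
  show "fst ` {p. word t p} \<subseteq> G t" for t using word_in by fastforce
  show "mG s t x y \<in> fst ` {p. word (s + t) p}"
    if "s > 0" "t > 0" and xy: "x \<in> fst ` {p. word s p}" "y \<in> fst ` {p. word t p}" for s t x y
  proof -
    obtain p q where "x = fst p" "y = fst q" "word s p" "word t q" using xy by blast
    then show ?thesis using imageI[of "pair_mult s t p q" "{p. word (s + t) p}" fst] word.mult[of s p t q] by (simp add: pair_mult_def)
  qed
  show "fst ` {p. word (s + t) p} \<subseteq> G.sprod s t (fst ` {p. word s p}) (fst ` {p. word t p})"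
    if st: "s > 0" "t > 0" for s t
  proof
    fix z assume "z \<in> fst ` {p. word (s + t) p}"
    then obtain p where p: "word (s + t) p" "z = fst p" by blast
    from bounded_op_image_closed_cspan[OF closed_csubspace_UNIV bounded_op_fst subset_UNIV
        word_split[OF p(1) st refl]]
    have "z \<in> closed_cspan (fst ` {pair_mult s t a b | a b. word s a \<and> word t b})" using p(2) by simp
    also have "\<dots> \<subseteq> G.sprod s t (fst ` {p. word s p}) (fst ` {p. word t p})"
      unfolding G.sprod_def by (rule closed_cspan_mono) (force simp: pair_mult_def)
    finally show "z \<in> G.sprod s t (fst ` {p. word s p}) (fst ` {p. word t p})" .
  qed
  show "fst ` X t \<subseteq> fst ` {p. word t p}" if "t > 0" for t using word.generator[OF that] by blast
  fix K and t :: real assume K: "G.msub K" "\<And>s. s > 0 \<Longrightarrow> fst ` X s \<subseteq> K s" and t: "t > 0"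
  have "word t p \<Longrightarrow> fst p \<in> K t" for t p
  proof (induction rule: word.induct)
    case (mult s p t q)
    have st: "s > 0" "t > 0" using word_in mult by auto
    show ?case using G.msub_mult[OF K(1) st mult.IH] by (simp add: pair_mult_def)
  qed (use K in auto)
  then show "fst ` {p. word t p} \<subseteq> K t" by blast
qed

lemma gen_snd_word:
  assumes t: "t > 0"
  shows "closed_cspan (snd ` {p. word t p}) = H.gen (\<lambda>t. snd ` X t) t"
proof (rule H.gen_eq_closed_cspan[OF _ _ _ _ _ t])
  show "snd ` {p. word t p} \<subseteq> H t" for t using word_in by fastforce
  show "mH s t x y \<in> snd ` {p. word (s + t) p}"
    if "s > 0" "t > 0" and xy: "x \<in> snd ` {p. word s p}" "y \<in> snd ` {p. word t p}" for s t x y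
  proof -
    obtain p q where "x = snd p" "y = snd q" "word s p" "word t q" using xy by blast
    then show ?thesis using imageI[of "pair_mult s t p q" "{p. word (s + t) p}" snd] word.mult[of s p t q] by (simp add: pair_mult_def)
  qed
  show "snd ` {p. word (s + t) p} \<subseteq> H.sprod s t (snd ` {p. word s p}) (snd ` {p. word t p})"
    if st: "s > 0" "t > 0" for s t
  proof
    fix z assume "z \<in> snd ` {p. word (s + t) p}"
    then obtain p where p: "word (s + t) p" "z = snd p" by blast
    from bounded_op_image_closed_cspan[OF closed_csubspace_UNIV bounded_op_snd subset_UNIV
        word_split[OF p(1) st refl]]
    have "z \<in> closed_cspan (snd ` {pair_mult s t a b | a b. word s a \<and> word t b})" using p(2) by simp
    also have "\<dots> \<subseteq> H.sprod s t (snd ` {p. word s p}) (snd ` {p. word t p})"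
      unfolding H.sprod_def by (rule closed_cspan_mono) (force simp: pair_mult_def)
    finally show "z \<in> H.sprod s t (snd ` {p. word s p}) (snd ` {p. word t p})" .
  qed
  show "snd ` X t \<subseteq> snd ` {p. word t p}" if "t > 0" for t using word.generator[OF that] by blast
  fix K and t :: real assume K: "H.msub K" "\<And>s. s > 0 \<Longrightarrow> snd ` X s \<subseteq> K s" and t: "t > 0"
  have "word t p \<Longrightarrow> snd p \<in> K t" for t p
  proof (induction rule: word.induct)
    case (mult s p t q)
    have st: "s > 0" "t > 0" using word_in mult by auto
    show ?case using H.msub_mult[OF K(1) st mult.IH] by (simp add: pair_mult_def)
  qed (use K in auto)
  then show "snd ` {p. word t p} \<subseteq> K t" by blast
qed

text \<open>On words the map sends the first component to the second; \<open>word_cinner\<close>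
  makes it isometric, hence extendable to the closed spans. It is multiplicative on words by
  construction, and then in each argument in turn by boundedness.\<close>

lemma generated_isomorphism:
  obtains \<phi> where
    "\<And>t. t > 0 \<Longrightarrow> isometry_on (G.gen (\<lambda>t. fst ` X t) t) (\<phi> t)"
    "\<And>t. t > 0 \<Longrightarrow> \<phi> t ` G.gen (\<lambda>t. fst ` X t) t = H.gen (\<lambda>t. snd ` X t) t"
    "\<And>s t x y. s > 0 \<Longrightarrow> t > 0 \<Longrightarrow> x \<in> G.gen (\<lambda>t. fst ` X t) s \<Longrightarrow> y \<in> G.gen (\<lambda>t. fst ` X t) t \<Longrightarrow>
      \<phi> (s + t) (mG s t x y) = mH s t (\<phi> s x) (\<phi> t y)"
proof -
  let ?A = "G.gen (\<lambda>t. fst ` X t)" and ?B = "H.gen (\<lambda>t. snd ` X t)"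
  have "\<exists>T. t > 0 \<longrightarrow> isometry_on (?A t) T \<and> (\<forall>p. word t p \<longrightarrow> T (fst p) = snd p) \<and> T ` ?A t = ?B t" for t
  proof (cases "t > 0")
    case True
    show ?thesis
    proof (rule isometry_extension[of "{p. word t p}"])
      show "cinner b b' = cinner a a'" if "(a, b) \<in> {p. word t p}" "(a', b') \<in> {p. word t p}" for a b a' b'
        using word_cinner[of t "(a, b)" "(a', b')"] that by simp
      fix T assume T: "isometry_on (closed_cspan (fst ` {p. word t p})) T"
        "\<And>a b. (a, b) \<in> {p. word t p} \<Longrightarrow> T a = b"
        "T ` closed_cspan (fst ` {p. word t p}) = closed_cspan (snd ` {p. word t p})"
      have "\<forall>p. word t p \<longrightarrow> T (fst p) = snd p" using T(2) by simp
      with T(1,3) show ?thesis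
        unfolding gen_fst_word[OF True] gen_snd_word[OF True] by (intro exI[of _ T]) simp
    qed
  qed simp
  then have "\<exists>\<phi>. \<forall>t. t > 0 \<longrightarrow> isometry_on (?A t) (\<phi> t) \<and> (\<forall>p. word t p \<longrightarrow> \<phi> t (fst p) = snd p) \<and> \<phi> t ` ?A t = ?B t"
    by (intro choice allI)
  then obtain \<phi> where \<phi>0: "\<forall>t. t > 0 \<longrightarrow> isometry_on (?A t) (\<phi> t) \<and> (\<forall>p. word t p \<longrightarrow> \<phi> t (fst p) = snd p) \<and> \<phi> t ` ?A t = ?B t"
    by (rule exE)
  then have \<phi>: "\<And>t. t > 0 \<Longrightarrow> isometry_on (?A t) (\<phi> t)"
    "\<And>t p. t > 0 \<Longrightarrow> word t p \<Longrightarrow> \<phi> t (fst p) = snd p" "\<And>t. t > 0 \<Longrightarrow> \<phi> t ` ?A t = ?B t" by simp_all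
  have mA: "G.msub ?A" using X_in by (intro G.msub_gen) fastforce
  have mB: "H.msub ?B" using X_in by (intro H.msub_gen) fastforce
  have AG: "?A t \<subseteq> G t" and BH: "?B t \<subseteq> H t" and clA: "closed_csubspace (?A t)"
    if "t > 0" for t
    using G.msubD[OF mA] H.msubD[OF mB] that by auto
  have \<phi>op: "bounded_op (?A t) (H t) (\<phi> t)" if "t > 0" for t
    using \<phi>(1,3)[OF that] BH[OF that] by (intro isometry_on_bounded_op clA[OF that]) auto
  have AA: "mG s t x y \<in> ?A (s + t)" if "s > 0" "t > 0" "x \<in> ?A s" "y \<in> ?A t" for s t x y
    using that by (rule G.msub_mult[OF mA])
  have wA: "fst p \<in> ?A t" if p: "word t p" for t p
  proof -
    have "fst p \<in> closed_cspan (fst ` {p. word t p})" by (intro closed_cspan_base imageI CollectI p)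
    moreover have "t > 0" using word_in[OF p] by (rule conjunct1)
    ultimately show ?thesis by (simp only: gen_fst_word)
  qed
  have in\<phi>: "\<phi> t x \<in> H t" if "t > 0" "x \<in> ?A t" for t x
    using bounded_opE[OF \<phi>op[OF that(1)]] that(2) by (metis image_subset_iff)
  have Gl: "bounded_op (?A s) (?A (s + t)) (\<lambda>x. mG s t x y)" if st: "s > 0" "t > 0" and y: "y \<in> ?A t" for s t y
  proof (rule bounded_op_range)
    show "bounded_op (?A s) (G (s + t)) (\<lambda>x. mG s t x y)"
      using y AG[OF st(2)] by (intro bounded_op_subset[OF G.m_bounded_op_left AG] st) blast
    show "(\<lambda>x. mG s t x y) ` ?A s \<subseteq> ?A (s + t)" by (intro image_subsetI AA st y)
  qed
  have Gr: "bounded_op (?A t) (?A (s + t)) (mG s t x)" if st: "s > 0" "t > 0" and x: "x \<in> ?A s" for s t x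
  proof (rule bounded_op_range)
    show "bounded_op (?A t) (G (s + t)) (mG s t x)"
      using x AG[OF st(1)] by (intro bounded_op_subset[OF G.m_bounded_op_right AG] st) blast
    show "mG s t x ` ?A t \<subseteq> ?A (s + t)" by (intro image_subsetI AA st x)
  qed
  have 1: "\<phi> (s + t) (mG s t (fst p) y) = mH s t (\<phi> s (fst p)) (\<phi> t y)"
    if st: "s > 0" "t > 0" and p: "word s p" and y: "y \<in> ?A t" for s t p y
  proof (rule bounded_op_eqI[OF clA[OF st(2)]])
    show "bounded_op (?A t) (H (s + t)) (\<lambda>y. \<phi> (s + t) (mG s t (fst p) y))"
      using st by (intro bounded_op_compose[OF Gr[OF st wA[OF p]] \<phi>op]) simp
    show "bounded_op (?A t) (H (s + t)) (\<lambda>y. mH s t (\<phi> s (fst p)) (\<phi> t y))"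
      by (intro bounded_op_compose[OF \<phi>op H.m_bounded_op_right] st in\<phi> wA p)
    show "y \<in> closed_cspan (fst ` {p. word t p})" using y gen_fst_word[OF st(2)] by simp
    show "fst ` {p. word t p} \<subseteq> ?A t" using wA by blast
    fix z assume "z \<in> fst ` {p. word t p}"
    then obtain q where q: "word t q" "z = fst q" by blast
    show "\<phi> (s + t) (mG s t (fst p) z) = mH s t (\<phi> s (fst p)) (\<phi> t z)"
      using \<phi>(2)[OF _ word.mult[OF p q(1)]] \<phi>(2)[OF st(1) p] \<phi>(2)[OF st(2) q(1)] st q(2)
      by (simp add: pair_mult_def)
  qed
  have 2: "\<phi> (s + t) (mG s t x y) = mH s t (\<phi> s x) (\<phi> t y)"
    if st: "s > 0" "t > 0" and x: "x \<in> ?A s" and y: "y \<in> ?A t" for s t x y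
  proof (rule bounded_op_eqI[where f = "\<lambda>x. \<phi> (s + t) (mG s t x y)" and g = "\<lambda>x. mH s t (\<phi> s x) (\<phi> t y)",
        OF clA[OF st(1)]])
    show "bounded_op (?A s) (H (s + t)) (\<lambda>x. \<phi> (s + t) (mG s t x y))"
      using st by (intro bounded_op_compose[OF Gl[OF st y] \<phi>op]) simp
    show "bounded_op (?A s) (H (s + t)) (\<lambda>x. mH s t (\<phi> s x) (\<phi> t y))"
      by (intro bounded_op_compose[OF \<phi>op H.m_bounded_op_left] st in\<phi> y)
    show "x \<in> closed_cspan (fst ` {p. word s p})" using x gen_fst_word[OF st(1)] by simp
    show "fst ` {p. word s p} \<subseteq> ?A s" using wA by blast
    fix z assume "z \<in> fst ` {p. word s p}"
    then obtain p where p: "word s p" "z = fst p" by blast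
    show "\<phi> (s + t) (mG s t z y) = mH s t (\<phi> s z) (\<phi> t y)"
      unfolding p(2) by (rule 1[OF st p(1) y])
  qed
  show thesis by (rule that[OF \<phi>(1,3) 2])
qed

end

end

section \<open>Normalised sections, type I parts and amalgamated products\<close>

context mult_system
begin

text \<open>Norms of a multiplicative family are multiplicative, so dividing by them preserves the
  product law once they are known not to vanish. Thus arbitrary units reduce to normalised
  ones.\<close>

lemma msection_normalise:
  assumes w: "\<And>t. t > 0 \<Longrightarrow> w t \<in> H t" "\<And>s t. s > 0 \<Longrightarrow> t > 0 \<Longrightarrow> w (s + t) = m s t (w s) (w t)"
    and t0: "t0 > 0" "w t0 \<noteq> 0"
  shows "msection (\<lambda>t. complex_of_real (1 / norm (w t)) *\<^sub>C w t)" "\<And>t. t > 0 \<Longrightarrow> w t \<noteq> 0"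
proof -
  have n: "norm (w (s + t)) = norm (w s) * norm (w t)" if "s > 0" "t > 0" for s t
    using w that by (simp add: norm_m)
  have pow: "norm (w (real (Suc k) * s)) = norm (w s) ^ Suc k" if "s > 0" for s k
  proof (induction k)
    case (Suc k)
    have "real (Suc (Suc k)) * s = real (Suc k) * s + s" by (simp add: algebra_simps)
    then have "norm (w (real (Suc (Suc k)) * s)) = norm (w (real (Suc k) * s)) * norm (w s)"
      using n[of "real (Suc k) * s" s] that by simp
    with Suc show ?case by (simp add: mult.commute)
  qed simp
  show nz: "w t \<noteq> 0" if t: "t > 0" for t
  proof -
    \<comment> \<open>Dividing t into k + 1 equal parts s < t0 links t with t0: \<open>w t0\<close>
      has the factor \<open>w s\<close>, which is therefore nonzero, and norm (w t) is a power of
      norm (w s).\<close>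
    obtain k where k: "t / t0 < real (Suc k)"
      using reals_Archimedean2[of "t / t0"] by (metis less_trans lessI of_nat_less_iff)
    define s where "s = t / real (Suc k)"
    have s: "s > 0" "s < t0" using t t0 k by (auto simp: s_def field_simps)
    have "norm (w t0) = norm (w s) * norm (w (t0 - s))" using n[of s "t0 - s"] s by simp
    then have "norm (w s) \<noteq> 0" using t0(2) by auto
    moreover have "norm (w t) = norm (w s) ^ Suc k" using pow[OF s(1), of k] by (simp add: s_def)
    ultimately show ?thesis by (metis norm_eq_zero power_not_zero)
  qed
  let ?c = "\<lambda>t. complex_of_real (1 / norm (w t))"
  have "?c (s + t) *\<^sub>C w (s + t) = m s t (?c s *\<^sub>C w s) (?c t *\<^sub>C w t)" if st: "s > 0" "t > 0" for s t
    using w st closed_csubspaceD(4)[OF fibre_closed]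
    by (simp add: m_scaleC_left m_scaleC_right scaleC_scaleC norm_m mult.commute)
  then show "msection (\<lambda>t. ?c t *\<^sub>C w t)"
    using w(1) nz closed_csubspaceD(4)[OF fibre_closed] by (simp add: msection_def norm_scaleC norm_divide)
qed

end

context tensor_pairing
begin

definition tprod :: "'a set \<Rightarrow> 'b set \<Rightarrow> 'h set" where
  "tprod A B = closed_cspan {tp x y | x y. x \<in> A \<and> y \<in> B}"

lemma tprod_minimal:
  "closed_csubspace S \<Longrightarrow> (\<And>x y. x \<in> A \<Longrightarrow> y \<in> B \<Longrightarrow> tp x y \<in> S) \<Longrightarrow> tprod A B \<subseteq> S"
  unfolding tprod_def by (rule closed_cspan_minimal) auto

lemma tprod_base: "x \<in> A \<Longrightarrow> y \<in> B \<Longrightarrow> tp x y \<in> tprod A B"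
  unfolding tprod_def by (rule closed_cspan_base) blast

text \<open>The type I part enters through its minimality: \<open>right_factor S\<close> is a
  product subsystem of F, and \<open>tensor_section_mem\<close> places every normalised section in
  it.\<close>

lemma tprod_right_type_I_subset:
  assumes sep: E.separable_fibres F.separable_fibres and u: "E.msection u" and v: "F.msection v"
    and S: "H.msub S" and Sv: "\<And>t x. t > 0 \<Longrightarrow> x \<in> E t \<Longrightarrow> tp x (v t) \<in> S t"
    and Su: "\<And>t y. t > 0 \<Longrightarrow> y \<in> F t \<Longrightarrow> tp (u t) y \<in> S t"
    and FI: "\<And>K t. F.msub K \<Longrightarrow> (\<And>w s. F.msection w \<Longrightarrow> s > 0 \<Longrightarrow> w s \<in> K s) \<Longrightarrow> t > 0 \<Longrightarrow> FI t \<subseteq> K t"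
    and t: "t > 0"
  shows "tprod (E t) (FI t) \<subseteq> S t"
proof -
  have units: "w s \<in> right_factor S s" if w: "F.msection w" and s: "s > 0" for w s
    unfolding right_factor_def
    using tensor_section_mem[OF sep S u v w Sv Su s] F.msectionD(1)[OF w s] by simp
  have "FI t \<subseteq> right_factor S t" by (rule FI[OF msub_right_factor[OF S u] _ t]) (rule units)
  then show ?thesis by (intro tprod_minimal H.msubD(1)[OF S t]) (auto simp: right_factor_def)
qed

text \<open>One inclusion is \<open>tprod_right_type_I_subset\<close>, used directly and for the
  flipped pairing. For the other, u and v lie in the type I parts, so the generators
  \<open>tp x (v t)\<close> and \<open>tp (u t) y\<close> belong to the two tensor products.\<close>

lemma gen_type_I_eq:
  assumes sep: E.separable_fibres F.separable_fibres and u: "E.msection u" and v: "F.msection v"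
    and EI: "\<And>K t. E.msub K \<Longrightarrow> (\<And>w s. E.msection w \<Longrightarrow> s > 0 \<Longrightarrow> w s \<in> K s) \<Longrightarrow> t > 0 \<Longrightarrow> EI t \<subseteq> K t"
      "\<And>t. t > 0 \<Longrightarrow> u t \<in> EI t"
    and FI: "\<And>K t. F.msub K \<Longrightarrow> (\<And>w s. F.msection w \<Longrightarrow> s > 0 \<Longrightarrow> w s \<in> K s) \<Longrightarrow> t > 0 \<Longrightarrow> FI t \<subseteq> K t"
      "\<And>t. t > 0 \<Longrightarrow> v t \<in> FI t"
    and t: "t > 0"
  shows "H.gen (\<lambda>t. tprod (E t) (FI t) \<union> tprod (EI t) (F t)) t =
    H.gen (\<lambda>t. (\<lambda>x. tp x (v t)) ` E t \<union> (\<lambda>y. tp (u t) y) ` F t) t"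
    (is "H.gen ?R t = H.gen ?S t")
proof
  note U = E.msectionD(1)[OF u] and V = F.msectionD(1)[OF v]
  have S: "H.msub (H.gen ?S)" using U V tp_in by (intro H.msub_gen) auto
  have Sv: "tp x (v t) \<in> H.gen ?S t" if "t > 0" "x \<in> E t" for x t
    using H.gen_superset[OF that(1), of ?S] that(2) by blast
  have Su: "tp (u t) y \<in> H.gen ?S t" if "t > 0" "y \<in> F t" for y t
    using H.gen_superset[OF that(1), of ?S] that(2) by blast
  interpret fl: tensor_pairing F mF E mE H mH "\<lambda>y x. tp x y" by (rule flip)
  have "fl.tprod (F s) (EI s) = tprod (EI s) (F s)" for s
    unfolding fl.tprod_def tprod_def by (rule arg_cong[where f = closed_cspan]) blast
  moreover have "fl.tprod (F s) (EI s) \<subseteq> H.gen ?S s" if "s > 0" for s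
    by (rule fl.tprod_right_type_I_subset[OF sep(2,1) v u S _ _ _ that]) (fact Su Sv EI(1))+
  moreover have "tprod (E s) (FI s) \<subseteq> H.gen ?S s" if "s > 0" for s
    by (rule tprod_right_type_I_subset[OF sep u v S _ _ _ that]) (fact Su Sv FI(1))+
  ultimately show "H.gen ?R t \<subseteq> H.gen ?S t" by (intro H.gen_minimal[OF S] Un_least) simp_all
  have EIE: "EI s \<subseteq> E s" and FIF: "FI s \<subseteq> F s" if s: "s > 0" for s
  proof -
    show "EI s \<subseteq> E s" by (rule EI(1)[OF E.msub_fibre _ s]) (erule E.msectionD(1))
    show "FI s \<subseteq> F s" by (rule FI(1)[OF F.msub_fibre _ s]) (erule F.msectionD(1))
  qed
  have "tprod (E s) (FI s) \<subseteq> H s" "tprod (EI s) (F s) \<subseteq> H s" if s: "s > 0" for s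
    by (rule tprod_minimal[OF H.fibre_closed[OF s]], use EIE[OF s] FIF[OF s] tp_in[OF s] in blast)+
  then have R: "H.msub (H.gen ?R)" by (intro H.msub_gen Un_least)
  have "?S s \<subseteq> ?R s" if "s > 0" for s
    using EI(2)[OF that] FI(2)[OF that] by (auto intro: tprod_base)
  then show "H.gen ?S t \<subseteq> H.gen ?R t"
    using H.gen_superset[of _ ?R] by (intro H.gen_minimal[OF R]) blast
qed

text \<open>The generators \<open>J t x\<close> and \<open>tp x (v t)\<close> correspond, as do
  \<open>K t y\<close> and \<open>tp (u t) y\<close>. Mixed inner products agree: \<open>JK\<close>
  prescribes exactly the product <x, u> <v, y> that the tensor product yields.\<close>

lemma amalgam_isomorphism:
  fixes G :: "real \<Rightarrow> 'c::chilbert set"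
  assumes G: "mult_system G mG" and u: "E.msection u" and v: "F.msection v"
    and J: "\<And>t. t > 0 \<Longrightarrow> isometry_on (E t) (J t)" "\<And>t. t > 0 \<Longrightarrow> J t ` E t \<subseteq> G t"
      "\<And>s t x y. s > 0 \<Longrightarrow> t > 0 \<Longrightarrow> x \<in> E s \<Longrightarrow> y \<in> E t \<Longrightarrow> J (s + t) (mE s t x y) = mG s t (J s x) (J t y)"
    and K: "\<And>t. t > 0 \<Longrightarrow> isometry_on (F t) (K t)" "\<And>t. t > 0 \<Longrightarrow> K t ` F t \<subseteq> G t"
      "\<And>s t x y. s > 0 \<Longrightarrow> t > 0 \<Longrightarrow> x \<in> F s \<Longrightarrow> y \<in> F t \<Longrightarrow> K (s + t) (mF s t x y) = mG s t (K s x) (K t y)"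
    and JK: "\<And>t x y. t > 0 \<Longrightarrow> x \<in> E t \<Longrightarrow> y \<in> F t \<Longrightarrow> cinner (J t x) (K t y) = cinner x (u t) * cinner (v t) y"
  obtains \<phi> where
    "\<And>t. t > 0 \<Longrightarrow> isometry_on (mult_system.gen G mG (\<lambda>t. J t ` E t \<union> K t ` F t) t) (\<phi> t)"
    "\<And>t. t > 0 \<Longrightarrow> \<phi> t ` mult_system.gen G mG (\<lambda>t. J t ` E t \<union> K t ` F t) t =
      H.gen (\<lambda>t. (\<lambda>x. tp x (v t)) ` E t \<union> (\<lambda>y. tp (u t) y) ` F t) t"
    "\<And>s t x y. s > 0 \<Longrightarrow> t > 0 \<Longrightarrow> x \<in> mult_system.gen G mG (\<lambda>t. J t ` E t \<union> K t ` F t) s \<Longrightarrow>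
      y \<in> mult_system.gen G mG (\<lambda>t. J t ` E t \<union> K t ` F t) t \<Longrightarrow>
      \<phi> (s + t) (mG s t x y) = mH s t (\<phi> s x) (\<phi> t y)"
proof -
  interpret G: mult_system G mG by (rule G)
  interpret GH: two_mult_systems G mG H mH ..
  note U = E.msectionD[OF u] and V = F.msectionD[OF v]
  let ?j = "\<lambda>t x. (J t x, tp x (v t))" and ?k = "\<lambda>t y. (K t y, tp (u t) y)"
  define X where "X t = ?j t ` E t \<union> ?k t ` F t" for t
  have fstX: "(\<lambda>t. fst ` X t) = (\<lambda>t. J t ` E t \<union> K t ` F t)"
    and sndX: "(\<lambda>t. snd ` X t) = (\<lambda>t. (\<lambda>x. tp x (v t)) ` E t \<union> (\<lambda>y. tp (u t) y) ` F t)"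
    by (auto simp: X_def image_Un image_image)
  have jin: "?j t x \<in> G t \<times> H t" if "t > 0" "x \<in> E t" for t x
    using J(2)[OF that(1)] V(1)[OF that(1)] tp_in that by auto
  have kin: "?k t y \<in> G t \<times> H t" if "t > 0" "y \<in> F t" for t y
    using K(2)[OF that(1)] U(1)[OF that(1)] tp_in that by auto
  \<comment> \<open>Both components of a generator carry the same inner product, so passing to pairs
    scales it by 2 and \<open>similarity_bounded_op\<close> applies.\<close>
  have dbl: "cinner (a, b) (a', b') = (1 + 1) * k" if "cinner a a' = k" "cinner b b' = k"
    for a a' :: 'c and b b' :: 'h and k using that by (simp add: cinner_prod_def)
  have jop: "bounded_op (E t) (G t \<times> H t) (?j t)" if t: "t > 0" for t
  proof (rule similarity_bounded_op[OF E.fibre_closed[OF t]])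
    show "?j t ` E t \<subseteq> G t \<times> H t" using jin[OF t] by (intro image_subsetI)
    show "cinner (?j t x) (?j t y) = (1 + 1) * cinner x y" if "x \<in> E t" "y \<in> E t" for x y
      using isometry_onD[OF J(1)[OF t] that] V(3)[OF t] by (intro dbl) (simp_all add: cinner_tp)
  qed
  have kop: "bounded_op (F t) (G t \<times> H t) (?k t)" if t: "t > 0" for t
  proof (rule similarity_bounded_op[OF F.fibre_closed[OF t]])
    show "?k t ` F t \<subseteq> G t \<times> H t" using kin[OF t] by (intro image_subsetI)
    show "cinner (?k t x) (?k t y) = (1 + 1) * cinner x y" if "x \<in> F t" "y \<in> F t" for x y
      using isometry_onD[OF K(1)[OF t] that] U(3)[OF t] by (intro dbl) (simp_all add: cinner_tp)
  qed
  have X_in: "X t \<subseteq> G t \<times> H t" if "t > 0" for t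
    unfolding X_def using jin[OF that] kin[OF that] by (intro Un_least image_subsetI)
  have jk: "cinner (tp x (v t)) (tp (u t) y) = cinner (J t x) (K t y)" if "t > 0" "x \<in> E t" "y \<in> F t" for t x y
    using JK[OF that] by (simp add: cinner_tp)
  have kj: "cinner (tp (u t) y) (tp x (v t)) = cinner (K t y) (J t x)" if "t > 0" "x \<in> E t" "y \<in> F t" for t x y
    using jk[OF that] by (metis cinner_commute)
  have X_cinner: "cinner (snd p) (snd q) = cinner (fst p) (fst q)" if t: "t > 0" and pq: "p \<in> X t" "q \<in> X t" for t p q
    using pq jk[OF t] kj[OF t] isometry_onD[OF J(1)[OF t]] isometry_onD[OF K(1)[OF t]] U(3)[OF t] V(3)[OF t]
    unfolding X_def by (elim UnE imageE) (simp_all add: cinner_tp)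
  \<comment> \<open>As J, K, u and v are all multiplicative, the generator of a product x \<cdot> y
    is the product of the generators of x and y in both components at once. Generators from E and
    from F are split separately.\<close>
  have X_split: "X (s + t) \<subseteq> closed_cspan {GH.pair_mult s t p q | p q. p \<in> X s \<and> q \<in> X t}" (is "_ \<subseteq> ?C")
    if st: "s > 0" "t > 0" for s t
  proof -
    have r: "s + t > 0" using st by simp
    have "E.sprod s t (E s) (E t) \<subseteq> {x \<in> E (s + t). ?j (s + t) x \<in> ?C}"
    proof (rule E.sprod_minimal[OF closed_csubspace_preimage[OF E.fibre_closed[OF r] jop[OF r] closed_csubspace_closed_cspan]])
      fix x y assume xy: "x \<in> E s" "y \<in> E t"
      have "?j (s + t) (mE s t x y) = GH.pair_mult s t (?j s x) (?j t y)"
        using J(3)[OF st xy] mH_tp[OF st xy V(1)[OF st(1)] V(1)[OF st(2)]] V(4)[OF st refl]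
        by (simp add: GH.pair_mult_def)
      moreover have "?j s x \<in> X s" "?j t y \<in> X t" using xy by (auto simp: X_def)
      ultimately have "?j (s + t) (mE s t x y) \<in> ?C" by (intro closed_cspan_base) blast
      then show "mE s t x y \<in> {x \<in> E (s + t). ?j (s + t) x \<in> ?C}" using E.m_in[OF st xy] by simp
    qed
    moreover have "F.sprod s t (F s) (F t) \<subseteq> {x \<in> F (s + t). ?k (s + t) x \<in> ?C}"
    proof (rule F.sprod_minimal[OF closed_csubspace_preimage[OF F.fibre_closed[OF r] kop[OF r] closed_csubspace_closed_cspan]])
      fix x y assume xy: "x \<in> F s" "y \<in> F t"
      have "?k (s + t) (mF s t x y) = GH.pair_mult s t (?k s x) (?k t y)"
        using K(3)[OF st xy] mH_tp[OF st U(1)[OF st(1)] U(1)[OF st(2)] xy] U(4)[OF st refl]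
        by (simp add: GH.pair_mult_def)
      moreover have "?k s x \<in> X s" "?k t y \<in> X t" using xy by (auto simp: X_def)
      ultimately have "?k (s + t) (mF s t x y) \<in> ?C" by (intro closed_cspan_base) blast
      then show "mF s t x y \<in> {x \<in> F (s + t). ?k (s + t) x \<in> ?C}" using F.m_in[OF st xy] by simp
    qed
    ultimately show ?thesis
      unfolding X_def[of "s + t"] E.sprod_fibre[OF st] F.sprod_fibre[OF st]
      by (intro Un_least image_subsetI) auto
  qed
  show thesis
    by (rule GH.generated_isomorphism[of X, unfolded fstX sndX, OF X_in X_cinner X_split that])
qed

end

section \<open>Translation of product systems into multiplicative form\<close>

lemma closed_csubspace_tensor_space: "closed_csubspace (tensor_space H K)"
  by (simp add: tensor_space_def closed_csubspace_closed_cspan)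

lemma tensor_space_base: "x \<in> H \<Longrightarrow> y \<in> K \<Longrightarrow> x \<otimes> y \<in> tensor_space H K"
  unfolding tensor_space_def by (rule closed_cspan_base) blast

lemma tensor_space_minimal:
  "closed_csubspace S \<Longrightarrow> (\<And>x y. x \<in> H \<Longrightarrow> y \<in> K \<Longrightarrow> x \<otimes> y \<in> S) \<Longrightarrow> tensor_space H K \<subseteq> S"
  unfolding tensor_space_def by (rule closed_cspan_minimal) auto

lemma tensor_bounded_op_left: "bounded_op UNIV UNIV (\<lambda>x. x \<otimes> y)"
  by (rule similarity_bounded_op[where k = "cinner y y"]) (auto simp: closed_csubspace_UNIV cinner_tensor)

lemma tensor_bounded_op_right: "bounded_op UNIV UNIV ((\<otimes>) x)"
  by (rule similarity_bounded_op[where k = "cinner x x"]) (auto simp: closed_csubspace_UNIV cinner_tensor)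

lemma tensor_space_closed_cspan:
  "tensor_space (closed_cspan A) (closed_cspan B) = closed_cspan {x \<otimes> y | x y. x \<in> A \<and> y \<in> B}"
proof
  let ?C = "closed_cspan {x \<otimes> y | x y. x \<in> A \<and> y \<in> B}"
  show "tensor_space (closed_cspan A) (closed_cspan B) \<subseteq> ?C"
  proof (rule tensor_space_minimal[OF closed_csubspace_closed_cspan])
    fix x y assume x: "x \<in> closed_cspan A" and y: "y \<in> closed_cspan B"
    have "a \<otimes> y \<in> ?C" if "a \<in> A" for a
    proof -
      have "closed_cspan B \<subseteq> {y \<in> UNIV. a \<otimes> y \<in> ?C}"
        using that by (intro closed_cspan_minimal closed_csubspace_preimage[OF closed_csubspace_UNIV
            tensor_bounded_op_right closed_csubspace_closed_cspan]) (auto intro: closed_cspan_base)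
      with y show ?thesis by blast
    qed
    then have "closed_cspan A \<subseteq> {x \<in> UNIV. x \<otimes> y \<in> ?C}"
      by (intro closed_cspan_minimal closed_csubspace_preimage[OF closed_csubspace_UNIV
          tensor_bounded_op_left closed_csubspace_closed_cspan]) auto
    with x show "x \<otimes> y \<in> ?C" by blast
  qed
  show "?C \<subseteq> tensor_space (closed_cspan A) (closed_cspan B)"
    unfolding tensor_space_def by (rule closed_cspan_mono) (auto intro: closed_cspan_base)
qed

lemma unitary_op_isometry_on: "unitary_op H K f \<Longrightarrow> isometry_on H f"
  by (simp add: unitary_op_def isometry_on_def)

lemma unitary_opI: "closed_csubspace H \<Longrightarrow> isometry_on H f \<Longrightarrow> f ` H = K \<Longrightarrow> unitary_op H K f"
  by (simp add: unitary_op_def isometry_on_clinear_on isometry_onD)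

lemma isometry_on_subset: "isometry_on H f \<Longrightarrow> K \<subseteq> H \<Longrightarrow> isometry_on K f"
  by (auto simp: isometry_on_def)

lemma isometry_on_compose: "isometry_on H f \<Longrightarrow> f ` H \<subseteq> K \<Longrightarrow> isometry_on K g \<Longrightarrow> isometry_on H (\<lambda>x. g (f x))"
  by (simp add: isometry_on_def image_subset_iff)

lemma isometry_on_eq_imp_eq:
  assumes H: "closed_csubspace H" and f: "isometry_on H f" and xy: "x \<in> H" "y \<in> H" "f x = f y"
  shows "x = y"
proof -
  have "norm (x - y) = norm (f (x - y))"
    using isometry_on_norm[OF f closed_csubspaceD(5)[OF H xy(1,2)]] by simp
  also have "f (x - y) = 0"
    using clinear_on_diff[OF H isometry_on_clinear_on[OF H f] xy(1,2)] xy(3) by simp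
  finally show ?thesis by simp
qed

section \<open>Operators specified on elementary tensors\<close>

lemma adjoint_op_eqI:
  assumes H: "closed_csubspace H" and x: "x \<in> H" "\<And>z. z \<in> H \<Longrightarrow> cinner x z = cinner y (f z)"
  shows "adjoint_op H f y = x"
  unfolding adjoint_op_def
proof (rule the_equality)
  show "x \<in> H \<and> (\<forall>z\<in>H. cinner x z = cinner y (f z))" using x by blast
  fix x' assume x': "x' \<in> H \<and> (\<forall>z\<in>H. cinner x' z = cinner y (f z))"
  then have "x' - x \<in> H" using closed_csubspaceD(5)[OF H] x(1) by blast
  then have "cinner (x' - x) (x' - x) = 0"
    using x' x(2) by (subst cinner_diff_left) simp
  then show "x' = x" by (simp add: cinner_self_eq_0)
qed

text \<open>A bounded operator on \<open>tensor_space H K\<close> is fixed by its values on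
  elementary tensors, so any witness computes the chosen operator. This covers factors that are not
  isometric, such as rank-one maps.\<close>

lemma tensor_opI:
  assumes "bounded_op (tensor_space H K) UNIV T" "\<And>x y. x \<in> H \<Longrightarrow> y \<in> K \<Longrightarrow> T (x \<otimes> y) = f x \<otimes> g y"
    and z: "z \<in> tensor_space H K"
  shows "tensor_op H K f g z = T z"
proof -
  have "bounded_op (tensor_space H K) UNIV (tensor_op H K f g) \<and>
    (\<forall>x\<in>H. \<forall>y\<in>K. tensor_op H K f g (x \<otimes> y) = f x \<otimes> g y)"
    unfolding tensor_op_def by (rule someI[of _ T]) (use assms in blast)
  then have *: "bounded_op (tensor_space H K) UNIV (tensor_op H K f g)"
    "\<And>x y. x \<in> H \<Longrightarrow> y \<in> K \<Longrightarrow> tensor_op H K f g (x \<otimes> y) = f x \<otimes> g y" by blast+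
  show ?thesis
  proof (rule bounded_op_eqI[OF closed_csubspace_tensor_space *(1) assms(1)])
    show "z \<in> closed_cspan {x \<otimes> y | x y. x \<in> H \<and> y \<in> K}" using z by (simp add: tensor_space_def)
  qed (use tensor_space_base *(2) assms(2) in fastforce)+
qed

text \<open>Shared by the tensor product of isometries, the associator and the middle flip.
  Existence behind the choice is \<open>isometry_extension\<close> of the prescribed values R;
  boundedness and totality make the choice unique on W, so it inherits the isometry
  property.\<close>

lemma Eps_isometry:
  fixes R :: "('a::chilbert \<times> 'b::chilbert) set"
  assumes R: "\<And>a b a' b'. (a, b) \<in> R \<Longrightarrow> (a', b') \<in> R \<Longrightarrow> cinner b b' = cinner a a'"
    and W: "closed_cspan (fst ` R) = W"
    and Q: "\<And>T. Q T \<longleftrightarrow> bounded_op W UNIV T \<and> (\<forall>p\<in>R. T (fst p) = snd p)"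
  shows "isometry_on W (Eps Q)" "p \<in> R \<Longrightarrow> Eps Q (fst p) = snd p" "Eps Q ` W = closed_cspan (snd ` R)"
proof -
  have clW: "closed_csubspace W" unfolding W[symmetric] by (rule closed_csubspace_closed_cspan)
  obtain T where T: "isometry_on W T" "\<And>a b. (a, b) \<in> R \<Longrightarrow> T a = b" "T ` W = closed_cspan (snd ` R)"
    by (rule isometry_extension[of R, OF R, unfolded W]) iprover+
  have "Q T" unfolding Q using isometry_on_bounded_op[OF clW T(1) subset_UNIV] T(2) by simp
  then have "Q (Eps Q)" by (rule someI[of Q T])
  then have E: "bounded_op W UNIV (Eps Q)" "\<And>p. p \<in> R \<Longrightarrow> Eps Q (fst p) = snd p" unfolding Q by blast+
  have eq: "Eps Q w = T w" if w: "w \<in> W" for w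
  proof (rule bounded_op_eqI[where f = "Eps Q" and g = T, OF clW E(1)
        isometry_on_bounded_op[OF clW T(1) subset_UNIV]])
    show "fst ` R \<subseteq> W" unfolding W[symmetric] by (rule closed_cspan_superset)
    show "w \<in> closed_cspan (fst ` R)" unfolding W by (rule w)
    show "Eps Q x = T x" if "x \<in> fst ` R" for x using that E(2) T(2) by fastforce
  qed
  show "isometry_on W (Eps Q)" using T(1) eq by (simp add: isometry_on_def)
  show "Eps Q ` W = closed_cspan (snd ` R)" unfolding T(3)[symmetric] using eq by (intro image_cong refl)
  show "p \<in> R \<Longrightarrow> Eps Q (fst p) = snd p" by (rule E(2))
qed

lemma tensor_op_isometry:
  assumes f: "isometry_on H f" and g: "isometry_on K g"
  shows "isometry_on (tensor_space H K) (tensor_op H K f g)"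
    and "x \<in> H \<Longrightarrow> y \<in> K \<Longrightarrow> tensor_op H K f g (x \<otimes> y) = f x \<otimes> g y"
    and "tensor_op H K f g ` tensor_space H K = tensor_space (f ` H) (g ` K)"
proof -
  let ?R = "{(x \<otimes> y, f x \<otimes> g y) | x y. x \<in> H \<and> y \<in> K}"
  have fstR: "closed_cspan (fst ` ?R) = tensor_space H K"
    unfolding tensor_space_def by (rule arg_cong[where f = closed_cspan]) force
  have sndR: "closed_cspan (snd ` ?R) = tensor_space (f ` H) (g ` K)"
    unfolding tensor_space_def by (rule arg_cong[where f = closed_cspan]) force
  have R: "cinner b b' = cinner a a'" if "(a, b) \<in> ?R" "(a', b') \<in> ?R" for a b a' b'
    using that isometry_onD[OF f] isometry_onD[OF g] by (auto simp: cinner_tensor)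
  have "bounded_op (tensor_space H K) UNIV T \<and> (\<forall>x\<in>H. \<forall>y\<in>K. T (x \<otimes> y) = f x \<otimes> g y) \<longleftrightarrow>
      bounded_op (tensor_space H K) UNIV T \<and> (\<forall>p\<in>?R. T (fst p) = snd p)" for T
    by fastforce
  note E = Eps_isometry[of ?R, OF R fstR this, folded tensor_op_def]
  show "isometry_on (tensor_space H K) (tensor_op H K f g)" by (rule E(1))
  show "tensor_op H K f g ` tensor_space H K = tensor_space (f ` H) (g ` K)" using E(3) unfolding sndR .
  show "tensor_op H K f g (x \<otimes> y) = f x \<otimes> g y" if "x \<in> H" "y \<in> K"
    using E(2)[of "(x \<otimes> y, f x \<otimes> g y)"] that by auto
qed

lemma tensor_space_UNIV: "tensor_space UNIV UNIV = (UNIV :: ('a::chilbert, 'b::chilbert) htensor set)"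
proof -
  have "{x \<otimes> y | x y. x \<in> (UNIV :: 'a set) \<and> y \<in> (UNIV :: 'b set)} = range (\<lambda>(x, y). x \<otimes> y)" by auto
  then show ?thesis unfolding tensor_space_def using tensor_total by simp
qed

lemma tensor3_total:
  "closed_cspan {(x \<otimes> y) \<otimes> z | x y z. True} = (UNIV :: (('a::chilbert, 'b::chilbert) htensor, 'c::chilbert) htensor set)"
proof -
  have "UNIV = tensor_space (tensor_space (UNIV :: 'a set) (UNIV :: 'b set)) (closed_cspan (UNIV :: 'c set))"
    by (simp add: tensor_space_UNIV closed_cspan_id closed_csubspace_UNIV)
  also have "\<dots> = closed_cspan {(x \<otimes> y) \<otimes> z | x y z. True}"
    unfolding tensor_space_def[of "UNIV :: 'a set"] tensor_space_closed_cspan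
    by (rule arg_cong[where f = closed_cspan]) blast
  finally show ?thesis ..
qed

lemma tensor4_total:
  "closed_cspan {(w \<otimes> x) \<otimes> (y \<otimes> z) | w x y z. True} =
    (UNIV :: (('a::chilbert, 'b::chilbert) htensor, ('c::chilbert, 'd::chilbert) htensor) htensor set)"
proof -
  have "UNIV = tensor_space (tensor_space (UNIV :: 'a set) (UNIV :: 'b set)) (tensor_space (UNIV :: 'c set) (UNIV :: 'd set))"
    by (simp add: tensor_space_UNIV)
  also have "\<dots> = closed_cspan {(w \<otimes> x) \<otimes> (y \<otimes> z) | w x y z. True}"
    unfolding tensor_space_def[of "UNIV :: 'a set"] tensor_space_def[of "UNIV :: 'c set"] tensor_space_closed_cspan
    by (rule arg_cong[where f = closed_cspan]) blast
  finally show ?thesis ..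
qed

lemma tensor_assoc:
  fixes x :: "'a::chilbert" and y :: "'b::chilbert" and z :: "'c::chilbert"
  shows "isometry_on UNIV (tensor_assoc :: (('a, 'b) htensor, 'c) htensor \<Rightarrow> _)"
    and "tensor_assoc ((x \<otimes> y) \<otimes> z) = x \<otimes> (y \<otimes> z)"
proof -
  let ?R = "{((x \<otimes> y) \<otimes> z, x \<otimes> (y \<otimes> z)) | (x :: 'a) (y :: 'b) (z :: 'c). True}"
  have fstR: "closed_cspan (fst ` ?R) = UNIV"
    unfolding tensor3_total[symmetric] by (rule arg_cong[where f = closed_cspan]) force
  have R: "cinner b b' = cinner a a'" if "(a, b) \<in> ?R" "(a', b') \<in> ?R" for a b a' b'
    using that by (auto simp: cinner_tensor)
  have "bounded_op UNIV UNIV T \<and> (\<forall>(x :: 'a) (y :: 'b) (z :: 'c). T ((x \<otimes> y) \<otimes> z) = x \<otimes> (y \<otimes> z)) \<longleftrightarrow>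
      bounded_op UNIV UNIV T \<and> (\<forall>p\<in>?R. T (fst p) = snd p)" for T
    by fastforce
  note E = Eps_isometry[of ?R, OF R fstR this, folded tensor_assoc_def]
  show "isometry_on UNIV (tensor_assoc :: (('a, 'b) htensor, 'c) htensor \<Rightarrow> _)" by (rule E(1))
  show "tensor_assoc ((x \<otimes> y) \<otimes> z) = x \<otimes> (y \<otimes> z)"
    using E(2)[of "((x \<otimes> y) \<otimes> z, x \<otimes> (y \<otimes> z))"] by auto
qed

lemma middle_flip:
  fixes w :: "'a::chilbert" and x :: "'b::chilbert" and y :: "'c::chilbert" and z :: "'d::chilbert"
  shows "isometry_on UNIV (middle_flip :: (('a, 'b) htensor, ('c, 'd) htensor) htensor \<Rightarrow> _)"
    and "middle_flip ((w \<otimes> x) \<otimes> (y \<otimes> z)) = (w \<otimes> y) \<otimes> (x \<otimes> z)"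
proof -
  let ?R = "{((w \<otimes> x) \<otimes> (y \<otimes> z), (w \<otimes> y) \<otimes> (x \<otimes> z)) | (w :: 'a) (x :: 'b) (y :: 'c) (z :: 'd). True}"
  have fstR: "closed_cspan (fst ` ?R) = UNIV"
    unfolding tensor4_total[symmetric] by (rule arg_cong[where f = closed_cspan]) force
  have R: "cinner b b' = cinner a a'" if "(a, b) \<in> ?R" "(a', b') \<in> ?R" for a b a' b'
    using that by (auto simp: cinner_tensor)
  have "bounded_op UNIV UNIV T \<and>
      (\<forall>(w :: 'a) (x :: 'b) (y :: 'c) (z :: 'd). T ((w \<otimes> x) \<otimes> (y \<otimes> z)) = (w \<otimes> y) \<otimes> (x \<otimes> z)) \<longleftrightarrow>
      bounded_op UNIV UNIV T \<and> (\<forall>p\<in>?R. T (fst p) = snd p)" for T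
    by fastforce
  note E = Eps_isometry[of ?R, OF R fstR this, folded middle_flip_def]
  show "isometry_on UNIV (middle_flip :: (('a, 'b) htensor, ('c, 'd) htensor) htensor \<Rightarrow> _)" by (rule E(1))
  show "middle_flip ((w \<otimes> x) \<otimes> (y \<otimes> z)) = (w \<otimes> y) \<otimes> (x \<otimes> z)"
    using E(2)[of "((w \<otimes> x) \<otimes> (y \<otimes> z), (w \<otimes> y) \<otimes> (x \<otimes> z))"] by auto
qed

text \<open>Unitarity without coassociativity. It already allows \<open>pmult\<close> to be
  evaluated, so that coassociativity can be verified afterwards as associativity of
  products.\<close>

locale comult_system =
  fixes P :: "'a::chilbert psystem"
  assumes fibre_closed: "t > 0 \<Longrightarrow> closed_csubspace (fibre P t)"
    and comult_unitary: "s > 0 \<Longrightarrow> t > 0 \<Longrightarrow>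
      unitary_op (fibre P (s + t)) (tensor_space (fibre P s) (fibre P t)) (comult P s t)"
begin

lemma comult_isometry: "s > 0 \<Longrightarrow> t > 0 \<Longrightarrow> isometry_on (fibre P (s + t)) (comult P s t)"
  using comult_unitary unitary_op_isometry_on by blast

lemma comult_image:
  "s > 0 \<Longrightarrow> t > 0 \<Longrightarrow> comult P s t ` fibre P (s + t) = tensor_space (fibre P s) (fibre P t)"
  using comult_unitary by (auto simp: unitary_op_def)

lemma comult_inject:
  "\<lbrakk>s > 0; t > 0; x \<in> fibre P (s + t); y \<in> fibre P (s + t); comult P s t x = comult P s t y\<rbrakk> \<Longrightarrow> x = y"
  using isometry_on_eq_imp_eq[OF fibre_closed comult_isometry] by simp

lemma pmult_eqI:
  assumes st: "s > 0" "t > 0" and z: "z \<in> fibre P (s + t)" "comult P s t z = x \<otimes> y"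
  shows "pmult P s t x y = z"
  unfolding pmult_def z(2)[symmetric]
  using st isometry_onD[OF comult_isometry[OF st]] z(1) by (intro adjoint_op_eqI fibre_closed) auto

lemma pmult:
  assumes st: "s > 0" "t > 0" and xy: "x \<in> fibre P s" "y \<in> fibre P t"
  shows "pmult P s t x y \<in> fibre P (s + t)" "comult P s t (pmult P s t x y) = x \<otimes> y"
proof -
  obtain z where z: "z \<in> fibre P (s + t)" "comult P s t z = x \<otimes> y"
    using tensor_space_base[OF xy] unfolding comult_image[OF st, symmetric] by (metis imageE)
  with pmult_eqI[OF st z] show "pmult P s t x y \<in> fibre P (s + t)" "comult P s t (pmult P s t x y) = x \<otimes> y"
    by auto
qed

lemma cinner_pmult:
  "\<lbrakk>s > 0; t > 0; x \<in> fibre P s; x' \<in> fibre P s; y \<in> fibre P t; y' \<in> fibre P t\<rbrakk> \<Longrightarrow>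
    cinner (pmult P s t x y) (pmult P s t x' y') = cinner x x' * cinner y y'"
  by (simp add: pmult cinner_tensor flip: isometry_onD[OF comult_isometry])

text \<open>On products of fibre vectors the structure map undoes \<open>pmult\<close>, and being
  isometric it commutes with closed spans; so spans of products correspond to tensor products of
  subspaces.\<close>

lemma comult_image_closed_cspan_pmult:
  assumes st: "s > 0" "t > 0" and AB: "A \<subseteq> fibre P s" "B \<subseteq> fibre P t"
  shows "comult P s t ` closed_cspan {pmult P s t x y | x y. x \<in> A \<and> y \<in> B} = tensor_space A B"
proof -
  have "{pmult P s t x y | x y. x \<in> A \<and> y \<in> B} \<subseteq> fibre P (s + t)" using pmult(1)[OF st] AB by blast
  then have "comult P s t ` closed_cspan {pmult P s t x y | x y. x \<in> A \<and> y \<in> B} =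
      closed_cspan (comult P s t ` {pmult P s t x y | x y. x \<in> A \<and> y \<in> B})"
    using st by (intro isometry_on_image_closed_cspan[OF fibre_closed comult_isometry]) auto
  also have "comult P s t ` {pmult P s t x y | x y. x \<in> A \<and> y \<in> B} = {x \<otimes> y | x y. x \<in> A \<and> y \<in> B}"
  proof (rule set_eqI)
    fix z
    have *: "comult P s t (pmult P s t x y) = x \<otimes> y" if "x \<in> A" "y \<in> B" for x y
      using pmult(2)[OF st] AB that by blast
    show "z \<in> comult P s t ` {pmult P s t x y | x y. x \<in> A \<and> y \<in> B} \<longleftrightarrow> z \<in> {x \<otimes> y | x y. x \<in> A \<and> y \<in> B}"
    proof
      assume "z \<in> {x \<otimes> y | x y. x \<in> A \<and> y \<in> B}"
      then obtain x y where "z = x \<otimes> y" "x \<in> A" "y \<in> B" by blast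
      then show "z \<in> comult P s t ` {pmult P s t x y | x y. x \<in> A \<and> y \<in> B}"
        using * by (intro image_eqI[of _ _ "pmult P s t x y"]) auto
    qed (use * in auto)
  qed
  finally show ?thesis by (simp add: tensor_space_def)
qed

lemma closed_cspan_pmult:
  assumes st: "s > 0" "t > 0"
  shows "closed_cspan {pmult P s t x y | x y. x \<in> fibre P s \<and> y \<in> fibre P t} = fibre P (s + t)"
proof -
  let ?X = "{pmult P s t x y | x y. x \<in> fibre P s \<and> y \<in> fibre P t}"
  have sub: "closed_cspan ?X \<subseteq> fibre P (s + t)"
    using st pmult(1)[OF st] by (intro closed_cspan_minimal fibre_closed) auto
  have "comult P s t ` closed_cspan ?X = comult P s t ` fibre P (s + t)"
    unfolding comult_image_closed_cspan_pmult[OF st subset_refl subset_refl] comult_image[OF st] ..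
  then show ?thesis
    using inj_on_image_eq_iff[OF inj_onI[of "fibre P (s + t)" "comult P s t"] sub subset_refl]
      comult_inject[OF st] by blast
qed

lemma pmult_bounded_op_left:
  "\<lbrakk>s > 0; t > 0; y \<in> fibre P t\<rbrakk> \<Longrightarrow> bounded_op (fibre P s) (fibre P (s + t)) (\<lambda>x. pmult P s t x y)"
  by (rule similarity_bounded_op[where k = "cinner y y"]) (auto simp: fibre_closed pmult cinner_pmult)

lemma pmult_bounded_op_right:
  "\<lbrakk>s > 0; t > 0; x \<in> fibre P s\<rbrakk> \<Longrightarrow> bounded_op (fibre P t) (fibre P (s + t)) (pmult P s t x)"
  by (rule similarity_bounded_op[where k = "cinner x x"]) (auto simp: fibre_closed pmult cinner_pmult)

text \<open>Together with \<open>coassoc_right\<close> this evaluates the two sides of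
  coassociativity on a threefold product, bracketed to suit each side; both return x \<otimes> (y
  \<otimes> z).\<close>

lemma coassoc_left:
  assumes rst: "r > 0" "s > 0" "t > 0"
  defines "L \<equiv> \<lambda>w. tensor_op (fibre P r) (fibre P (s + t)) id (comult P s t) (comult P r (s + t) w)"
  shows "isometry_on (fibre P (r + s + t)) L"
    and "x \<in> fibre P r \<Longrightarrow> y \<in> fibre P s \<Longrightarrow> z \<in> fibre P t \<Longrightarrow>
      L (pmult P r (s + t) x (pmult P s t y z)) = x \<otimes> (y \<otimes> z)"
proof -
  have id: "isometry_on (fibre P r) id" by (simp add: isometry_on_def)
  have st: "s + t > 0" using rst by simp
  note T = tensor_op_isometry[OF id comult_isometry[OF rst(2,3)]]
  show "isometry_on (fibre P (r + s + t)) L"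
    unfolding L_def add.assoc
    by (rule isometry_on_compose[OF comult_isometry[OF rst(1) st] _ T(1)])
      (simp add: comult_image[OF rst(1) st])
  show "L (pmult P r (s + t) x (pmult P s t y z)) = x \<otimes> (y \<otimes> z)"
    if "x \<in> fibre P r" "y \<in> fibre P s" "z \<in> fibre P t"
    unfolding L_def using that pmult rst st T(2) by simp
qed

lemma coassoc_right:
  assumes rst: "r > 0" "s > 0" "t > 0"
  defines "R \<equiv> \<lambda>w. tensor_assoc (tensor_op (fibre P (r + s)) (fibre P t) (comult P r s) id (comult P (r + s) t w))"
  shows "isometry_on (fibre P (r + s + t)) R"
    and "x \<in> fibre P r \<Longrightarrow> y \<in> fibre P s \<Longrightarrow> z \<in> fibre P t \<Longrightarrow>
      R (pmult P (r + s) t (pmult P r s x y) z) = x \<otimes> (y \<otimes> z)"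
proof -
  have id: "isometry_on (fibre P t) id" by (simp add: isometry_on_def)
  have rs: "r + s > 0" using rst by simp
  note T = tensor_op_isometry[OF comult_isometry[OF rst(1,2)] id]
  have "isometry_on (fibre P (r + s + t)) (\<lambda>w. tensor_op (fibre P (r + s)) (fibre P t) (comult P r s) id (comult P (r + s) t w))"
    by (rule isometry_on_compose[OF comult_isometry[OF rs rst(3)] _ T(1)])
      (simp add: comult_image[OF rs rst(3)])
  then show "isometry_on (fibre P (r + s + t)) R"
    unfolding R_def by (rule isometry_on_compose[OF _ subset_UNIV tensor_assoc(1)])
  show "R (pmult P (r + s) t (pmult P r s x y) z) = x \<otimes> (y \<otimes> z)"
    if "x \<in> fibre P r" "y \<in> fibre P s" "z \<in> fibre P t"
    unfolding R_def using that pmult rst rs T(2) tensor_assoc(2) by simp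
qed

text \<open>Both sides of coassociativity are isometries into one triple tensor product. Injectivity
  of the left one yields associativity; conversely they agree on threefold products, which are
  total.\<close>

lemma product_system_iff_assoc:
  "product_system P \<longleftrightarrow> (\<forall>r>0. \<forall>s>0. \<forall>t>0. \<forall>x\<in>fibre P r. \<forall>y\<in>fibre P s. \<forall>z\<in>fibre P t.
     pmult P (r + s) t (pmult P r s x y) z = pmult P r (s + t) x (pmult P s t y z))" (is "_ \<longleftrightarrow> ?assoc")
proof
  assume P: "product_system P"
  show ?assoc
  proof (intro allI impI ballI)
    fix r s t :: real and x y z
    assume rst: "r > 0" "s > 0" "t > 0" and xyz: "x \<in> fibre P r" "y \<in> fibre P s" "z \<in> fibre P t"
    let ?w = "pmult P (r + s) t (pmult P r s x y) z" and ?w' = "pmult P r (s + t) x (pmult P s t y z)"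
    have w: "?w \<in> fibre P (r + s + t)" using rst xyz by (intro pmult) auto
    have w': "?w' \<in> fibre P (r + s + t)"
      unfolding add.assoc using rst xyz by (intro pmult) auto
    have pos: "r + s + t > 0" using rst by simp
    let ?L = "\<lambda>w. tensor_op (fibre P r) (fibre P (s + t)) id (comult P s t) (comult P r (s + t) w)"
    have "?L ?w = tensor_assoc (tensor_op (fibre P (r + s)) (fibre P t) (comult P r s) id (comult P (r + s) t ?w))"
      using P rst w unfolding product_system_def by blast
    also have "\<dots> = ?L ?w'"
      unfolding coassoc_right(2)[OF rst xyz] coassoc_left(2)[OF rst xyz] ..
    finally show "?w = ?w'"
      by (rule isometry_on_eq_imp_eq[OF fibre_closed[OF pos] coassoc_left(1)[OF rst] w w'])
  qed
next
  assume a: ?assoc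
  show "product_system P"
    unfolding product_system_def
  proof (intro conjI allI impI ballI)
    fix r s t :: real and w assume rst: "r > 0" "s > 0" "t > 0" and w: "w \<in> fibre P (r + s + t)"
    have pos: "r + s + t > 0" "r + s > 0" using rst by auto
    let ?L = "\<lambda>w. tensor_op (fibre P r) (fibre P (s + t)) id (comult P s t) (comult P r (s + t) w)"
    let ?R = "\<lambda>w. tensor_assoc (tensor_op (fibre P (r + s)) (fibre P t) (comult P r s) id (comult P (r + s) t w))"
    note Lop = isometry_on_bounded_op[OF fibre_closed[OF pos(1)] coassoc_left(1)[OF rst] subset_UNIV]
    note Rop = isometry_on_bounded_op[OF fibre_closed[OF pos(1)] coassoc_right(1)[OF rst] subset_UNIV]
    have "?L (pmult P (r + s) t p z) = ?R (pmult P (r + s) t p z)"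
      if p: "p \<in> fibre P (r + s)" and z: "z \<in> fibre P t" for p z
    proof (rule bounded_op_eqI[where f = "\<lambda>p. ?L (pmult P (r + s) t p z)" and g = "\<lambda>p. ?R (pmult P (r + s) t p z)",
          OF fibre_closed[OF pos(2)] bounded_op_compose[OF _ Lop] bounded_op_compose[OF _ Rop]])
      show "bounded_op (fibre P (r + s)) (fibre P (r + s + t)) (\<lambda>p. pmult P (r + s) t p z)"
        by (rule pmult_bounded_op_left[OF pos(2) rst(3) z])
      then show "bounded_op (fibre P (r + s)) (fibre P (r + s + t)) (\<lambda>p. pmult P (r + s) t p z)" .
      show "p \<in> closed_cspan {pmult P r s x y | x y. x \<in> fibre P r \<and> y \<in> fibre P s}"
        using p closed_cspan_pmult[OF rst(1,2)] by simp
      show "{pmult P r s x y | x y. x \<in> fibre P r \<and> y \<in> fibre P s} \<subseteq> fibre P (r + s)"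
        using pmult(1)[OF rst(1,2)] by blast
      fix q assume "q \<in> {pmult P r s x y | x y. x \<in> fibre P r \<and> y \<in> fibre P s}"
      then obtain x y where q: "q = pmult P r s x y" and xy: "x \<in> fibre P r" "y \<in> fibre P s" by blast
      have "pmult P (r + s) t q z = pmult P r (s + t) x (pmult P s t y z)"
        using a rst xy z q by blast
      then show "?L (pmult P (r + s) t q z) = ?R (pmult P (r + s) t q z)"
        using coassoc_left(2)[OF rst xy z] coassoc_right(2)[OF rst xy z] q by simp
    qed
    note LR = this
    show "?L w = ?R w"
    proof (rule bounded_op_eqI[OF fibre_closed[OF pos(1)] Lop Rop])
      show "w \<in> closed_cspan {pmult P (r + s) t p z | p z. p \<in> fibre P (r + s) \<and> z \<in> fibre P t}"
        using w closed_cspan_pmult[OF pos(2) rst(3)] by simp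
      show "{pmult P (r + s) t p z | p z. p \<in> fibre P (r + s) \<and> z \<in> fibre P t} \<subseteq> fibre P (r + s + t)"
        using pmult(1)[OF pos(2) rst(3)] by blast
    qed (use LR in blast)
  qed (simp_all add: fibre_closed comult_unitary)
qed

text \<open>For tensor systems associativity is visible on elementary tensors. Products are bounded
  in each variable, so the arguments are extended to the fibres one after the other, the last one
  first.\<close>

lemma product_system_if_assoc_total:
  assumes A: "\<And>t. t > 0 \<Longrightarrow> closed_cspan (A t) = fibre P t"
    and assoc: "\<And>r s t x y z. r > 0 \<Longrightarrow> s > 0 \<Longrightarrow> t > 0 \<Longrightarrow> x \<in> A r \<Longrightarrow> y \<in> A s \<Longrightarrow> z \<in> A t \<Longrightarrow>
      pmult P (r + s) t (pmult P r s x y) z = pmult P r (s + t) x (pmult P s t y z)"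
  shows "product_system P"
  unfolding product_system_iff_assoc
proof (intro allI impI ballI)
  fix r s t :: real and x y z
  assume rst: "r > 0" "s > 0" "t > 0" and xyz: "x \<in> fibre P r" "y \<in> fibre P s" "z \<in> fibre P t"
  have pos: "r + s > 0" "s + t > 0" using rst by auto
  have Asub: "A t \<subseteq> fibre P t" if "t > 0" for t using A[OF that] closed_cspan_superset[of "A t"] by simp
  have 1: "pmult P (r + s) t (pmult P r s x y) z = pmult P r (s + t) x (pmult P s t y z)"
    if x: "x \<in> A r" and y: "y \<in> A s" and z: "z \<in> fibre P t" for x y z
  proof (rule bounded_op_eqI[where f = "pmult P (r + s) t (pmult P r s x y)" and g = "\<lambda>z. pmult P r (s + t) x (pmult P s t y z)",
        OF fibre_closed[OF rst(3)]])
    have xy: "x \<in> fibre P r" "y \<in> fibre P s" using x y Asub rst by auto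
    show "bounded_op (fibre P t) (fibre P (r + s + t)) (pmult P (r + s) t (pmult P r s x y))"
      by (intro pmult_bounded_op_right pmult pos rst xy)
    show "bounded_op (fibre P t) (fibre P (r + (s + t))) (\<lambda>z. pmult P r (s + t) x (pmult P s t y z))"
      by (intro bounded_op_compose[OF pmult_bounded_op_right pmult_bounded_op_right] pos rst xy)
    show "z \<in> closed_cspan (A t)" using z A[OF rst(3)] by simp
  qed (use Asub rst assoc x y in auto)
  have 2: "pmult P (r + s) t (pmult P r s x y) z = pmult P r (s + t) x (pmult P s t y z)"
    if x: "x \<in> A r" and y: "y \<in> fibre P s" and z: "z \<in> fibre P t" for x y z
  proof (rule bounded_op_eqI[where f = "\<lambda>y. pmult P (r + s) t (pmult P r s x y) z" and g = "\<lambda>y. pmult P r (s + t) x (pmult P s t y z)",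
        OF fibre_closed[OF rst(2)]])
    have xr: "x \<in> fibre P r" using x Asub rst by auto
    show "bounded_op (fibre P s) (fibre P (r + s + t)) (\<lambda>y. pmult P (r + s) t (pmult P r s x y) z)"
      by (rule bounded_op_compose[OF pmult_bounded_op_right pmult_bounded_op_left]) (intro pos rst xr z)+
    show "bounded_op (fibre P s) (fibre P (r + (s + t))) (\<lambda>y. pmult P r (s + t) x (pmult P s t y z))"
      by (rule bounded_op_compose[OF pmult_bounded_op_left pmult_bounded_op_right]) (intro pos rst xr z)+
    show "y \<in> closed_cspan (A s)" using y A[OF rst(2)] by simp
  qed (use Asub rst 1 x z in auto)
  show "pmult P (r + s) t (pmult P r s x y) z = pmult P r (s + t) x (pmult P s t y z)"
  proof (rule bounded_op_eqI[where f = "\<lambda>x. pmult P (r + s) t (pmult P r s x y) z" and g = "\<lambda>x. pmult P r (s + t) x (pmult P s t y z)",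
        OF fibre_closed[OF rst(1)]])
    show "bounded_op (fibre P r) (fibre P (r + s + t)) (\<lambda>x. pmult P (r + s) t (pmult P r s x y) z)"
      by (rule bounded_op_compose[OF pmult_bounded_op_left pmult_bounded_op_left]) (intro pos rst xyz)+
    show "bounded_op (fibre P r) (fibre P (r + (s + t))) (\<lambda>x. pmult P r (s + t) x (pmult P s t y z))"
      by (intro pmult_bounded_op_left pmult pos rst xyz)
    show "x \<in> closed_cspan (A r)" using xyz A[OF rst(1)] by simp
  qed (use Asub rst 2 xyz in auto)
qed

end

section \<open>Dictionary between structure maps and products\<close>

lemma product_system_comult_system: "product_system P \<Longrightarrow> comult_system P"
  by (simp add: product_system_def comult_system_def)

lemma product_system_mult_system:
  assumes P: "product_system P"
  shows "mult_system (fibre P) (pmult P)"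
proof -
  interpret comult_system P by (rule product_system_comult_system[OF P])
  have a: "pmult P (r + s) t (pmult P r s x y) z = pmult P r (s + t) x (pmult P s t y z)"
    if "r > 0" "s > 0" "t > 0" "x \<in> fibre P r" "y \<in> fibre P s" "z \<in> fibre P t" for r s t x y z
    using P that unfolding product_system_iff_assoc by blast
  show ?thesis
    by (intro mult_system.intro fibre_closed cinner_pmult closed_cspan_pmult a)
qed

text \<open>The structure map is injective on the fibre and carries \<open>sprod\<close> onto the
  tensor product, so equality of images is equality of subspaces. If G is not a family of closed
  subspaces of the fibres, both sides fail.\<close>

lemma product_subsystem_iff_msub:
  assumes P: "product_system P"
  shows "product_subsystem P G \<longleftrightarrow> mult_system.msub (fibre P) (pmult P) G"
proof -
  interpret comult_system P by (rule product_system_comult_system[OF P])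
  interpret M: mult_system "fibre P" "pmult P" by (rule product_system_mult_system[OF P])
  have iff: "comult P s t ` G (s + t) = tensor_space (G s) (G t) \<longleftrightarrow> M.sprod s t (G s) (G t) = G (s + t)"
    if G: "\<And>t. t > 0 \<Longrightarrow> G t \<subseteq> fibre P t" and st: "s > 0" "t > 0" for s t
  proof -
    have 1: "tensor_space (G s) (G t) = comult P s t ` M.sprod s t (G s) (G t)"
      unfolding M.sprod_def using comult_image_closed_cspan_pmult[OF st G[OF st(1)] G[OF st(2)]] ..
    have 2: "inj_on (comult P s t) (fibre P (s + t))" using comult_inject[OF st] by (intro inj_onI)
    have 3: "M.sprod s t (G s) (G t) \<subseteq> fibre P (s + t)" by (intro M.sprod_subset st G)
    have 4: "G (s + t) \<subseteq> fibre P (s + t)" using st by (intro G) simp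
    show ?thesis unfolding 1 inj_on_image_eq_iff[OF 2 4 3] by (rule eq_commute)
  qed
  show ?thesis
  proof (cases "\<forall>t>0. closed_csubspace (G t) \<and> G t \<subseteq> fibre P t")
    case True
    then have "\<And>t. t > 0 \<Longrightarrow> G t \<subseteq> fibre P t" by blast
    note iff = iff[OF this]
    show ?thesis unfolding product_subsystem_def M.msub_def using True iff by simp
  next
    case False
    then show ?thesis unfolding product_subsystem_def M.msub_def by (simp only: simp_thms)
  qed
qed

lemma generated_subsystem_eq_gen:
  "product_system P \<Longrightarrow> generated_subsystem P X = mult_system.gen (fibre P) (pmult P) X"
  by (intro ext)
    (simp add: generated_subsystem_def mult_system.gen_def[OF product_system_mult_system] product_subsystem_iff_msub)

section \<open>Tensor products and restrictions of product systems\<close>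

lemma tensor_system_comult_system:
  assumes E: "comult_system E" and F: "comult_system F"
  shows "comult_system (tensor_system E F)"
    and "\<lbrakk>s > 0; t > 0; x \<in> fibre E s; x' \<in> fibre E t; y \<in> fibre F s; y' \<in> fibre F t\<rbrakk> \<Longrightarrow>
      pmult (tensor_system E F) s t (x \<otimes> y) (x' \<otimes> y') = pmult E s t x x' \<otimes> pmult F s t y y'"
proof -
  interpret E: comult_system E by (rule E)
  interpret F: comult_system F by (rule F)
  let ?EF = "tensor_system E F"
  have fib: "fibre ?EF t = tensor_space (fibre E t) (fibre F t)" for t by (simp add: tensor_system_def)
  have com: "comult ?EF s t z = middle_flip
      (tensor_op (fibre E (s + t)) (fibre F (s + t)) (comult E s t) (comult F s t) z)" for s t z
    by (simp add: tensor_system_def)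
  show EF: "comult_system ?EF"
  proof
    show "closed_csubspace (fibre ?EF t)" for t by (simp add: fib closed_csubspace_tensor_space)
    fix s t :: real assume st: "s > 0" "t > 0"
    let ?T = "tensor_op (fibre E (s + t)) (fibre F (s + t)) (comult E s t) (comult F s t)"
    note T = tensor_op_isometry[OF E.comult_isometry[OF st] F.comult_isometry[OF st]]
    have iso: "isometry_on (fibre ?EF (s + t)) (comult ?EF s t)"
      unfolding com[abs_def] fib by (rule isometry_on_compose[OF T(1) subset_UNIV middle_flip(1)])
    have "comult ?EF s t ` fibre ?EF (s + t) = middle_flip ` (?T ` tensor_space (fibre E (s + t)) (fibre F (s + t)))"
      unfolding fib by (simp add: com image_image)
    also have "\<dots> = middle_flip ` tensor_space (tensor_space (fibre E s) (fibre E t)) (tensor_space (fibre F s) (fibre F t))"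
      unfolding T(3) E.comult_image[OF st] F.comult_image[OF st] ..
    \<comment> \<open>Everything is reduced to fourfold elementary tensors, on which the flip merely
      exchanges the two middle factors.\<close>
    also have "\<dots> = closed_cspan (middle_flip ` {p \<otimes> q | p q.
        p \<in> {x \<otimes> y | x y. x \<in> fibre E s \<and> y \<in> fibre E t} \<and> q \<in> {x \<otimes> y | x y. x \<in> fibre F s \<and> y \<in> fibre F t}})"
      unfolding tensor_space_def[of "fibre E s"] tensor_space_def[of "fibre F s"] tensor_space_closed_cspan
      by (rule isometry_on_image_closed_cspan[OF closed_csubspace_UNIV middle_flip(1) subset_UNIV])
    also have "middle_flip ` {p \<otimes> q | p q.
        p \<in> {x \<otimes> y | x y. x \<in> fibre E s \<and> y \<in> fibre E t} \<and> q \<in> {x \<otimes> y | x y. x \<in> fibre F s \<and> y \<in> fibre F t}} =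
      {p \<otimes> q | p q. p \<in> {x \<otimes> y | x y. x \<in> fibre E s \<and> y \<in> fibre F s} \<and> q \<in> {x \<otimes> y | x y. x \<in> fibre E t \<and> y \<in> fibre F t}}"
      (is "middle_flip ` ?A = ?B")
    proof (intro equalityI subsetI)
      fix z assume "z \<in> middle_flip ` ?A"
      then obtain a b c d where "z = middle_flip ((a \<otimes> b) \<otimes> (c \<otimes> d))" and
        m: "a \<in> fibre E s" "b \<in> fibre E t" "c \<in> fibre F s" "d \<in> fibre F t" by blast
      then have "z = (a \<otimes> c) \<otimes> (b \<otimes> d)" by (simp add: middle_flip(2))
      then show "z \<in> ?B" using m by blast
    next
      fix z assume "z \<in> ?B"
      then obtain a b c d where "z = (a \<otimes> c) \<otimes> (b \<otimes> d)" and
        m: "a \<in> fibre E s" "b \<in> fibre E t" "c \<in> fibre F s" "d \<in> fibre F t" by blast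
      then have "z = middle_flip ((a \<otimes> b) \<otimes> (c \<otimes> d))" by (simp add: middle_flip(2))
      then show "z \<in> middle_flip ` ?A" using m by (intro image_eqI) blast+
    qed
    also have "closed_cspan ?B = tensor_space (fibre ?EF s) (fibre ?EF t)"
      unfolding fib unfolding tensor_space_def[of "fibre E s"] tensor_space_def[of "fibre E t"] tensor_space_closed_cspan ..
    finally have img: "comult ?EF s t ` fibre ?EF (s + t) = tensor_space (fibre ?EF s) (fibre ?EF t)" .
    show "unitary_op (fibre ?EF (s + t)) (tensor_space (fibre ?EF s) (fibre ?EF t)) (comult ?EF s t)"
      by (rule unitary_opI[OF _ iso img]) (simp add: fib closed_csubspace_tensor_space)
  qed
  show "pmult ?EF s t (x \<otimes> y) (x' \<otimes> y') = pmult E s t x x' \<otimes> pmult F s t y y'"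
    if st: "s > 0" "t > 0" and m: "x \<in> fibre E s" "x' \<in> fibre E t" "y \<in> fibre F s" "y' \<in> fibre F t"
  proof (rule comult_system.pmult_eqI[OF EF st])
    note e = E.pmult[OF st m(1,2)] and f = F.pmult[OF st m(3,4)]
    show "pmult E s t x x' \<otimes> pmult F s t y y' \<in> fibre ?EF (s + t)"
      unfolding fib by (rule tensor_space_base[OF e(1) f(1)])
    show "comult ?EF s t (pmult E s t x x' \<otimes> pmult F s t y y') = (x \<otimes> y) \<otimes> (x' \<otimes> y')"
      unfolding com tensor_op_isometry(2)[OF E.comult_isometry[OF st] F.comult_isometry[OF st] e(1) f(1)]
        e(2) f(2) by (rule middle_flip(2))
  qed
qed

lemma tensor_system_product_system:
  assumes E: "product_system E" and F: "product_system F"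
  shows "product_system (tensor_system E F)"
proof -
  note cE = product_system_comult_system[OF E] and cF = product_system_comult_system[OF F]
  interpret E: mult_system "fibre E" "pmult E" by (rule product_system_mult_system[OF E])
  interpret F: mult_system "fibre F" "pmult F" by (rule product_system_mult_system[OF F])
  note T = tensor_system_comult_system[OF cE cF]
  show ?thesis
  proof (rule comult_system.product_system_if_assoc_total[OF T(1)])
    show "closed_cspan {x \<otimes> y | x y. x \<in> fibre E t \<and> y \<in> fibre F t} = fibre (tensor_system E F) t" for t
      by (simp add: tensor_system_def tensor_space_def)
    fix r s t :: real and x y z
    assume rst: "r > 0" "s > 0" "t > 0"
      and "x \<in> {x \<otimes> y | x y. x \<in> fibre E r \<and> y \<in> fibre F r}"
        "y \<in> {x \<otimes> y | x y. x \<in> fibre E s \<and> y \<in> fibre F s}"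
        "z \<in> {x \<otimes> y | x y. x \<in> fibre E t \<and> y \<in> fibre F t}"
    then obtain a a' b b' c c' where xyz: "x = a \<otimes> a'" "y = b \<otimes> b'" "z = c \<otimes> c'"
      and m: "a \<in> fibre E r" "b \<in> fibre E s" "c \<in> fibre E t" "a' \<in> fibre F r" "b' \<in> fibre F s" "c' \<in> fibre F t"
      by blast
    show "pmult (tensor_system E F) (r + s) t (pmult (tensor_system E F) r s x y) z =
        pmult (tensor_system E F) r (s + t) x (pmult (tensor_system E F) s t y z)"
      unfolding xyz using rst m by (simp add: T(2) E.m_in F.m_in E.m_assoc F.m_assoc)
  qed
qed

lemma tensor_system_pairing:
  assumes E: "product_system E" and F: "product_system F"
  shows "tensor_pairing (fibre E) (pmult E) (fibre F) (pmult F)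
    (fibre (tensor_system E F)) (pmult (tensor_system E F)) (\<otimes>)"
proof (intro tensor_pairing.intro product_system_mult_system E F tensor_system_product_system
    tensor_pairing_axioms.intro cinner_tensor)
  show "closed_cspan {x \<otimes> y | x y. x \<in> fibre E t \<and> y \<in> fibre F t} = fibre (tensor_system E F) t" for t
    by (simp add: tensor_system_def tensor_space_def)
qed (rule tensor_system_comult_system(2)[OF product_system_comult_system[OF E] product_system_comult_system[OF F]])

lemma restrict_system_simps [simp]:
  "fibre (restrict_system P G) = G" "comult (restrict_system P G) = comult P"
  by (simp_all add: restrict_system_def)

text \<open>The product of the restricted system is an adjoint over a smaller fibre. It agrees with
  the old product because that already lies in G and has the required image under the structure map;
  associativity is then inherited.\<close>

lemma restrict_system_product_system:
  assumes P: "product_system P" and G: "product_subsystem P G"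
  shows "product_system (restrict_system P G)"
    and "\<lbrakk>s > 0; t > 0; x \<in> G s; y \<in> G t\<rbrakk> \<Longrightarrow> pmult (restrict_system P G) s t x y = pmult P s t x y"
proof -
  interpret P: comult_system P by (rule product_system_comult_system[OF P])
  interpret M: mult_system "fibre P" "pmult P" by (rule product_system_mult_system[OF P])
  have ms: "M.msub G" using G product_subsystem_iff_msub[OF P] by simp
  note D = M.msubD[OF ms]
  have c: "comult_system (restrict_system P G)"
  proof (unfold_locales, unfold restrict_system_simps)
    show "t > 0 \<Longrightarrow> closed_csubspace (G t)" for t by (rule D(1))
    fix s t :: real assume st: "s > 0" "t > 0"
    have pos: "s + t > 0" using st by simp
    show "unitary_op (G (s + t)) (tensor_space (G s) (G t)) (comult P s t)"
      using G st
      by (intro unitary_opI D(1)[OF pos] isometry_on_subset[OF P.comult_isometry[OF st] D(2)[OF pos]])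
        (simp add: product_subsystem_def)
  qed
  show pm: "pmult (restrict_system P G) s t x y = pmult P s t x y"
    if st: "s > 0" "t > 0" and xy: "x \<in> G s" "y \<in> G t" for s t x y
  proof (rule comult_system.pmult_eqI[OF c st], unfold restrict_system_simps)
    show "pmult P s t x y \<in> G (s + t)" by (rule M.msub_mult[OF ms st xy])
    show "comult P s t (pmult P s t x y) = x \<otimes> y" using xy D(2) st by (intro P.pmult) auto
  qed
  show "product_system (restrict_system P G)"
    unfolding comult_system.product_system_iff_assoc[OF c] restrict_system_simps
  proof (intro allI impI ballI)
    fix r s t :: real and x y z
    assume rst: "r > 0" "s > 0" "t > 0" and xyz: "x \<in> G r" "y \<in> G s" "z \<in> G t"
    have "x \<in> fibre P r" "y \<in> fibre P s" "z \<in> fibre P t" using xyz D(2) rst by auto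
    then have "pmult P (r + s) t (pmult P r s x y) z = pmult P r (s + t) x (pmult P s t y z)"
      by (intro M.m_assoc rst)
    moreover have "pmult P r s x y \<in> G (r + s)" "pmult P s t y z \<in> G (s + t)"
      by (intro M.msub_mult[OF ms] rst xyz)+
    ultimately show "pmult (restrict_system P G) (r + s) t (pmult (restrict_system P G) r s x y) z =
        pmult (restrict_system P G) r (s + t) x (pmult (restrict_system P G) s t y z)"
      using rst xyz by (simp add: pm)
  qed
qed

lemma product_subsystem_restrict_system_iff:
  assumes "product_subsystem P G"
  shows "product_subsystem (restrict_system P G) K \<longleftrightarrow> product_subsystem P K \<and> (\<forall>t>0. K t \<subseteq> G t)"
  using assms unfolding product_subsystem_def restrict_system_simps by (meson subset_trans)

text \<open>Product subsystems of the restriction are exactly the product subsystems of P contained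
  in it, so generating inside or outside makes no difference. An amalgamated product is required to
  be generated within itself.\<close>

lemma generated_subsystem_restrict_system:
  assumes P: "product_system P" and X: "\<And>t. t > 0 \<Longrightarrow> X t \<subseteq> fibre P t" and t: "t > 0"
  shows "generated_subsystem (restrict_system P (generated_subsystem P X)) X t = generated_subsystem P X t"
proof -
  interpret M: mult_system "fibre P" "pmult P" by (rule product_system_mult_system[OF P])
  let ?S = "generated_subsystem P X"
  have gen: "?S = M.gen X" by (rule generated_subsystem_eq_gen[OF P])
  have S: "product_subsystem P ?S"
    unfolding product_subsystem_iff_msub[OF P] gen by (rule M.msub_gen[OF X])
  have XS: "X s \<subseteq> ?S s" if "s > 0" for s unfolding gen by (rule M.gen_superset[OF that])
  have SS: "product_subsystem (restrict_system P ?S) ?S"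
    unfolding product_subsystem_restrict_system_iff[OF S] using S by blast
  show ?thesis
  proof
    show "generated_subsystem (restrict_system P ?S) X t \<subseteq> ?S t"
      unfolding generated_subsystem_def[of "restrict_system P ?S"] using SS XS by blast
    show "?S t \<subseteq> generated_subsystem (restrict_system P ?S) X t"
      unfolding generated_subsystem_def[of "restrict_system P ?S"]
    proof (rule Inter_greatest)
      fix A assume "A \<in> {K t | K. product_subsystem (restrict_system P ?S) K \<and> (\<forall>s>0. X s \<subseteq> K s)}"
      then obtain K where K: "A = K t" "product_subsystem (restrict_system P ?S) K" "\<forall>s>0. X s \<subseteq> K s" by blast
      have "M.msub K"
        using K(2) unfolding product_subsystem_restrict_system_iff[OF S] product_subsystem_iff_msub[OF P] by blast
      then show "?S t \<subseteq> A" unfolding K(1) gen using K(3) by (intro M.gen_minimal) auto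
    qed
  qed
qed

text \<open>Both sides of the intertwining relation are isometries of the fibre, and products are
  total in it; so the relation is equivalent to multiplicativity. The growth bound holds with k =
  0.\<close>

lemma isometric_morphism_iff:
  assumes P: "product_system P" and Q: "product_system Q"
    and iso: "\<And>t. t > 0 \<Longrightarrow> isometry_on (fibre P t) (\<phi> t)" "\<And>t. t > 0 \<Longrightarrow> \<phi> t ` fibre P t \<subseteq> fibre Q t"
  shows "morphism P Q \<phi> \<longleftrightarrow> (\<forall>s>0. \<forall>t>0. \<forall>x\<in>fibre P s. \<forall>y\<in>fibre P t.
    \<phi> (s + t) (pmult P s t x y) = pmult Q s t (\<phi> s x) (\<phi> t y))" (is "_ \<longleftrightarrow> ?mult")
proof -
  interpret P: comult_system P by (rule product_system_comult_system[OF P])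
  interpret Q: comult_system Q by (rule product_system_comult_system[OF Q])
  have in\<phi>: "\<phi> t x \<in> fibre Q t" if "t > 0" "x \<in> fibre P t" for t x
    using iso(2)[OF that(1)] that(2) by blast
  have T: "tensor_op (fibre P s) (fibre P t) (\<phi> s) (\<phi> t) (x \<otimes> y) = comult Q s t (pmult Q s t (\<phi> s x) (\<phi> t y))"
    if "s > 0" "t > 0" "x \<in> fibre P s" "y \<in> fibre P t" for s t x y
    using tensor_op_isometry(2)[OF iso(1)[OF that(1)] iso(1)[OF that(2)] that(3,4)]
      Q.pmult(2)[OF that(1,2) in\<phi>[OF that(1,3)] in\<phi>[OF that(2,4)]] by simp
  show ?thesis
  proof
    assume m: "morphism P Q \<phi>"
    show ?mult
    proof (intro allI impI ballI)
      fix s t :: real and x y assume st: "s > 0" "t > 0" and xy: "x \<in> fibre P s" "y \<in> fibre P t"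
      let ?z = "pmult P s t x y"
      have z: "?z \<in> fibre P (s + t)" by (rule P.pmult(1)[OF st xy])
      have "comult Q s t (\<phi> (s + t) ?z) = tensor_op (fibre P s) (fibre P t) (\<phi> s) (\<phi> t) (comult P s t ?z)"
        using m st z unfolding morphism_def by blast
      also have "\<dots> = comult Q s t (pmult Q s t (\<phi> s x) (\<phi> t y))"
        unfolding P.pmult(2)[OF st xy] by (rule T[OF st xy])
      finally show "\<phi> (s + t) ?z = pmult Q s t (\<phi> s x) (\<phi> t y)"
        using st xy z by (intro Q.comult_inject[OF st] in\<phi> Q.pmult(1)) auto
    qed
  next
    assume m: ?mult
    show "morphism P Q \<phi>"
      unfolding morphism_def
    proof (intro conjI allI impI ballI exI[of _ 0])
      show "bounded_op (fibre P t) (fibre Q t) (\<phi> t)" if "t > 0" for t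
        by (rule isometry_on_bounded_op[OF P.fibre_closed[OF that] iso[OF that]])
      show "norm (\<phi> t x) \<le> exp (0 * t) * norm x" if "t > 0" "x \<in> fibre P t" for t x
        using isometry_on_norm[OF iso(1)[OF that(1)] that(2)] by simp
      fix s t :: real and z assume st: "s > 0" "t > 0" and z: "z \<in> fibre P (s + t)"
      have pos: "s + t > 0" using st by simp
      note TI = tensor_op_isometry[OF iso(1)[OF st(1)] iso(1)[OF st(2)]]
      show "comult Q s t (\<phi> (s + t) z) = tensor_op (fibre P s) (fibre P t) (\<phi> s) (\<phi> t) (comult P s t z)"
      proof (rule bounded_op_eqI[where f = "\<lambda>z. comult Q s t (\<phi> (s + t) z)"
            and g = "\<lambda>z. tensor_op (fibre P s) (fibre P t) (\<phi> s) (\<phi> t) (comult P s t z)", OF P.fibre_closed[OF pos]])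
        show "bounded_op (fibre P (s + t)) UNIV (\<lambda>z. comult Q s t (\<phi> (s + t) z))"
          by (intro isometry_on_bounded_op P.fibre_closed[OF pos] subset_UNIV
              isometry_on_compose[OF iso(1)[OF pos] iso(2)[OF pos] Q.comult_isometry[OF st]])
        show "bounded_op (fibre P (s + t)) UNIV (\<lambda>z. tensor_op (fibre P s) (fibre P t) (\<phi> s) (\<phi> t) (comult P s t z))"
          by (intro isometry_on_bounded_op P.fibre_closed[OF pos] subset_UNIV
              isometry_on_compose[OF P.comult_isometry[OF st] equalityD1[OF P.comult_image[OF st]] TI(1)])
        show "z \<in> closed_cspan {pmult P s t x y | x y. x \<in> fibre P s \<and> y \<in> fibre P t}"
          using z P.closed_cspan_pmult[OF st] by simp
        show "{pmult P s t x y | x y. x \<in> fibre P s \<and> y \<in> fibre P t} \<subseteq> fibre P (s + t)"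
          using P.pmult(1)[OF st] by blast
        fix w assume "w \<in> {pmult P s t x y | x y. x \<in> fibre P s \<and> y \<in> fibre P t}"
        then obtain x y where w: "w = pmult P s t x y" and xy: "x \<in> fibre P s" "y \<in> fibre P t" by blast
        have "\<phi> (s + t) w = pmult Q s t (\<phi> s x) (\<phi> t y)" using m st xy w by blast
        then show "comult Q s t (\<phi> (s + t) w) = tensor_op (fibre P s) (fibre P t) (\<phi> s) (\<phi> t) (comult P s t w)"
          using T[OF st xy] P.pmult(2)[OF st xy] w by simp
      qed
    qed
  qed
qed

lemma isometric_morphism_isometry_on:
  assumes P: "product_system P" and J: "isometric_morphism P Q J" and t: "t > 0"
  shows "isometry_on (fibre P t) (J t)" "J t ` fibre P t \<subseteq> fibre Q t"
proof -
  have b: "bounded_op (fibre P t) (fibre Q t) (J t)" "\<And>x. x \<in> fibre P t \<Longrightarrow> norm (J t x) = norm x"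
    using J t by (auto simp: isometric_morphism_def morphism_def)
  have "closed_csubspace (fibre P t)" using P t by (simp add: product_system_def)
  then show "isometry_on (fibre P t) (J t)"
    using b by (intro norm_preserving_isometry_on) (auto simp: bounded_op_def)
  show "J t ` fibre P t \<subseteq> fibre Q t" using b(1) by (simp add: bounded_op_def)
qed

lemma cinner_bounded_op:
  fixes a :: "'a::complex_inner" and b :: "'b::complex_inner"
  assumes "norm a = 1" "norm b = 1" "b \<in> K" "closed_csubspace K"
  shows "bounded_op W K (\<lambda>y. cinner a y *\<^sub>C b)" "norm (cinner a y *\<^sub>C b) \<le> norm y"
proof -
  show n: "norm (cinner a y *\<^sub>C b) \<le> norm y" for y
    using complex_Cauchy_Schwarz[of a y] assms by (simp add: norm_scaleC)
  show "bounded_op W K (\<lambda>y. cinner a y *\<^sub>C b)"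
    unfolding bounded_op_def clinear_on_def
    using n closed_csubspaceD(4)[OF assms(4,3)]
    by (auto simp: cinner_add_right cinner_scaleC_right scaleC_add_left scaleC_scaleC intro!: exI[of _ 1])
qed

text \<open>The tensor product of two rank-one maps is the rank-one map of the tensored vectors, and
  the structure maps send \<open>u (s + t)\<close> and \<open>v (s + t)\<close> to exactly these.
  Contractivity is the Cauchy-Schwarz inequality.\<close>

lemma contractive_morphism_rank_one:
  assumes P: "product_system P" and Q: "product_system Q"
    and u: "mult_system.msection (fibre P) (pmult P) u" and v: "mult_system.msection (fibre Q) (pmult Q) v"
  shows "contractive_morphism Q P (rank_one u v)"
proof -
  interpret P: comult_system P by (rule product_system_comult_system[OF P])
  interpret Q: comult_system Q by (rule product_system_comult_system[OF Q])
  note U = mult_system.msectionD[OF product_system_mult_system[OF P] u]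
  note V = mult_system.msectionD[OF product_system_mult_system[OF Q] v]
  have op: "bounded_op (fibre Q t) (fibre P t) (rank_one u v t)" and le: "norm (rank_one u v t x) \<le> norm x" if "t > 0" for t x
    using cinner_bounded_op[of "v t" "u t" "fibre P t"] U V P.fibre_closed that
    by (auto simp: rank_one_def[abs_def])
  have "comult P s t (rank_one u v (s + t) x) =
      tensor_op (fibre Q s) (fibre Q t) (rank_one u v s) (rank_one u v t) (comult Q s t x)"
    if st: "s > 0" "t > 0" and x: "x \<in> fibre Q (s + t)" for s t x
  proof -
    have pos: "s + t > 0" using st by simp
    have cu: "comult P s t (u (s + t)) = u s \<otimes> u t"
      using P.pmult(2)[OF st U(1)[OF st(1)] U(1)[OF st(2)]] U(4)[OF st refl] by simp
    have cv: "comult Q s t (v (s + t)) = v s \<otimes> v t"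
      using Q.pmult(2)[OF st V(1)[OF st(1)] V(1)[OF st(2)]] V(4)[OF st refl] by simp
    have "tensor_op (fibre Q s) (fibre Q t) (rank_one u v s) (rank_one u v t) (comult Q s t x) =
        cinner (v s \<otimes> v t) (comult Q s t x) *\<^sub>C (u s \<otimes> u t)"
    proof (rule tensor_opI)
      have n1: "norm (v s \<otimes> v t) = 1" "norm (u s \<otimes> u t) = 1"
        using st U(3) V(3) by (simp_all add: norm_eq_sqrt_cinner cinner_tensor)
      show "bounded_op (tensor_space (fibre Q s) (fibre Q t)) UNIV (\<lambda>z. cinner (v s \<otimes> v t) z *\<^sub>C (u s \<otimes> u t))"
        by (rule cinner_bounded_op[OF n1 UNIV_I closed_csubspace_UNIV])
      show "comult Q s t x \<in> tensor_space (fibre Q s) (fibre Q t)" using Q.comult_image[OF st] x by blast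
    qed (simp add: rank_one_def cinner_tensor tensor_scaleC_left tensor_scaleC_right scaleC_scaleC mult.commute)
    also have "cinner (v s \<otimes> v t) (comult Q s t x) = cinner (v (s + t)) x"
      using isometry_onD[OF Q.comult_isometry[OF st] V(1)[OF pos] x] cv by simp
    also have "cinner (v (s + t)) x *\<^sub>C (u s \<otimes> u t) = comult P s t (rank_one u v (s + t) x)"
      using clinear_on_scaleC[OF isometry_on_clinear_on[OF P.fibre_closed[OF pos] P.comult_isometry[OF st]] U(1)[OF pos]]
        cu by (simp add: rank_one_def)
    finally show ?thesis ..
  qed
  moreover have "norm (rank_one u v t x) \<le> exp (0 * t) * norm x" if "t > 0" for t x using le[OF that] by simp
  ultimately have "morphism Q P (rank_one u v)"
    unfolding morphism_def using op by (intro conjI exI[of _ 0]) auto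
  then show ?thesis using le by (simp add: contractive_morphism_def)
qed

section \<open>The amalgamated product over normalised units\<close>

lemma normalised_unit_msection:
  "normalised_unit P e u \<Longrightarrow> product_system P \<Longrightarrow> mult_system.msection (fibre P) (pmult P) u"
  by (auto simp: mult_system.msection_def[OF product_system_mult_system] normalised_unit_def is_unit_def
      measurable_section_def)

text \<open>A unit is a scalar multiple, at each time, of its normalisation, which is a
  multiplicative section. Hence a product subsystem containing all normalised sections contains all
  units.\<close>

lemma type_I_part_properties:
  assumes P: "product_system P"
  shows "mult_system.msub (fibre P) (pmult P) K \<Longrightarrow>
      (\<And>w s. mult_system.msection (fibre P) (pmult P) w \<Longrightarrow> s > 0 \<Longrightarrow> w s \<in> K s) \<Longrightarrow> type_I_part P e t \<subseteq> K t"
    and "is_unit P e u \<Longrightarrow> t > 0 \<Longrightarrow> u t \<in> type_I_part P e t"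
proof -
  interpret M: mult_system "fibre P" "pmult P" by (rule product_system_mult_system[OF P])
  have gen: "type_I_part P e = M.gen (\<lambda>t. {u t | u. is_unit P e u})"
    unfolding type_I_part_def by (rule generated_subsystem_eq_gen[OF P])
  show "u t \<in> type_I_part P e t" if "is_unit P e u" "t > 0"
    unfolding gen using that(1) by (intro subsetD[OF M.gen_superset[OF that(2)]]) blast
  assume K: "M.msub K" and w: "\<And>w s. M.msection w \<Longrightarrow> s > 0 \<Longrightarrow> w s \<in> K s"
  have "w s \<in> K s" if u: "is_unit P e w" and s: "s > 0" for w s
  proof -
    obtain t0 where t0: "t0 > 0" "w t0 \<noteq> 0" using u by (auto simp: is_unit_def)
    have w': "\<And>t. t > 0 \<Longrightarrow> w t \<in> fibre P t" "\<And>s t. s > 0 \<Longrightarrow> t > 0 \<Longrightarrow> w (s + t) = pmult P s t (w s) (w t)"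
      using u by (auto simp: is_unit_def measurable_section_def)
    have N: "M.msection (\<lambda>t. complex_of_real (1 / norm (w t)) *\<^sub>C w t)"
      by (rule M.msection_normalise(1)[of w t0]) (fact w' t0)+
    have "w s \<noteq> 0" by (rule M.msection_normalise(2)[of w t0]) (fact w' t0 s)+
    moreover have "complex_of_real (norm (w s)) *\<^sub>C (complex_of_real (1 / norm (w s)) *\<^sub>C w s) \<in> K s"
      by (intro closed_csubspaceD(4)[OF M.msubD(1)[OF K s]] w[OF N s])
    ultimately show ?thesis by (simp add: scaleC_scaleC flip: of_real_mult)
  qed
  then show "type_I_part P e t \<subseteq> K t" unfolding gen by (intro M.gen_minimal[OF K]) auto
qed

lemma arveson_system_separable:
  assumes "arveson_system P e"
  shows "mult_system.separable_fibres (fibre P)"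
proof -
  have P: "product_system P" using assms by (simp add: arveson_system_def)
  show ?thesis
    unfolding mult_system.separable_fibres_def[OF product_system_mult_system[OF P]]
    using assms unfolding arveson_system_def by blast
qed

text \<open>The existence clause has a witness on the Hilbert space of E \<otimes> F. The last
  clause concerns amalgamated products on any Hilbert space type, so it identifies every realisation
  of the amalgam, independently of that witness.\<close>

theorem theorem5p6:
  fixes E :: "'a::chilbert psystem" and e :: "nat \<Rightarrow> real \<Rightarrow> 'a" and u :: "real \<Rightarrow> 'a"
    and F :: "'b::chilbert psystem" and f :: "nat \<Rightarrow> real \<Rightarrow> 'b" and v :: "real \<Rightarrow> 'b"
  assumes "arveson_system E e" and "spatial E e"
    and "arveson_system F f" and "spatial F f"
    and "normalised_unit E e u" and "normalised_unit F f v"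
  shows "let EF = tensor_system E F;
             R = join_subsystem EF
                   (\<lambda>t. tensor_space (fibre E t) (type_I_part F f t))
                   (\<lambda>t. tensor_space (type_I_part E e t) (fibre F t))
         in product_subsystem EF R
            \<and> (\<exists>(G :: ('a, 'b) htensor psystem) J K. is_unit_amalgam E F u v G J K)
            \<and> (\<forall>(G :: 'c::chilbert psystem) J K. is_unit_amalgam E F u v G J K \<longrightarrow>
                 G \<cong>\<^sub>p restrict_system EF R)"
proof -
  have PE: "product_system E" and PF: "product_system F" using assms by (auto simp: arveson_system_def)
  define EF where "EF = tensor_system E F"
  interpret tp: tensor_pairing "fibre E" "pmult E" "fibre F" "pmult F" "fibre EF" "pmult EF" "(\<otimes>)"
    unfolding EF_def by (rule tensor_system_pairing[OF PE PF])
  have PEF: "product_system EF" unfolding EF_def by (rule tensor_system_product_system[OF PE PF])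
  have sep: "tp.E.separable_fibres" "tp.F.separable_fibres" using assms arveson_system_separable by auto
  have u: "tp.E.msection u" and v: "tp.F.msection v" using assms normalised_unit_msection PE PF by auto
  note U = tp.E.msectionD[OF u] and V = tp.F.msectionD[OF v]
  have uu: "is_unit E e u" and uv: "is_unit F f v" using assms by (auto simp: normalised_unit_def)
  define R where "R = join_subsystem EF
                   (\<lambda>t. tensor_space (fibre E t) (type_I_part F f t))
                   (\<lambda>t. tensor_space (type_I_part E e t) (fibre F t))"
  let ?X = "\<lambda>t. (\<lambda>x. x \<otimes> v t) ` fibre E t \<union> (\<lambda>y. u t \<otimes> y) ` fibre F t"
  define S where "S = generated_subsystem EF ?X"
  have Sgen: "S = tp.H.gen ?X" unfolding S_def by (rule generated_subsystem_eq_gen[OF PEF])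
  have Xin: "?X t \<subseteq> fibre EF t" if "t > 0" for t using tp.tp_in[OF that] U(1)[OF that] V(1)[OF that] by auto
  have tprod: "tp.tprod A B = tensor_space A B" for A B by (simp add: tp.tprod_def tensor_space_def)
  \<comment> \<open>The two families are compared at positive times only, which are all that
    subsystems and morphisms see.\<close>
  have RS: "R t = S t" if t: "t > 0" for t
  proof -
    have "R t = tp.H.gen (\<lambda>t. tp.tprod (fibre E t) (type_I_part F f t) \<union> tp.tprod (type_I_part E e t) (fibre F t)) t"
      unfolding R_def join_subsystem_def tprod generated_subsystem_eq_gen[OF PEF] ..
    also have "\<dots> = tp.H.gen ?X t"
    proof (rule tp.gen_type_I_eq[OF sep u v])
      show "type_I_part E e t \<subseteq> K t" if "tp.E.msub K" "\<And>w s. tp.E.msection w \<Longrightarrow> s > 0 \<Longrightarrow> w s \<in> K s" for K t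
        by (rule type_I_part_properties(1)[OF PE]) (fact that)+
      show "type_I_part F f t \<subseteq> K t" if "tp.F.msub K" "\<And>w s. tp.F.msection w \<Longrightarrow> s > 0 \<Longrightarrow> w s \<in> K s" for K t
        by (rule type_I_part_properties(1)[OF PF]) (fact that)+
    qed (use type_I_part_properties(2) PE PF uu uv t in auto)
    finally show ?thesis by (simp add: Sgen)
  qed
  have Smsub: "tp.H.msub S" unfolding Sgen by (rule tp.H.msub_gen[OF Xin])
  then have Rmsub: "tp.H.msub R" unfolding tp.H.msub_def using RS by simp
  have Ssub: "product_subsystem EF S" and Rsub: "product_subsystem EF R"
    using Smsub Rmsub product_subsystem_iff_msub[OF PEF] by auto
  have C: "contractive_morphism F E (rank_one u v)" by (rule contractive_morphism_rank_one[OF PE PF u v])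
  \<comment> \<open>S is generated by the images of the embeddings x \<mapsto> x \<otimes>
    \<open>v t\<close> and y \<mapsto> \<open>u t\<close> \<otimes> y, and the adjoint of the first
    maps \<open>u t\<close> \<otimes> y to <v, y> u; so S itself realises the amalgam.\<close>
  have "is_unit_amalgam E F u v (restrict_system EF S) (\<lambda>t x. x \<otimes> v t) (\<lambda>t y. u t \<otimes> y)"
  proof -
    note PS = restrict_system_product_system[OF PEF Ssub]
    have XS: "?X t \<subseteq> S t" if "t > 0" for t unfolding Sgen by (rule tp.H.gen_superset[OF that])
    have Jiso: "isometry_on (fibre E t) (\<lambda>x. x \<otimes> v t)" if "t > 0" for t
      using V(3)[OF that] by (simp add: isometry_on_def cinner_tensor)
    have Kiso: "isometry_on (fibre F t) (\<lambda>y. u t \<otimes> y)" if "t > 0" for t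
      using U(3)[OF that] by (simp add: isometry_on_def cinner_tensor)
    have J: "isometric_morphism E (restrict_system EF S) (\<lambda>t x. x \<otimes> v t)"
      unfolding isometric_morphism_def
    proof
      have "morphism E (restrict_system EF S) (\<lambda>t x. x \<otimes> v t) \<longleftrightarrow>
        (\<forall>s>0. \<forall>t>0. \<forall>x\<in>fibre E s. \<forall>y\<in>fibre E t. pmult E s t x y \<otimes> v (s + t) =
          pmult (restrict_system EF S) s t (x \<otimes> v s) (y \<otimes> v t))"
        using XS by (intro isometric_morphism_iff[OF PE PS(1)] Jiso) auto
      moreover have "pmult E s t x y \<otimes> v (s + t) = pmult (restrict_system EF S) s t (x \<otimes> v s) (y \<otimes> v t)"
        if st: "s > 0" "t > 0" and xy: "x \<in> fibre E s" "y \<in> fibre E t" for s t x y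
      proof -
        have "x \<otimes> v s \<in> S s" "y \<otimes> v t \<in> S t" using XS[OF st(1)] XS[OF st(2)] xy by auto
        then show ?thesis
          using tp.mH_tp[OF st xy V(1)[OF st(1)] V(1)[OF st(2)]] V(4)[OF st refl] by (simp add: PS(2)[OF st])
      qed
      ultimately show "morphism E (restrict_system EF S) (\<lambda>t x. x \<otimes> v t)" by blast
    qed (use V(2) tp.norm_tp in simp)
    have K: "isometric_morphism F (restrict_system EF S) (\<lambda>t y. u t \<otimes> y)"
      unfolding isometric_morphism_def
    proof
      have "morphism F (restrict_system EF S) (\<lambda>t y. u t \<otimes> y) \<longleftrightarrow>
        (\<forall>s>0. \<forall>t>0. \<forall>x\<in>fibre F s. \<forall>y\<in>fibre F t. u (s + t) \<otimes> pmult F s t x y =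
          pmult (restrict_system EF S) s t (u s \<otimes> x) (u t \<otimes> y))"
        using XS by (intro isometric_morphism_iff[OF PF PS(1)] Kiso) auto
      moreover have "u (s + t) \<otimes> pmult F s t x y = pmult (restrict_system EF S) s t (u s \<otimes> x) (u t \<otimes> y)"
        if st: "s > 0" "t > 0" and xy: "x \<in> fibre F s" "y \<in> fibre F t" for s t x y
      proof -
        have "u s \<otimes> x \<in> S s" "u t \<otimes> y \<in> S t" using XS[OF st(1)] XS[OF st(2)] xy by auto
        then show ?thesis
          using tp.mH_tp[OF st U(1)[OF st(1)] U(1)[OF st(2)] xy] U(4)[OF st refl] by (simp add: PS(2)[OF st])
      qed
      ultimately show "morphism F (restrict_system EF S) (\<lambda>t y. u t \<otimes> y)" by blast
    qed (use U(2) tp.norm_tp in simp)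
    have adj: "adjoint_op (fibre E t) (\<lambda>x. x \<otimes> v t) (u t \<otimes> y) = rank_one u v t y" if t: "t > 0" for t y
    proof (rule adjoint_op_eqI[OF tp.E.fibre_closed[OF t]])
      show "rank_one u v t y \<in> fibre E t"
        unfolding rank_one_def by (intro closed_csubspaceD(4)[OF tp.E.fibre_closed[OF t]] U(1)[OF t])
      show "cinner (rank_one u v t y) z = cinner (u t \<otimes> y) (z \<otimes> v t)" for z
        by (simp add: rank_one_def cinner_scaleC_left cinner_tensor cinner_commute[of y] mult.commute)
    qed
    \<comment> \<open>The join is formed inside the restricted system here, although S was generated
      in \<open>EF\<close>.\<close>
    have "S t = join_subsystem (restrict_system EF S) (\<lambda>s. (\<lambda>x. x \<otimes> v s) ` fibre E s) (\<lambda>s. (\<lambda>y. u s \<otimes> y) ` fibre F s) t"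
      if t: "t > 0" for t
      unfolding join_subsystem_def S_def by (rule generated_subsystem_restrict_system[OF PEF Xin t, symmetric])
    then show ?thesis unfolding is_amalgam_def using C PS(1) J K adj by simp
  qed
  moreover have "G \<cong>\<^sub>p restrict_system EF R" if "is_unit_amalgam E F u v G J K" for G :: "'c psystem" and J K
  proof -
    note am = that[unfolded is_amalgam_def]
    have PG: "product_system G" and J: "isometric_morphism E G J" and K: "isometric_morphism F G K"
      using am by blast+
    have adj: "adjoint_op (fibre E t) (J t) (K t y) = rank_one u v t y" if "t > 0" "y \<in> fibre F t" for t y
      using am that by blast
    have Gt: "fibre G t = join_subsystem G (\<lambda>s. J s ` fibre E s) (\<lambda>s. K s ` fibre F s) t" if "t > 0" for t
      using am that by blast
    interpret G: mult_system "fibre G" "pmult G" by (rule product_system_mult_system[OF PG])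
    note Ji = isometric_morphism_isometry_on[OF PE J] and Ki = isometric_morphism_isometry_on[OF PF K]
    have Jm: "J (s + t) (pmult E s t x y) = pmult G s t (J s x) (J t y)"
      if "s > 0" "t > 0" "x \<in> fibre E s" "y \<in> fibre E t" for s t x y
      using J that isometric_morphism_iff[OF PE PG Ji] unfolding isometric_morphism_def by blast
    have Km: "K (s + t) (pmult F s t x y) = pmult G s t (K s x) (K t y)"
      if "s > 0" "t > 0" "x \<in> fibre F s" "y \<in> fibre F t" for s t x y
      using K that isometric_morphism_iff[OF PF PG Ki] unfolding isometric_morphism_def by blast
    have JK: "cinner (J t x) (K t y) = cinner x (u t) * cinner (v t) y"
      if t: "t > 0" and xy: "x \<in> fibre E t" "y \<in> fibre F t" for t x y
    proof -
      \<comment> \<open>\<open>adjoint_op\<close> is a definite description, so its given value says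
        something about inner products only after a vector with the adjoint property is exhibited
        and identified with it.\<close>
      obtain z where z: "z \<in> fibre E t" "\<And>k. k \<in> fibre E t \<Longrightarrow> cinner (J t k) (K t y) = cinner k z"
        using isometry_adjoint[OF tp.E.fibre_closed[OF t] Ji(1)[OF t], of "K t y"] by blast
      have "cinner z k = cinner (K t y) (J t k)" if "k \<in> fibre E t" for k
        using z(2)[OF that] by (metis cinner_commute)
      then have "z = rank_one u v t y"
        using adjoint_op_eqI[OF tp.E.fibre_closed[OF t] z(1), of "K t y" "J t"] adj[OF t xy(2)] by simp
      then show ?thesis using z(2)[OF xy(1)] by (simp add: rank_one_def cinner_scaleC_right mult.commute)
    qed
    have gen: "G.gen (\<lambda>t. J t ` fibre E t \<union> K t ` fibre F t) t = fibre G t" if "t > 0" for t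
      using Gt[OF that] unfolding join_subsystem_def generated_subsystem_eq_gen[OF PG] by simp
    obtain \<phi> where \<phi>: "\<And>t. t > 0 \<Longrightarrow> isometry_on (G.gen (\<lambda>t. J t ` fibre E t \<union> K t ` fibre F t) t) (\<phi> t)"
      "\<And>t. t > 0 \<Longrightarrow> \<phi> t ` G.gen (\<lambda>t. J t ` fibre E t \<union> K t ` fibre F t) t = tp.H.gen ?X t"
      "\<And>s t x y. s > 0 \<Longrightarrow> t > 0 \<Longrightarrow> x \<in> G.gen (\<lambda>t. J t ` fibre E t \<union> K t ` fibre F t) s \<Longrightarrow>
        y \<in> G.gen (\<lambda>t. J t ` fibre E t \<union> K t ` fibre F t) t \<Longrightarrow>
        \<phi> (s + t) (pmult G s t x y) = pmult EF s t (\<phi> s x) (\<phi> t y)"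
      by (rule tp.amalgam_isomorphism[OF G.mult_system_axioms u v Ji Jm Ki Km JK]) iprover+
    have iso: "isometry_on (fibre G t) (\<phi> t)" and img: "\<phi> t ` fibre G t = R t" if "t > 0" for t
      using \<phi>(1,2)[OF that] gen[OF that] RS[OF that] Sgen by auto
    note PR = restrict_system_product_system[OF PEF Rsub]
    have "\<phi> (s + t) (pmult G s t x y) = pmult (restrict_system EF R) s t (\<phi> s x) (\<phi> t y)"
      if st: "s > 0" "t > 0" and xy: "x \<in> fibre G s" "y \<in> fibre G t" for s t x y
    proof -
      have "\<phi> s x \<in> R s" "\<phi> t y \<in> R t" using img[OF st(1)] img[OF st(2)] xy by auto
      then show ?thesis using \<phi>(3)[OF st] xy gen[OF st(1)] gen[OF st(2)] by (simp add: PR(2)[OF st])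
    qed
    moreover have "morphism G (restrict_system EF R) \<phi> \<longleftrightarrow> (\<forall>s>0. \<forall>t>0. \<forall>x\<in>fibre G s. \<forall>y\<in>fibre G t.
        \<phi> (s + t) (pmult G s t x y) = pmult (restrict_system EF R) s t (\<phi> s x) (\<phi> t y))"
      using img by (intro isometric_morphism_iff[OF PG PR(1)] iso) auto
    ultimately have "morphism G (restrict_system EF R) \<phi>" by blast
    moreover have "unitary_op (fibre G t) (fibre (restrict_system EF R) t) (\<phi> t)" if "t > 0" for t
      using img[OF that] by (intro unitary_opI G.fibre_closed iso that) simp
    ultimately show ?thesis unfolding isomorphic_def by blast
  qed
  ultimately show ?thesis
    unfolding Let_def EF_def[symmetric] R_def[symmetric] using Rsub by blast
qed

end
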